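(* Let $q\in\Bbbk^\times$ with $q\ne\pm1$ and assume $m\ge 3$. Then the generalized Taft algebra $T_n(\lambda,m,0)$ acts on $\mathcal O_q(M_2(\Bbbk))$ with $x$ acting linearly and nonzero, and with $g$ acting as an element of $\mathcal H\rtimes\langle\tau\rangle$, if and only if - $\lambda=q^{\pm2}$ and $\operatorname{ord}(q)\mid n$, or - $\lambda=q^{\pm4}$ and $\operatorname{ord}(q^2)\mid n$. The actions are exactly those in the following lists, where the action of $g$ is specified by a rank one matrix $(\alpha_{ij})$ via $g\cdot Y_{ij}=\alpha_{ij}Y_{ij}$, $x$ acts as zero on each generator not listed, and $\gamma,\delta,\epsilon\in\Bbbk$. For any $q$: (1) $\lambda=q^2$, $g=\begin{pmatrix} q & q^{-1} \\ q & q^{-1} \end{pmatrix}$, $x\cdot B=\delta A$, $x\cdot D=\delta C$, $\delta\ne0$; (2) $\lambda=q^2$, $g=\begin{pmatrix} q & q \\ q^{-1} & q^{-1} \end{pmatrix}$, $x\cdot C=\delta A$, $x\cdot D=\delta B$, $\delta\ne0$; (3) $\lambda=q^2$, $g=\begin{pmatrix} q^{-3} & q^{-1} \\ q^{-1} & q \end{pmatrix}$, $x\cdot A=\delta B+\epsilon C$, $\delta\ne0$ or $\epsilon\ne0$; (4) $\lambda=q^{-2}$, $g=\begin{pmatrix} q & q^{-1} \\ q & q^{-1} \end{pmatrix}$, $x\cdot A=\delta B$, $x\cdot C=\delta D$, $\delta\ne0$; (5) $\lambda=q^{-2}$, $g=\begin{pmatrix} q & q \\ q^{-1} & q^{-1}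 \end{pmatrix}$, $x\cdot A=\delta C$, $x\cdot B=\delta D$, $\delta\ne0$; (6) $\lambda=q^{-2}$, $g=\begin{pmatrix} q^{-1} & q \\ q & q^{3} \end{pmatrix}$, $x\cdot D=\delta B+\epsilon C$, $\delta\ne0$ or $\epsilon\ne0$; (7) $\lambda=q^4$, $g=\begin{pmatrix} q^{-4} & q^{-2} \\ q^{-2} & 1 \end{pmatrix}$, $x\cdot A=\delta D$, $\delta\ne0$; (8) $\lambda=q^{-4}$, $g=\begin{pmatrix} 1 & q^2 \\ q^2 & q^4 \end{pmatrix}$, $x\cdot D=\delta A$, $\delta\ne0$. If $\operatorname{ord}(q)=3$, additionally, with $\gamma,\delta,\epsilon$ not all zero: (i) $\lambda=q^2$, $g=\begin{pmatrix} 1 & q^{-1} \\ q^{-1} & q \end{pmatrix}$, $x\cdot D=\gamma A$, $x\cdot A=\delta B+\epsilon C$; (ii) $\lambda=q^{-2}$, $g=\begin{pmatrix} q^{-1} & q \\ q & 1 \end{pmatrix}$, $x\cdot A=\gamma D$, $x\cdot D=\delta B+\epsilon C$.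
   Context: $\Bbbk$ is an algebraically closed field of characteristic zero; $\operatorname{ord}$ denotes multiplicative order. $\mathcal O_q(M_2(\Bbbk))$ is the algebra generated by $A=Y_{11},B=Y_{12},C=Y_{21},D=Y_{22}$ with relations $AB=qBA$, $AC=qCA$, $BD=qDB$, $CD=qDC$, $BC=CB$, $AD=DA+(q-q^{-1})BC$; it is graded with generators in degree one. $\mathcal H\cong(\Bbbk^\times)^3$ is the group of automorphisms of the form $Y_{ij}\mapsto\alpha_{ij}Y_{ij}$ where $(\alpha_{ij})$ is a $2\times2$ matrix of rank one with no zero entries; $\tau$ is the automorphism $Y_{ij}\mapsto Y_{ji}$. Generalized Taft algebra: for $m\mid n$ and $\lambda$ a primitive $m$th root of unity, $T_n(\lambda,m,0)$ is the Hopf algebra generated by a grouplike $g$ and $x$ with $\Delta(x)=g\otimes x+x\otimes1$, with relations $g^n=1$, $x^m=0$, $gx=\lambda xg$. It acts on an algebra $R$ if $R$ is a left $T_n(\lambda,m,0)$-module algebra. "$x$ acts linearly and nonzero" means $x$ maps $\operatorname{Span}_\Bbbk\{A,B,C,D\}$ into itself and does not act as zero. *)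

theory Defs
  imports
    "HOL-Analysis.Determinants"
    "HOL-Algebra.Algebraic_Closure_Type"
    "HOL-Algebra.Bij"
    "HOL-Library.Poly_Mapping"
    "HOL-Library.Product_Plus"
begin

section \<open>Free algebras and presented algebras\<close>

datatype 'g fword = FWord (letters: "'g list")

text \<open>
  \<^typ>\<open>'g fword\<close> is the free monoid on \<^typ>\<open>'g\<close>, written additively because \<^typ>\<open>'a \<Rightarrow>\<^sub>0 'k\<close> is the
  monoid algebra of an additively written monoid.  Thus \<^typ>\<open>'g fword \<Rightarrow>\<^sub>0 'k\<close> is the free algebra
  \<open>F = k\<langle>g\<rangle>\<close>, and \<^typ>\<open>'g fword \<times> 'g fword \<Rightarrow>\<^sub>0 'k\<close> is \<open>F \<otimes> F\<close> with the pairs of words \<open>(u, v)\<close> standing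
  for the basis elements \<open>u \<otimes> v\<close>.
\<close>

instantiation fword :: (type) monoid_add
begin

definition zero_fword :: "'g fword" where
  "zero_fword = FWord []"

definition plus_fword :: "'g fword \<Rightarrow> 'g fword \<Rightarrow> 'g fword" where
  "plus_fword v w = FWord (letters v @ letters w)"

instance
  by standard (simp_all add: zero_fword_def plus_fword_def)

end

definition letter :: "'g \<Rightarrow> ('g fword \<Rightarrow>\<^sub>0 'k::zero_neq_one)" where
  "letter a = Poly_Mapping.single (FWord [a]) 1"

definition scalar :: "'k::zero \<Rightarrow> ('m::zero \<Rightarrow>\<^sub>0 'k)" where
  "scalar c = Poly_Mapping.single 0 c"

text \<open>The extension of a map \<open>\<phi>\<close> on generators to an algebra homomorphism on the free algebra;
  \<open>\<iota>\<close> is the structure map of the target algebra.\<close>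

definition free_hom :: "('k \<Rightarrow> 'r) \<Rightarrow> ('g \<Rightarrow> 'r) \<Rightarrow> ('g fword \<Rightarrow>\<^sub>0 'k::field) \<Rightarrow> 'r::ring_1" where
  "free_hom \<iota> \<phi> f = (\<Sum>w\<in>Poly_Mapping.keys f. \<iota> (Poly_Mapping.lookup f w) * prod_list (map \<phi> (letters w)))"

definition relation_ideal :: "('g fword \<Rightarrow>\<^sub>0 'k::field) set \<Rightarrow> ('g fword \<Rightarrow>\<^sub>0 'k) set" where
  "relation_ideal S = Idl\<^bsub>ring_of_type_algebra\<^esub> S"

definition presented :: "('g fword \<Rightarrow>\<^sub>0 'k::field) set \<Rightarrow> ('g fword \<Rightarrow>\<^sub>0 'k) set ring" where
  "presented S = ring_of_type_algebra Quot relation_ideal S"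

definition coset :: "('g fword \<Rightarrow>\<^sub>0 'k::field) set \<Rightarrow> ('g fword \<Rightarrow>\<^sub>0 'k) \<Rightarrow> ('g fword \<Rightarrow>\<^sub>0 'k) set" where
  "coset S f = relation_ideal S +>\<^bsub>ring_of_type_algebra\<^esub> f"

definition scale :: "('g fword \<Rightarrow>\<^sub>0 'k::field) set \<Rightarrow> 'k \<Rightarrow> ('g fword \<Rightarrow>\<^sub>0 'k) set \<Rightarrow> ('g fword \<Rightarrow>\<^sub>0 'k) set" where
  "scale S c r = coset S (scalar c) \<otimes>\<^bsub>presented S\<^esub> r"

definition linear_between ::
  "('g fword \<Rightarrow>\<^sub>0 'k::field) set \<Rightarrow> ('h fword \<Rightarrow>\<^sub>0 'k) set
    \<Rightarrow> (('g fword \<Rightarrow>\<^sub>0 'k) set \<Rightarrow> ('h fword \<Rightarrow>\<^sub>0 'k) set) \<Rightarrow> bool" where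
  "linear_between S S' \<phi> \<longleftrightarrow>
     \<phi> \<in> carrier (presented S) \<rightarrow> carrier (presented S') \<and>
     (\<forall>a\<in>carrier (presented S). \<forall>b\<in>carrier (presented S).
        \<phi> (a \<oplus>\<^bsub>presented S\<^esub> b) = \<phi> a \<oplus>\<^bsub>presented S'\<^esub> \<phi> b) \<and>
     (\<forall>c. \<forall>a\<in>carrier (presented S). \<phi> (scale S c a) = scale S' c (\<phi> a))"

definition algebra_auts ::
  "('g fword \<Rightarrow>\<^sub>0 'k::field) set \<Rightarrow> (('g fword \<Rightarrow>\<^sub>0 'k) set \<Rightarrow> ('g fword \<Rightarrow>\<^sub>0 'k) set) set" where
  "algebra_auts S =
     {\<phi> \<in> Bij (carrier (presented S)).
        \<phi> \<in> ring_hom (presented S) (presented S) \<and> linear_between S S \<phi>}"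


section \<open>Module algebras over a presented bialgebra\<close>

text \<open>
  Let \<open>H\<close> be the algebra presented by \<open>S\<close>, with comultiplication and counit given on generators by
  \<open>\<delta>\<close> and \<open>\<epsilon>\<close>, and let \<open>R\<close> be the algebra presented by \<open>S'\<close>.  The predicate says that \<open>\<rho>\<close> makes \<open>R\<close>
  a left \<open>H\<close>-module with \<open>h \<cdot> 1 = \<epsilon>(h) 1\<close> and \<open>h \<cdot> (ab) = \<Sum> (h\<^sub>1 \<cdot> a)(h\<^sub>2 \<cdot> b)\<close>.  An element \<open>h\<close>
  is given by an arbitrary representative \<open>f\<close> in the free algebra, and \<open>\<Delta>(h)\<close> is the image in \<open>H \<otimes> H\<close>
  of the comultiplication of \<open>f\<close>; for a bialgebra this does not depend on the choice of \<open>f\<close>.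
  Actions are extensional functions, so that an action is determined by its values on the carriers.
\<close>

definition module_algebra ::
  "('g fword \<Rightarrow>\<^sub>0 'k::field) set \<Rightarrow> ('g \<Rightarrow> ('g fword \<times> 'g fword \<Rightarrow>\<^sub>0 'k)) \<Rightarrow> ('g \<Rightarrow> 'k)
    \<Rightarrow> ('h fword \<Rightarrow>\<^sub>0 'k) set
    \<Rightarrow> (('g fword \<Rightarrow>\<^sub>0 'k) set \<Rightarrow> ('h fword \<Rightarrow>\<^sub>0 'k) set \<Rightarrow> ('h fword \<Rightarrow>\<^sub>0 'k) set) \<Rightarrow> bool" where
  "module_algebra S \<delta> \<epsilon> S' \<rho> \<longleftrightarrow>
    (let H = presented S; R = presented S' in
     \<rho> \<in> carrier H \<rightarrow>\<^sub>E (carrier R \<rightarrow>\<^sub>E carrier R) \<and>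
     (\<forall>h\<in>carrier H. linear_between S' S' (\<rho> h)) \<and>
     (\<forall>r\<in>carrier R. linear_between S S' (\<lambda>h. \<rho> h r)) \<and>
     (\<forall>r\<in>carrier R. \<rho> \<one>\<^bsub>H\<^esub> r = r) \<and>
     (\<forall>h\<in>carrier H. \<forall>h'\<in>carrier H. \<forall>r\<in>carrier R. \<rho> (h \<otimes>\<^bsub>H\<^esub> h') r = \<rho> h (\<rho> h' r)) \<and>
     (\<forall>f. \<rho> (coset S f) \<one>\<^bsub>R\<^esub> = scale S' (free_hom id \<epsilon> f) \<one>\<^bsub>R\<^esub>) \<and>
     (\<forall>f. \<forall>a\<in>carrier R. \<forall>b\<in>carrier R.
        \<rho> (coset S f) (a \<otimes>\<^bsub>R\<^esub> b) =
        (\<Oplus>\<^bsub>R\<^esub>p\<in>Poly_Mapping.keys (free_hom scalar \<delta> f).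
           scale S' (Poly_Mapping.lookup (free_hom scalar \<delta> f) p)
             (\<rho> (coset S (Poly_Mapping.single (fst p) 1)) a \<otimes>\<^bsub>R\<^esub>
              \<rho> (coset S (Poly_Mapping.single (snd p) 1)) b))))"


section \<open>Generalized Taft algebras\<close>

datatype taft_gen = Gr | Sk

definition taft_relations :: "nat \<Rightarrow> 'k::field \<Rightarrow> nat \<Rightarrow> (taft_gen fword \<Rightarrow>\<^sub>0 'k) set" where
  "taft_relations n lam m =
    (let g = letter Gr; x = letter Sk in
      {g ^ n - 1, x ^ m, g * x - scalar lam * x * g})"

fun taft_comult :: "taft_gen \<Rightarrow> (taft_gen fword \<times> taft_gen fword \<Rightarrow>\<^sub>0 'k::field)" where
  "taft_comult Gr = Poly_Mapping.single (FWord [Gr], FWord [Gr]) 1"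
| "taft_comult Sk = Poly_Mapping.single (FWord [Gr], FWord [Sk]) 1
                  + Poly_Mapping.single (FWord [Sk], FWord []) 1"

fun taft_counit :: "taft_gen \<Rightarrow> 'k::field" where
  "taft_counit Gr = 1"
| "taft_counit Sk = 0"


section \<open>Quantum matrices\<close>

text \<open>The generators \<open>Y\<^sub>i\<^sub>j\<close> are indexed by pairs over the two-element type \<^typ>\<open>2\<close>, whose elements are
  \<open>1\<close> and \<open>2\<close>.\<close>

definition qmat_relations :: "'k::field \<Rightarrow> ((2 \<times> 2) fword \<Rightarrow>\<^sub>0 'k) set" where
  "qmat_relations q =
    (let A = letter (1, 1); B = letter (1, 2); C = letter (2, 1); D = letter (2, 2) in
      {A * B - scalar q * B * A,
       A * C - scalar q * C * A,
       B * D - scalar q * D * B,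
       C * D - scalar q * D * C,
       B * C - C * B,
       A * D - (D * A + scalar (q - inverse q) * B * C)})"

abbreviation Oq :: "'k::field \<Rightarrow> ((2 \<times> 2) fword \<Rightarrow>\<^sub>0 'k) set ring" where
  "Oq q \<equiv> presented (qmat_relations q)"

abbreviation smult_Oq :: "'k::field \<Rightarrow> 'k \<Rightarrow> ((2 \<times> 2) fword \<Rightarrow>\<^sub>0 'k) set \<Rightarrow> ((2 \<times> 2) fword \<Rightarrow>\<^sub>0 'k) set" where
  "smult_Oq q \<equiv> scale (qmat_relations q)"

definition Y :: "'k::field \<Rightarrow> 2 \<Rightarrow> 2 \<Rightarrow> ((2 \<times> 2) fword \<Rightarrow>\<^sub>0 'k) set" where
  "Y q i j = coset (qmat_relations q) (letter (i, j))"

definition gen_span :: "'k::field \<Rightarrow> ((2 \<times> 2) fword \<Rightarrow>\<^sub>0 'k) set set" where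
  "gen_span q =
    range (\<lambda>c :: 2 \<times> 2 \<Rightarrow> 'k. \<Oplus>\<^bsub>Oq q\<^esub>p\<in>UNIV. smult_Oq q (c p) (Y q (fst p) (snd p)))"

definition torus :: "'k::field \<Rightarrow> (((2 \<times> 2) fword \<Rightarrow>\<^sub>0 'k) set \<Rightarrow> ((2 \<times> 2) fword \<Rightarrow>\<^sub>0 'k) set) set" where
  "torus q =
    {\<phi> \<in> algebra_auts (qmat_relations q).
       \<exists>\<alpha> :: 'k^2^2. rank \<alpha> = 1 \<and> (\<forall>i j. \<alpha> $ i $ j \<noteq> 0) \<and>
         (\<forall>i j. \<phi> (Y q i j) = smult_Oq q (\<alpha> $ i $ j) (Y q i j))}"

definition transposition :: "'k::field \<Rightarrow> ((2 \<times> 2) fword \<Rightarrow>\<^sub>0 'k) set \<Rightarrow> ((2 \<times> 2) fword \<Rightarrow>\<^sub>0 'k) set" where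
  "transposition q =
    (THE \<phi>. \<phi> \<in> algebra_auts (qmat_relations q) \<and> (\<forall>i j. \<phi> (Y q i j) = Y q j i))"

text \<open>The internal semidirect product of \<^term>\<open>torus q\<close> and the subgroup generated by
  \<^term>\<open>transposition q\<close>, inside the group of bijections of \<^term>\<open>Oq q\<close>.\<close>

definition torus_transposition ::
  "'k::field \<Rightarrow> (((2 \<times> 2) fword \<Rightarrow>\<^sub>0 'k) set \<Rightarrow> ((2 \<times> 2) fword \<Rightarrow>\<^sub>0 'k) set) set" where
  "torus_transposition q =
    (let G = BijGroup (carrier (Oq q)) in torus q <#>\<^bsub>G\<^esub> generate G {transposition q})"


section \<open>Taft algebra actions on quantum matrices\<close>

definition taft_g :: "nat \<Rightarrow> 'k::field \<Rightarrow> nat \<Rightarrow> (taft_gen fword \<Rightarrow>\<^sub>0 'k) set" where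
  "taft_g n lam m = coset (taft_relations n lam m) (letter Gr)"

definition taft_x :: "nat \<Rightarrow> 'k::field \<Rightarrow> nat \<Rightarrow> (taft_gen fword \<Rightarrow>\<^sub>0 'k) set" where
  "taft_x n lam m = coset (taft_relations n lam m) (letter Sk)"

definition taft_actions ::
  "'k::field \<Rightarrow> nat \<Rightarrow> 'k \<Rightarrow> nat
    \<Rightarrow> ((taft_gen fword \<Rightarrow>\<^sub>0 'k) set
         \<Rightarrow> ((2 \<times> 2) fword \<Rightarrow>\<^sub>0 'k) set \<Rightarrow> ((2 \<times> 2) fword \<Rightarrow>\<^sub>0 'k) set) set" where
  "taft_actions q n lam m =
    {\<rho>. module_algebra (taft_relations n lam m) taft_comult taft_counit (qmat_relations q) \<rho> \<and>
        (\<forall>v\<in>gen_span q. \<rho> (taft_x n lam m) v \<in> gen_span q) \<and>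
        (\<exists>r\<in>carrier (Oq q). \<rho> (taft_x n lam m) r \<noteq> \<zero>\<^bsub>Oq q\<^esub>) \<and>
        \<rho> (taft_g n lam m) \<in> torus_transposition q}"

text \<open>The images of the generators \<open>Y\<^sub>i\<^sub>j\<close> under \<open>g\<close> and under \<open>x\<close>.\<close>

definition generator_images ::
  "'k::field \<Rightarrow> nat \<Rightarrow> 'k \<Rightarrow> nat
    \<Rightarrow> ((taft_gen fword \<Rightarrow>\<^sub>0 'k) set
         \<Rightarrow> ((2 \<times> 2) fword \<Rightarrow>\<^sub>0 'k) set \<Rightarrow> ((2 \<times> 2) fword \<Rightarrow>\<^sub>0 'k) set)
    \<Rightarrow> (2 \<Rightarrow> 2 \<Rightarrow> ((2 \<times> 2) fword \<Rightarrow>\<^sub>0 'k) set) \<times> (2 \<Rightarrow> 2 \<Rightarrow> ((2 \<times> 2) fword \<Rightarrow>\<^sub>0 'k) set)" where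
  "generator_images q n lam m \<rho> =
    (\<lambda>i j. \<rho> (taft_g n lam m) (Y q i j), \<lambda>i j. \<rho> (taft_x n lam m) (Y q i j))"

definition table :: "'a \<Rightarrow> 'a \<Rightarrow> 'a \<Rightarrow> 'a \<Rightarrow> 2 \<Rightarrow> 2 \<Rightarrow> 'a" where
  "table a b c d i j = (if i = 1 then if j = 1 then a else b else if j = 1 then c else d)"

definition diag_g :: "'k::field \<Rightarrow> 'k \<Rightarrow> 'k \<Rightarrow> 'k \<Rightarrow> 'k \<Rightarrow> 2 \<Rightarrow> 2 \<Rightarrow> ((2 \<times> 2) fword \<Rightarrow>\<^sub>0 'k) set" where
  "diag_g q a b c d = (\<lambda>i j. smult_Oq q (table a b c d i j) (Y q i j))"

definition mult_ord :: "'k::field \<Rightarrow> nat" where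
  "mult_ord a = group.ord (units_of ring_of_type_algebra) a"

text \<open>
  In each entry the first component lists the images of \<open>A, B, C, D\<close> under \<open>g\<close> and the second
  one their images under \<open>x\<close>.  The divisibility hypotheses say that \<open>g ^ n = 1\<close>; they must be attached
  to the individual entries, because the possible values of \<open>lam\<close> need not be distinct: if
  \<open>mult_ord q = 6\<close> and \<open>n = 3\<close>, then \<open>lam = q\<^sup>2 = q\<^sup>-\<^sup>4\<close> occurs in \<open>entry_8\<close> but not
  in \<open>entry_1\<close>.
\<close>

inductive_set action_list ::
  "'k::field \<Rightarrow> nat \<Rightarrow> 'k
    \<Rightarrow> ((2 \<Rightarrow> 2 \<Rightarrow> ((2 \<times> 2) fword \<Rightarrow>\<^sub>0 'k) set) \<times> (2 \<Rightarrow> 2 \<Rightarrow> ((2 \<times> 2) fword \<Rightarrow>\<^sub>0 'k) set)) set"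
  for q :: 'k and n :: nat and lam :: 'k where
  entry_1:
    "\<lbrakk>lam = q powi 2; mult_ord q dvd n; \<delta> \<noteq> 0\<rbrakk> \<Longrightarrow>
     (diag_g q q (q powi -1) q (q powi -1),
      table \<zero>\<^bsub>Oq q\<^esub> (smult_Oq q \<delta> (Y q 1 1)) \<zero>\<^bsub>Oq q\<^esub> (smult_Oq q \<delta> (Y q 2 1)))
     \<in> action_list q n lam"
| entry_2:
    "\<lbrakk>lam = q powi 2; mult_ord q dvd n; \<delta> \<noteq> 0\<rbrakk> \<Longrightarrow>
     (diag_g q q q (q powi -1) (q powi -1),
      table \<zero>\<^bsub>Oq q\<^esub> \<zero>\<^bsub>Oq q\<^esub> (smult_Oq q \<delta> (Y q 1 1)) (smult_Oq q \<delta> (Y q 1 2)))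
     \<in> action_list q n lam"
| entry_3:
    "\<lbrakk>lam = q powi 2; mult_ord q dvd n; \<delta> \<noteq> 0 \<or> \<epsilon> \<noteq> 0\<rbrakk> \<Longrightarrow>
     (diag_g q (q powi -3) (q powi -1) (q powi -1) q,
      table (smult_Oq q \<delta> (Y q 1 2) \<oplus>\<^bsub>Oq q\<^esub> smult_Oq q \<epsilon> (Y q 2 1)) \<zero>\<^bsub>Oq q\<^esub> \<zero>\<^bsub>Oq q\<^esub> \<zero>\<^bsub>Oq q\<^esub>)
     \<in> action_list q n lam"
| entry_4:
    "\<lbrakk>lam = q powi -2; mult_ord q dvd n; \<delta> \<noteq> 0\<rbrakk> \<Longrightarrow>
     (diag_g q q (q powi -1) q (q powi -1),
      table (smult_Oq q \<delta> (Y q 1 2)) \<zero>\<^bsub>Oq q\<^esub> (smult_Oq q \<delta> (Y q 2 2)) \<zero>\<^bsub>Oq q\<^esub>)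
     \<in> action_list q n lam"
| entry_5:
    "\<lbrakk>lam = q powi -2; mult_ord q dvd n; \<delta> \<noteq> 0\<rbrakk> \<Longrightarrow>
     (diag_g q q q (q powi -1) (q powi -1),
      table (smult_Oq q \<delta> (Y q 2 1)) (smult_Oq q \<delta> (Y q 2 2)) \<zero>\<^bsub>Oq q\<^esub> \<zero>\<^bsub>Oq q\<^esub>)
     \<in> action_list q n lam"
| entry_6:
    "\<lbrakk>lam = q powi -2; mult_ord q dvd n; \<delta> \<noteq> 0 \<or> \<epsilon> \<noteq> 0\<rbrakk> \<Longrightarrow>
     (diag_g q (q powi -1) q q (q powi 3),
      table \<zero>\<^bsub>Oq q\<^esub> \<zero>\<^bsub>Oq q\<^esub> \<zero>\<^bsub>Oq q\<^esub> (smult_Oq q \<delta> (Y q 1 2) \<oplus>\<^bsub>Oq q\<^esub> smult_Oq q \<epsilon> (Y q 2 1)))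
     \<in> action_list q n lam"
| entry_7:
    "\<lbrakk>lam = q powi 4; mult_ord (q powi 2) dvd n; \<delta> \<noteq> 0\<rbrakk> \<Longrightarrow>
     (diag_g q (q powi -4) (q powi -2) (q powi -2) 1,
      table (smult_Oq q \<delta> (Y q 2 2)) \<zero>\<^bsub>Oq q\<^esub> \<zero>\<^bsub>Oq q\<^esub> \<zero>\<^bsub>Oq q\<^esub>)
     \<in> action_list q n lam"
| entry_8:
    "\<lbrakk>lam = q powi -4; mult_ord (q powi 2) dvd n; \<delta> \<noteq> 0\<rbrakk> \<Longrightarrow>
     (diag_g q 1 (q powi 2) (q powi 2) (q powi 4),
      table \<zero>\<^bsub>Oq q\<^esub> \<zero>\<^bsub>Oq q\<^esub> \<zero>\<^bsub>Oq q\<^esub> (smult_Oq q \<delta> (Y q 1 1)))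
     \<in> action_list q n lam"
| entry_i:
    "\<lbrakk>mult_ord q = 3; lam = q powi 2; mult_ord q dvd n; \<gamma> \<noteq> 0 \<or> \<delta> \<noteq> 0 \<or> \<epsilon> \<noteq> 0\<rbrakk> \<Longrightarrow>
     (diag_g q 1 (q powi -1) (q powi -1) q,
      table (smult_Oq q \<delta> (Y q 1 2) \<oplus>\<^bsub>Oq q\<^esub> smult_Oq q \<epsilon> (Y q 2 1)) \<zero>\<^bsub>Oq q\<^esub> \<zero>\<^bsub>Oq q\<^esub>
            (smult_Oq q \<gamma> (Y q 1 1)))
     \<in> action_list q n lam"
| entry_ii:
    "\<lbrakk>mult_ord q = 3; lam = q powi -2; mult_ord q dvd n; \<gamma> \<noteq> 0 \<or> \<delta> \<noteq> 0 \<or> \<epsilon> \<noteq> 0\<rbrakk> \<Longrightarrow>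
     (diag_g q (q powi -1) q q 1,
      table (smult_Oq q \<gamma> (Y q 2 2)) \<zero>\<^bsub>Oq q\<^esub> \<zero>\<^bsub>Oq q\<^esub>
            (smult_Oq q \<delta> (Y q 1 2) \<oplus>\<^bsub>Oq q\<^esub> smult_Oq q \<epsilon> (Y q 2 1)))
     \<in> action_list q n lam"

end

theory Submission
  imports Defs
begin

text \<open>
  Let \<open>R\<close> be the algebra of quantum matrices and \<open>V\<close> the span of its generators.  An action of the Taft
  algebra on \<open>R\<close> is a pair of operators: an algebra endomorphism \<open>g\<close> with \<open>g\<^sup>n = 1\<close> and a skew derivation
  \<open>x\<close>, that is \<open>x(ab) = g(a) x(b) + x(a) b\<close>, with \<open>x\<^sup>m = 0\<close> and \<open>g x = lam x g\<close>.  Both are determined by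
  their values on the generators, so an action with \<open>x\<close> linear and \<open>g\<close> in the group generated by the torus
  and the transposition amounts to two \<open>4 \<times> 4\<close> matrices.  The theorem follows by finding the equations that
  these matrices have to satisfy and solving them.

  The equations are found in the free algebra \<open>F\<close> over the same generators.  Any two families of values on
  the generators extend to an endomorphism \<open>g\<close> of \<open>F\<close> and a skew derivation \<open>x\<close> of \<open>F\<close>
  (\<open>free_hom\<close>, \<open>skew_mult\<close>).  The relation \<open>g x = lam x g\<close> passes from the generators to \<open>F\<close>
  (\<open>free_hom_skew_commute\<close>), and then so does \<open>x\<^sup>m = 0\<close>: the Gaussian binomials \<open>binom(m, j)\<close> with
  \<open>0 < j < m\<close> vanish at a primitive \<open>m\<close>th root of unity, hence \<open>x\<^sup>m\<close> is a skew derivation for \<open>g\<^sup>m\<close>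
  (\<open>skew_funpow_eq_zero\<close>).  So \<open>F\<close> is itself a module algebra, and the action descends to \<open>R\<close> as soon as \<open>g\<close> and
  \<open>x\<close> send the six defining relations into the ideal that they generate
  (\<open>module_algebra_descended\<close>).  Conversely every action on \<open>R\<close> is induced in this way from its values on
  the generators (\<open>taft_action_eq_act\<close>), which also shows that those values determine it.

  The operator \<open>x\<close> sends a relation to a quadratic form, and the quadratic part of the ideal is the span of
  the six relations, which is cut out by ten linear equations (\<open>quad_form_in_relation_ideal_iff\<close>).  If \<open>g\<close> is
  diagonal, then \<open>g x = lam x g\<close> says that \<open>x\<close> maps the weight space of weight \<open>c\<close> to that of weight
  \<open>lam c\<close>.  Because \<open>m \<ge> 3\<close>, neither \<open>lam\<close> nor \<open>lam\<^sup>2\<close> is \<open>1\<close>, so the matrix of \<open>x\<close> has zero diagonal and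
  no two nonzero entries in transposed positions.  What remains is a system in which almost every equation
  has the form ``an entry is zero or a weight has a certain value'', and any nonzero entry fixes all weights;
  its solutions are the ten families of the list (\<open>weight_list_complete\<close>).  If \<open>g\<close> involves the
  transposition, then the same equations force \<open>x = 0\<close> (\<open>antidiagonal_no_skew\<close>).  In each of the ten
  families \<open>x\<close> lowers a rank with values in \<open>{0, 1, 2}\<close>, so \<open>x\<^sup>3 = 0\<close> on generators and all of them are
  realised (\<open>weight_list_realised\<close>).
\<close>

section \<open>The free algebra\<close>

lemma poly_mapping_span_induct [case_names single add]:
  assumes "\<And>w c. P (Poly_Mapping.single w c)" "\<And>f g. P f \<Longrightarrow> P g \<Longrightarrow> P (f + g)"
  shows "P (f :: 'w \<Rightarrow>\<^sub>0 'k::comm_monoid_add)"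
proof -
  have "P (\<Sum>w\<in>W. Poly_Mapping.single w (Poly_Mapping.lookup f w))" if "finite W" for W
    using that
  proof (induction W rule: finite_induct)
    case empty
    show ?case using assms(1)[of undefined 0] by simp
  qed (use assms in simp)
  moreover have "(\<Sum>w\<in>Poly_Mapping.keys f. Poly_Mapping.single w (Poly_Mapping.lookup f w)) = f"
    by (intro poly_mapping_eqI)
      (auto simp: lookup_sum lookup_single when_def in_keys_iff)
  ultimately show ?thesis by (metis finite_keys)
qed

lemma FWord_plus [simp]: "FWord u + FWord v = FWord (u @ v)"
  by (simp add: plus_fword_def)

lemma FWord_zero [simp]: "FWord [] = 0"
  by (simp add: zero_fword_def)

lemma letters_zero [simp]: "letters 0 = []"
  by (simp add: zero_fword_def del: FWord_zero)

lemma letters_plus [simp]: "letters (u + v) = letters u @ letters v"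
  by (simp add: plus_fword_def)

abbreviation word :: "'g list \<Rightarrow> ('g fword \<Rightarrow>\<^sub>0 'k::zero_neq_one)" where
  "word u \<equiv> Poly_Mapping.single (FWord u) 1"

lemma word_Cons: "word (y # w) = (letter y * word w :: _ \<Rightarrow>\<^sub>0 'k::field)"
  by (simp add: letter_def mult_single)

lemma scalar_0 [simp]: "scalar 0 = 0"
  by (simp add: scalar_def)

lemma scalar_1 [simp]: "scalar 1 = 1"
  by (simp add: scalar_def)

lemma scalar_add: "scalar (c + d) = scalar c + scalar d"
  by (simp add: scalar_def single_add)

lemma scalar_mult: "scalar (c * d :: 'k::semiring_0) = scalar c * scalar d"
  by (simp add: scalar_def mult_single)

lemma scalar_diff: "scalar (c - d :: 'k::ab_group_add) = scalar c - scalar d"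
  by (simp add: scalar_def single_diff)

lemma scalar_times_single: "scalar (c::'k::semiring_0) * Poly_Mapping.single w d = Poly_Mapping.single w (c * d)"
  by (simp add: scalar_def mult_single)

lemma scalar_central: "f * scalar c = scalar (c::'k::comm_semiring_0) * f"
proof (induction f rule: poly_mapping_span_induct)
  case (single w d)
  show ?case by (simp add: scalar_def mult_single mult.commute)
qed (simp add: distrib_left distrib_right)

lemma scalar_left_commute: "f * (scalar c * g) = scalar (c::'k::comm_semiring_0) * (f * g)"
  by (metis mult.assoc scalar_central)

lemma lookup_scalar_times [simp]:
  "Poly_Mapping.lookup (scalar c * f) w = (c::'k::semiring_0) * Poly_Mapping.lookup f w"
proof (induction f rule: poly_mapping_span_induct)
  case (single v d)
  then show ?case by (simp add: scalar_times_single lookup_single when_def)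
qed (simp add: distrib_left lookup_add)

text \<open>Homomorphisms out of a free algebra are needed with values in the free algebra itself, in the tensor square
  of the Taft algebra, and in the base field (for the counit).  The locale covers the scalars of all three.\<close>

locale structure_map =
  fixes \<iota> :: "'k::field \<Rightarrow> 'r::ring_1"
  assumes zero [simp]: "\<iota> 0 = 0" and one [simp]: "\<iota> 1 = 1"
    and add: "\<iota> (c + d) = \<iota> c + \<iota> d" and mult: "\<iota> (c * d) = \<iota> c * \<iota> d"
    and central: "r * \<iota> c = \<iota> c * r"

interpretation scalar: structure_map scalar
  by standard (simp, simp, rule scalar_add, rule scalar_mult, rule scalar_central)

interpretation ident: structure_map "id :: 'k \<Rightarrow> 'k::field"
  by standard simp_all

definition lin_ext :: "('k::field \<Rightarrow> 'r::ring_1) \<Rightarrow> ('w \<Rightarrow> 'r) \<Rightarrow> ('w \<Rightarrow>\<^sub>0 'k) \<Rightarrow> 'r" where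
  "lin_ext \<iota> u f = (\<Sum>w\<in>Poly_Mapping.keys f. \<iota> (Poly_Mapping.lookup f w) * u w)"

lemma free_hom_eq_lin_ext: "free_hom \<iota> \<phi> = lin_ext \<iota> (\<lambda>w. prod_list (map \<phi> (letters w)))"
  by (simp add: fun_eq_iff free_hom_def lin_ext_def)

context structure_map
begin

lemma lin_ext_single [simp]: "lin_ext \<iota> u (Poly_Mapping.single w c) = \<iota> c * u w"
  by (simp add: lin_ext_def)

lemma lin_ext_zero [simp]: "lin_ext \<iota> u 0 = 0"
  by (simp add: lin_ext_def)

lemma lin_ext_add: "lin_ext \<iota> u (f + g) = lin_ext \<iota> u f + lin_ext \<iota> u g"
  unfolding lin_ext_def by (rule setsum_keys_plus_distrib) (simp_all add: add distrib_right)

lemma lin_ext_one [simp]: "lin_ext \<iota> u 1 = u 0"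
  using lin_ext_single[of u 0 1] by simp

lemma lin_ext_scale: "lin_ext \<iota> u (scalar c * f) = \<iota> c * lin_ext \<iota> u f"
proof (induction f rule: poly_mapping_span_induct)
  case (single w d)
  show ?case by (simp add: scalar_times_single mult mult.assoc)
qed (simp add: distrib_left lin_ext_add)

lemma free_hom_single: "free_hom \<iota> \<phi> (Poly_Mapping.single w c) = \<iota> c * prod_list (map \<phi> (letters w))"
  by (simp add: free_hom_eq_lin_ext)

lemma free_hom_letter [simp]: "free_hom \<iota> \<phi> (letter y) = \<phi> y"
  by (simp add: letter_def free_hom_single)

lemma free_hom_zero [simp]: "free_hom \<iota> \<phi> 0 = 0"
  by (simp add: free_hom_eq_lin_ext)

lemma free_hom_one [simp]: "free_hom \<iota> \<phi> 1 = 1"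
  by (simp add: free_hom_single flip: single_one)

lemma free_hom_add: "free_hom \<iota> \<phi> (f + g) = free_hom \<iota> \<phi> f + free_hom \<iota> \<phi> g"
  by (simp add: free_hom_eq_lin_ext lin_ext_add)

lemma free_hom_scale: "free_hom \<iota> \<phi> (scalar c * f) = \<iota> c * free_hom \<iota> \<phi> f"
  by (simp add: free_hom_eq_lin_ext lin_ext_scale)

lemma free_hom_scalar [simp]: "free_hom \<iota> \<phi> (scalar c) = \<iota> c"
  using free_hom_scale[of \<phi> c 1] by simp

lemma free_hom_mult: "free_hom \<iota> \<phi> (f * g) = free_hom \<iota> \<phi> f * free_hom \<iota> \<phi> g"
proof (induction f rule: poly_mapping_span_induct)
  case (single w c)
  show ?case
  proof (induction g rule: poly_mapping_span_induct)
    case (single v d)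
    have "\<iota> d * (x * y) = x * (\<iota> d * y)" for x y
      using central[of x d] by (simp flip: mult.assoc)
    then show ?case by (simp add: mult_single free_hom_single mult mult.assoc)
  qed (simp add: distrib_left free_hom_add)
qed (simp add: distrib_right free_hom_add)

end

text \<open>Source and target may have different monoids of words, so that for a module both \<open>r \<mapsto> h \<cdot> r\<close> and
  \<open>h \<mapsto> h \<cdot> r\<close> are instances.\<close>

definition linear_op :: "(('w::monoid_add \<Rightarrow>\<^sub>0 'k::field) \<Rightarrow> ('v::monoid_add \<Rightarrow>\<^sub>0 'k)) \<Rightarrow> bool" where
  "linear_op T \<longleftrightarrow> (\<forall>f g. T (f + g) = T f + T g) \<and> (\<forall>c f. T (scalar c * f) = scalar c * T f)"

lemma linear_op_add: "linear_op T \<Longrightarrow> T (f + g) = T f + T g"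
  and linear_op_scale: "linear_op T \<Longrightarrow> T (scalar c * f) = scalar c * T f"
  by (simp_all add: linear_op_def)

lemma linear_op_zero: "linear_op T \<Longrightarrow> T 0 = 0"
  using linear_op_scale[of T 0 0] by simp

lemma linear_op_minus: "linear_op T \<Longrightarrow> T (- f) = - T f"
  using linear_op_add[of T f "- f"] linear_op_zero[of T] by (simp add: eq_neg_iff_add_eq_0 add.commute)

lemma linear_op_diff: "linear_op T \<Longrightarrow> T (f - g) = T f - T g"
  using linear_op_add[of T f "- g"] linear_op_minus[of T] by simp

lemma linear_op_sum: "linear_op T \<Longrightarrow> T (sum h J) = (\<Sum>j\<in>J. T (h j))"
  by (induction J rule: infinite_finite_induct) (simp_all add: linear_op_zero linear_op_add)

lemma linear_op_lin_ext: "linear_op (lin_ext scalar u)"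
  by (simp add: linear_op_def scalar.lin_ext_add scalar.lin_ext_scale)

lemma linear_op_free_hom: "linear_op (free_hom scalar \<phi>)"
  by (simp add: free_hom_eq_lin_ext linear_op_lin_ext)

lemma linear_op_id: "linear_op (\<lambda>f. f)"
  by (simp add: linear_op_def)

lemma linear_op_comp: "linear_op S \<Longrightarrow> linear_op T \<Longrightarrow> linear_op (\<lambda>f. S (T f))"
  by (simp add: linear_op_def)

lemma linear_op_times_left: "linear_op T \<Longrightarrow> linear_op (\<lambda>f. h * T f)"
  by (simp add: linear_op_def distrib_left scalar_left_commute)

lemma linear_op_times_right: "linear_op T \<Longrightarrow> linear_op (\<lambda>f. T f * h)"
  by (simp add: linear_op_def distrib_right mult.assoc)

lemma linear_op_plus: "linear_op S \<Longrightarrow> linear_op T \<Longrightarrow> linear_op (\<lambda>f. S f + T f)"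
  by (simp add: linear_op_def distrib_left add_ac)

lemma linear_op_setsum: "(\<And>j. j \<in> J \<Longrightarrow> linear_op (T j)) \<Longrightarrow> linear_op (\<lambda>f. \<Sum>j\<in>J. T j f)"
  by (simp add: linear_op_def sum.distrib sum_distrib_left)

lemma linear_op_funpow:
  fixes T :: "('w::monoid_add \<Rightarrow>\<^sub>0 'k::field) \<Rightarrow> ('w \<Rightarrow>\<^sub>0 'k)"
  shows "linear_op T \<Longrightarrow> linear_op (T ^^ k)"
  by (induction k) (simp_all add: linear_op_def)

lemma linear_op_eq_on_words:
  assumes "linear_op S" "linear_op T" "\<And>w. S (word w) = T (word w)"
  shows "S f = T f"
proof (induction f rule: poly_mapping_span_induct)
  case (single w c)
  have "Poly_Mapping.single w c = scalar c * word (letters w)"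
    by (simp add: scalar_times_single)
  then show ?case using assms(3)[of "letters w"] by (simp add: linear_op_scale assms(1,2))
qed (use assms in \<open>simp add: linear_op_add\<close>)

section \<open>Skew derivations of the free algebra\<close>

text \<open>The rule \<open>x(ab) = g(a) x(b) + x(a) b\<close> with \<open>a\<close> a single letter leaves no choice for \<open>x\<close> on words.\<close>

fun skew_word :: "('g \<Rightarrow> ('g fword \<Rightarrow>\<^sub>0 'k::field)) \<Rightarrow> ('g \<Rightarrow> ('g fword \<Rightarrow>\<^sub>0 'k)) \<Rightarrow> 'g list \<Rightarrow> ('g fword \<Rightarrow>\<^sub>0 'k)" where
  "skew_word \<gamma> \<xi> [] = 0"
| "skew_word \<gamma> \<xi> (y # w) = \<gamma> y * skew_word \<gamma> \<xi> w + \<xi> y * word w"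

definition skew :: "('g \<Rightarrow> ('g fword \<Rightarrow>\<^sub>0 'k::field)) \<Rightarrow> ('g \<Rightarrow> ('g fword \<Rightarrow>\<^sub>0 'k)) \<Rightarrow> ('g fword \<Rightarrow>\<^sub>0 'k) \<Rightarrow> ('g fword \<Rightarrow>\<^sub>0 'k)" where
  "skew \<gamma> \<xi> = lin_ext scalar (\<lambda>w. skew_word \<gamma> \<xi> (letters w))"

lemma linear_op_skew: "linear_op (skew \<gamma> \<xi>)"
  by (simp add: skew_def linear_op_lin_ext)

lemma skew_letter [simp]: "skew \<gamma> \<xi> (letter y) = \<xi> y"
  by (simp add: skew_def letter_def)

lemma skew_one [simp]: "skew \<gamma> \<xi> 1 = 0"
  by (simp add: skew_def)

lemma skew_scalar [simp]: "skew \<gamma> \<xi> (scalar c) = 0"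
  using linear_op_scale[OF linear_op_skew, of \<gamma> \<xi> c 1] by simp

lemma skew_word_append:
  "skew_word \<gamma> \<xi> (v @ w) = prod_list (map \<gamma> v) * skew_word \<gamma> \<xi> w + skew_word \<gamma> \<xi> v * word w"
proof (induction v)
  case (Cons y v)
  have *: "word (v @ w) = word v * (word w :: _ \<Rightarrow>\<^sub>0 'b)"
    by (simp add: mult_single)
  show ?case by (simp add: Cons * distrib_left distrib_right mult.assoc add.assoc flip: word_Cons)
qed simp

lemma skew_mult: "skew \<gamma> \<xi> (f * g) = free_hom scalar \<gamma> f * skew \<gamma> \<xi> g + skew \<gamma> \<xi> f * g"
proof (rule linear_op_eq_on_words[where f = f])
  show "linear_op (\<lambda>f. skew \<gamma> \<xi> (f * g))"
    by (intro linear_op_comp[OF linear_op_skew] linear_op_times_right linear_op_id)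
  show "linear_op (\<lambda>f. free_hom scalar \<gamma> f * skew \<gamma> \<xi> g + skew \<gamma> \<xi> f * g)"
    by (intro linear_op_plus linear_op_times_right linear_op_free_hom linear_op_skew)
  fix v :: "'a list"
  show "skew \<gamma> \<xi> (word v * g) = free_hom scalar \<gamma> (word v) * skew \<gamma> \<xi> g + skew \<gamma> \<xi> (word v) * g"
  proof (rule linear_op_eq_on_words[where f = g])
    show "linear_op (\<lambda>g. skew \<gamma> \<xi> (word v * g))"
      by (intro linear_op_comp[OF linear_op_skew] linear_op_times_left linear_op_id)
    show "linear_op (\<lambda>g. free_hom scalar \<gamma> (word v) * skew \<gamma> \<xi> g + skew \<gamma> \<xi> (word v) * g)"
      by (intro linear_op_plus linear_op_times_left linear_op_skew linear_op_id)
    show "skew \<gamma> \<xi> (word v * word w)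
        = free_hom scalar \<gamma> (word v) * skew \<gamma> \<xi> (word w) + skew \<gamma> \<xi> (word v) * word w" for w
      by (simp add: skew_def mult_single scalar.free_hom_single skew_word_append)
  qed
qed

section \<open>Presented algebras as quotients of free algebras\<close>

lemma ring_of_type_algebra_simps [simp]:
  "carrier ring_of_type_algebra = UNIV"
  "monoid.mult ring_of_type_algebra = (*)"
  "\<one>\<^bsub>ring_of_type_algebra\<^esub> = 1"
  "\<zero>\<^bsub>ring_of_type_algebra\<^esub> = 0"
  "add ring_of_type_algebra = (+)"
  by (simp_all add: ring_of_type_algebra_def fun_eq_iff)

lemma ring_ring_of_type_algebra: "ring (ring_of_type_algebra :: 'a::ring_1 ring)"
proof -
  have "\<exists>y. x + y = 0" for x :: 'a
    using add.right_inverse by blast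
  then show ?thesis
    unfolding ring_of_type_algebra_def using add.right_inverse
    by unfold_locales (auto simp: algebra_simps Units_def)
qed

lemma ideal_relation_ideal: "ideal (relation_ideal S) ring_of_type_algebra"
  unfolding relation_ideal_def by (rule ring.genideal_ideal) (auto intro: ring_ring_of_type_algebra)

lemma relation_ideal_zero: "0 \<in> relation_ideal S"
  using additive_subgroup.zero_closed[OF ideal.axioms(1)[OF ideal_relation_ideal[of S]]] by simp

lemma relation_ideal_add: "f \<in> relation_ideal S \<Longrightarrow> g \<in> relation_ideal S \<Longrightarrow> f + g \<in> relation_ideal S"
  using additive_subgroup.a_closed[OF ideal.axioms(1)[OF ideal_relation_ideal[of S]]] by simp

lemma relation_ideal_mult_left: "f \<in> relation_ideal S \<Longrightarrow> h * f \<in> relation_ideal S"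
  using ideal.I_l_closed[OF ideal_relation_ideal[of S]] by simp

lemma relation_ideal_mult_right: "f \<in> relation_ideal S \<Longrightarrow> f * h \<in> relation_ideal S"
  using ideal.I_r_closed[OF ideal_relation_ideal[of S]] by simp

lemma relation_ideal_base: "f \<in> S \<Longrightarrow> f \<in> relation_ideal S"
  unfolding relation_ideal_def using ring.genideal_self[of ring_of_type_algebra S]
  by (auto intro: ring_ring_of_type_algebra)

text \<open>The induction principle for the ideal: closure under negation is multiplication by \<open>-1\<close>.\<close>

lemma relation_ideal_least:
  assumes "S \<subseteq> J" "0 \<in> J"
    and "\<And>f g. f \<in> J \<Longrightarrow> g \<in> J \<Longrightarrow> f + g \<in> J"
    and "\<And>h f. f \<in> J \<Longrightarrow> h * f \<in> J" "\<And>h f. f \<in> J \<Longrightarrow> f * h \<in> J"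
  shows "relation_ideal S \<subseteq> J"
proof -
  have neg: "- f \<in> J" if "f \<in> J" for f
    using assms(4)[OF that, of "- 1"] by simp
  interpret ring "ring_of_type_algebra :: ('a fword \<Rightarrow>\<^sub>0 'b) ring"
    by (rule ring_ring_of_type_algebra)
  have inv: "\<ominus>\<^bsub>ring_of_type_algebra\<^esub> f = - f" for f :: "'a fword \<Rightarrow>\<^sub>0 'b"
    by (rule minus_equality) simp_all
  have "ideal J ring_of_type_algebra"
    by (intro idealI ring_ring_of_type_algebra subgroup.intro)
      (use assms neg in \<open>auto simp: inv[unfolded a_inv_def, simplified]\<close>)
  then show ?thesis
    unfolding relation_ideal_def using assms(1) by (rule genideal_minimal)
qed

lemma carrier_presented: "carrier (presented S) = range (coset S)"
  by (auto simp: presented_def FactRing_def A_RCOSETS_def' coset_def)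

lemma coset_in_carrier [simp]: "coset S f \<in> carrier (presented S)"
  by (simp add: carrier_presented)

lemma coset_eq_iff: "coset S f = coset S g \<longleftrightarrow> f - g \<in> relation_ideal S"
proof -
  interpret R: ring "ring_of_type_algebra :: ('a fword \<Rightarrow>\<^sub>0 'b) ring"
    by (rule ring_ring_of_type_algebra)
  have "\<ominus>\<^bsub>ring_of_type_algebra\<^esub> g = - g"
    by (rule R.minus_equality) simp_all
  then show ?thesis
    using R.quotient_eq_iff_same_a_r_cos[OF ideal_relation_ideal, of f g S]
    by (simp add: coset_def a_minus_def)
qed

lemma coset_zero: "\<zero>\<^bsub>presented S\<^esub> = coset S 0"
  using ring.a_rcos_zero[OF ring_ring_of_type_algebra ideal_relation_ideal relation_ideal_zero, of S]
  by (simp add: presented_def FactRing_def coset_def)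

lemma coset_one: "\<one>\<^bsub>presented S\<^esub> = coset S 1"
  by (simp add: presented_def FactRing_def coset_def)

lemma coset_add: "coset S f \<oplus>\<^bsub>presented S\<^esub> coset S g = coset S (f + g)"
  using abelian_subgroup.a_rcos_sum[OF abelian_subgroupI3[OF ideal.axioms(1)[OF ideal_relation_ideal]
        ring.is_abelian_group[OF ring_ring_of_type_algebra]], of f g S]
  by (simp add: presented_def FactRing_def coset_def)

lemma coset_mult: "coset S f \<otimes>\<^bsub>presented S\<^esub> coset S g = coset S (f * g)"
  using ideal.rcoset_mult_add[OF ideal_relation_ideal, of f g S]
  by (simp add: presented_def FactRing_def coset_def)

lemma scale_coset: "scale S c (coset S f) = coset S (scalar c * f)"
  by (simp add: scale_def coset_mult)

lemma ring_presented: "ring (presented S)"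
  unfolding presented_def by (rule ideal.quotient_is_ring[OF ideal_relation_ideal])

lemma finsum_coset: "(\<Oplus>\<^bsub>presented S\<^esub>p\<in>P. coset S (h p)) = coset S (\<Sum>p\<in>P. h p)"
proof -
  interpret R: ring "presented S" by (rule ring_presented)
  show ?thesis
    by (induction P rule: infinite_finite_induct) (simp_all add: coset_zero coset_add Pi_def)
qed

lemmas coset_simps = scale_coset coset_mult coset_add coset_one coset_zero finsum_coset

text \<open>An operator of the free algebra that preserves the ideal acts on the quotient through representatives.\<close>

lemma coset_cong_linear_op:
  assumes T: "linear_op T" and I: "\<And>f. f \<in> relation_ideal S \<Longrightarrow> T f \<in> relation_ideal S'"
    and eq: "coset S f = coset S g"
  shows "coset S' (T f) = coset S' (T g)"
  using eq I[of "f - g"] by (simp add: coset_eq_iff linear_op_diff[OF T])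

lemma linear_betweenD:
  assumes "linear_between S S' \<phi>"
  shows "\<phi> (coset S f) \<in> carrier (presented S')"
    and "\<phi> (coset S (f + g)) = \<phi> (coset S f) \<oplus>\<^bsub>presented S'\<^esub> \<phi> (coset S g)"
    and "\<phi> (coset S (scalar c * f)) = scale S' c (\<phi> (coset S f))"
  using assms unfolding linear_between_def
  by (auto simp flip: coset_add scale_coset)

text \<open>Used to recognise a given linear map of the quotient as one induced from the free algebra.\<close>

lemma linear_between_eq_coset:
  assumes \<phi>: "linear_between S S' \<phi>" and T: "linear_op T"
    and words: "\<And>w. \<phi> (coset S (word w)) = coset S' (T (word w))"
  shows "\<phi> (coset S f) = coset S' (T f)"
proof (induction f rule: poly_mapping_span_induct)
  case (single w c)
  have "Poly_Mapping.single w c = scalar c * word (letters w)"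
    by (simp add: scalar_times_single)
  then show ?case
    by (simp only: linear_betweenD[OF \<phi>] words scale_coset linear_op_scale[OF T])
next
  case (add f g)
  then show ?case by (simp add: linear_betweenD[OF \<phi>] coset_add linear_op_add[OF T])
qed

section \<open>The Taft algebra acting on a free algebra\<close>

text \<open>Once \<open>g\<close> and \<open>x\<close> are chosen as operators of the free algebra \<open>F\<close> on the \<open>Y\<^sub>i\<^sub>j\<close>, the free algebra on the
  letters \<open>g\<close> and \<open>x\<close> acts on \<open>F\<close>.  The coproduct formula holds at this level, before any relations are imposed
  on either side.\<close>

fun act_word :: "('g \<Rightarrow> ('g fword \<Rightarrow>\<^sub>0 'k::field)) \<Rightarrow> ('g \<Rightarrow> ('g fword \<Rightarrow>\<^sub>0 'k))
    \<Rightarrow> taft_gen list \<Rightarrow> ('g fword \<Rightarrow>\<^sub>0 'k) \<Rightarrow> ('g fword \<Rightarrow>\<^sub>0 'k)" where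
  "act_word \<gamma> \<xi> [] r = r"
| "act_word \<gamma> \<xi> (Gr # w) r = free_hom scalar \<gamma> (act_word \<gamma> \<xi> w r)"
| "act_word \<gamma> \<xi> (Sk # w) r = skew \<gamma> \<xi> (act_word \<gamma> \<xi> w r)"

definition act :: "('g \<Rightarrow> ('g fword \<Rightarrow>\<^sub>0 'k::field)) \<Rightarrow> ('g \<Rightarrow> ('g fword \<Rightarrow>\<^sub>0 'k))
    \<Rightarrow> (taft_gen fword \<Rightarrow>\<^sub>0 'k) \<Rightarrow> ('g fword \<Rightarrow>\<^sub>0 'k) \<Rightarrow> ('g fword \<Rightarrow>\<^sub>0 'k)" where
  "act \<gamma> \<xi> h r = lin_ext scalar (\<lambda>w. act_word \<gamma> \<xi> (letters w) r) h"

lemma linear_op_act_word: "linear_op (act_word \<gamma> \<xi> w)"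
proof (induction w)
  case Nil
  then show ?case by (simp add: linear_op_def)
next
  case (Cons y w)
  then show ?case
    using linear_op_comp[OF linear_op_free_hom Cons] linear_op_comp[OF linear_op_skew Cons]
    by (cases y) (simp_all add: linear_op_def)
qed

lemma linear_op_act_left: "linear_op (\<lambda>h. act \<gamma> \<xi> h r)"
  unfolding act_def by (rule linear_op_lin_ext)

lemma linear_op_act: "linear_op (act \<gamma> \<xi> h)"
  unfolding act_def lin_ext_def
  by (intro linear_op_setsum linear_op_times_left linear_op_act_word)

lemma act_word_append: "act_word \<gamma> \<xi> (v @ w) r = act_word \<gamma> \<xi> v (act_word \<gamma> \<xi> w r)"
proof (induction v)
  case (Cons y v)
  then show ?case by (cases y) simp_all
qed simp

lemma act_of_word: "act \<gamma> \<xi> (word w) r = act_word \<gamma> \<xi> w r"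
  by (simp add: act_def)

lemma act_Gr [simp]: "act \<gamma> \<xi> (letter Gr) r = free_hom scalar \<gamma> r"
  by (simp add: act_def letter_def)

lemma act_Sk [simp]: "act \<gamma> \<xi> (letter Sk) r = skew \<gamma> \<xi> r"
  by (simp add: act_def letter_def)

lemma act_one [simp]: "act \<gamma> \<xi> 1 r = r"
  using act_of_word[of \<gamma> \<xi> "[]" r] by simp

lemma act_scalar [simp]: "act \<gamma> \<xi> (scalar c) r = scalar c * r"
  using linear_op_scale[OF linear_op_act_left, of \<gamma> \<xi> c 1 r] by simp

lemma act_mult: "act \<gamma> \<xi> (h * h') r = act \<gamma> \<xi> h (act \<gamma> \<xi> h' r)"
proof (rule linear_op_eq_on_words[where f = h])
  show "linear_op (\<lambda>h. act \<gamma> \<xi> (h * h') r)"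
    by (intro linear_op_comp[OF linear_op_act_left] linear_op_times_right linear_op_id)
  show "linear_op (\<lambda>h. act \<gamma> \<xi> h (act \<gamma> \<xi> h' r))"
    by (rule linear_op_act_left)
  show "act \<gamma> \<xi> (word v * h') r = act \<gamma> \<xi> (word v) (act \<gamma> \<xi> h' r)" for v
  proof (rule linear_op_eq_on_words[where f = h'])
    show "linear_op (\<lambda>h'. act \<gamma> \<xi> (word v * h') r)"
      by (intro linear_op_comp[OF linear_op_act_left] linear_op_times_left linear_op_id)
    show "linear_op (\<lambda>h'. act \<gamma> \<xi> (word v) (act \<gamma> \<xi> h' r))"
      by (intro linear_op_comp[OF linear_op_act] linear_op_act_left)
    show "act \<gamma> \<xi> (word v * word w) r = act \<gamma> \<xi> (word v) (act \<gamma> \<xi> (word w) r)" for w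
      by (simp add: mult_single act_of_word act_word_append)
  qed
qed

lemma act_power: "act \<gamma> \<xi> (h ^ k) r = (act \<gamma> \<xi> h ^^ k) r"
  by (induction k) (simp_all add: act_mult)

lemma act_counit: "act \<gamma> \<xi> h 1 = scalar (free_hom id taft_counit h)"
proof (rule linear_op_eq_on_words[where f = h])
  show "linear_op (\<lambda>h. act \<gamma> \<xi> h 1)"
    by (rule linear_op_act_left)
  show "linear_op (\<lambda>h. scalar (free_hom id taft_counit h) :: _ \<Rightarrow>\<^sub>0 'b)"
    by (simp add: linear_op_def ident.free_hom_add ident.free_hom_scale scalar_add scalar_mult)
  show "act \<gamma> \<xi> (word w) 1 = scalar (free_hom id taft_counit (word w))" for w
  proof (induction w)
    case (Cons y w)
    have "act \<gamma> \<xi> (word (y # w)) 1 = act \<gamma> \<xi> (letter y) (scalar (free_hom id taft_counit (word w)) * 1)"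
      by (simp only: word_Cons act_mult Cons mult_1_right)
    also have "\<dots> = scalar (free_hom id taft_counit (word w)) * act \<gamma> \<xi> (letter y) 1"
      by (rule linear_op_scale[OF linear_op_act])
    also have "\<dots> = scalar (free_hom id taft_counit (word (y # w)))"
      by (cases y) (simp_all add: word_Cons ident.free_hom_mult)
    finally show ?case .
  qed (simp only: FWord_zero single_one act_one ident.free_hom_one scalar_1)
qed

text \<open>The action of \<open>h \<otimes> h'\<close> on a pair followed by multiplication: a basis element \<open>u \<otimes> v\<close> sends \<open>(a, b)\<close> to
  \<open>(u \<cdot> a)(v \<cdot> b)\<close>.\<close>

definition act_pair :: "('g \<Rightarrow> ('g fword \<Rightarrow>\<^sub>0 'k::field)) \<Rightarrow> ('g \<Rightarrow> ('g fword \<Rightarrow>\<^sub>0 'k))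
    \<Rightarrow> (taft_gen fword \<times> taft_gen fword \<Rightarrow>\<^sub>0 'k) \<Rightarrow> ('g fword \<Rightarrow>\<^sub>0 'k) \<Rightarrow> ('g fword \<Rightarrow>\<^sub>0 'k) \<Rightarrow> ('g fword \<Rightarrow>\<^sub>0 'k)" where
  "act_pair \<gamma> \<xi> t a b = lin_ext scalar
     (\<lambda>p. act_word \<gamma> \<xi> (letters (fst p)) a * act_word \<gamma> \<xi> (letters (snd p)) b) t"

text \<open>For one letter the coproduct formula is the multiplicativity of \<open>g\<close> and the skew Leibniz rule of \<open>x\<close>; longer
  words follow because the comultiplication is multiplicative.\<close>

lemma act_pair_comult:
  "act_pair \<gamma> \<xi> (taft_comult y * t) a b = act \<gamma> \<xi> (letter y) (act_pair \<gamma> \<xi> t a b)"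
proof (induction t rule: poly_mapping_span_induct)
  case (single p c)
  obtain u v where p: "p = (u, v)" by (cases p)
  show ?case
    by (cases y)
      (simp_all add: p act_pair_def mult_single distrib_right scalar.lin_ext_add zero_prod_def
        linear_op_scale[OF linear_op_skew] linear_op_scale[OF linear_op_free_hom]
        scalar.free_hom_mult skew_mult plus_fword_def distrib_left)
next
  case (add s t)
  then show ?case
    by (simp add: act_pair_def distrib_left scalar.lin_ext_add linear_op_add[OF linear_op_act])
qed

lemma act_product: "act \<gamma> \<xi> h (a * b) = act_pair \<gamma> \<xi> (free_hom scalar taft_comult h) a b"
proof (rule linear_op_eq_on_words[where f = h])
  show "linear_op (\<lambda>h. act \<gamma> \<xi> h (a * b))"
    by (rule linear_op_act_left)
  show "linear_op (\<lambda>h. act_pair \<gamma> \<xi> (free_hom scalar taft_comult h) a b)"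
    unfolding act_pair_def by (intro linear_op_comp[OF linear_op_lin_ext] linear_op_free_hom)
  show "act \<gamma> \<xi> (word w) (a * b) = act_pair \<gamma> \<xi> (free_hom scalar taft_comult (word w)) a b" for w
  proof (induction w)
    case Nil
    then show ?case
      by (simp add: act_pair_def zero_prod_def)
  next
    case (Cons y w)
    then show ?case by (simp add: word_Cons act_mult scalar.free_hom_mult act_pair_comult)
  qed
qed

section \<open>Powers of a skew derivation\<close>

text \<open>Gaussian binomial coefficients, defined by their Pascal rule, so that they make sense at roots of unity,
  where the quotient of quantum factorials does not.\<close>

fun gauss :: "'k::field \<Rightarrow> nat \<Rightarrow> nat \<Rightarrow> 'k" where
  "gauss l n 0 = 1"
| "gauss l 0 (Suc j) = 0"
| "gauss l (Suc n) (Suc j) = gauss l n j + l ^ Suc j * gauss l n (Suc j)"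

text \<open>With the quantum integers \<open>[k + 1] = 1 + l + \<dots> + l\<^sup>k\<close> this is \<open>[j + 1] binom(n + 1, j + 1) = [n + 1] binom(n, j)\<close>.\<close>

lemma gauss_absorb:
  "(\<Sum>i\<le>j. l ^ i) * gauss l (Suc n) (Suc j) = (\<Sum>i\<le>n. l ^ i) * gauss l n j"
proof (induction n arbitrary: j)
  case 0
  then show ?case by (cases j) simp_all
next
  case (Suc n)
  have sp: "(\<Sum>i\<le>Suc k. l ^ i) = 1 + l * (\<Sum>i\<le>k. l ^ i)" for k
    by (subst sum.atMost_Suc_shift) (simp add: sum_distrib_left)
  show ?case
  proof (cases j)
    case 0
    with Suc[of 0] show ?thesis by (simp add: sp algebra_simps del: sum.atMost_Suc)
  next
    case (Suc i)
    have a: "(\<Sum>i\<le>i. l ^ i) * gauss l (Suc n) (Suc i) = (\<Sum>i\<le>n. l ^ i) * gauss l n i"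
      and b: "(\<Sum>i\<le>Suc i. l ^ i) * gauss l (Suc n) (Suc (Suc i)) = (\<Sum>i\<le>n. l ^ i) * gauss l n (Suc i)"
      by (rule Suc.IH)+
    have "(\<Sum>i\<le>Suc i. l ^ i) * gauss l (Suc (Suc n)) (Suc (Suc i))
        = (1 + l * (\<Sum>i\<le>i. l ^ i)) * gauss l (Suc n) (Suc i)
          + l ^ Suc (Suc i) * ((\<Sum>i\<le>Suc i. l ^ i) * gauss l (Suc n) (Suc (Suc i)))"
      by (simp add: sp algebra_simps del: sum.atMost_Suc)
    also have "\<dots> = gauss l (Suc n) (Suc i) + l * ((\<Sum>i\<le>i. l ^ i) * gauss l (Suc n) (Suc i))
          + l ^ Suc (Suc i) * ((\<Sum>i\<le>n. l ^ i) * gauss l n (Suc i))"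
      by (simp only: b) (simp add: algebra_simps)
    also have "\<dots> = (1 + l * (\<Sum>i\<le>n. l ^ i)) * gauss l (Suc n) (Suc i)"
      by (simp only: a) (simp add: algebra_simps)
    finally show ?thesis by (simp only: sp Suc)
  qed
qed

lemma gauss_self: "gauss l n n = 1" and gauss_above: "n < j \<Longrightarrow> gauss l n j = 0"
proof -
  have above: "\<And>j. n < j \<Longrightarrow> gauss l n j = 0" for n
  proof (induction n)
    case 0
    then show ?case by (cases j) simp_all
  next
    case (Suc n)
    then show ?case by (cases j) simp_all
  qed
  then show "n < j \<Longrightarrow> gauss l n j = 0" .
  show "gauss l n n = 1"
    by (induction n) (simp_all add: above)
qed

text \<open>In \<open>[j] binom(m, j) = [m] binom(m - 1, j - 1)\<close> the factor \<open>[m]\<close> is zero and \<open>[j]\<close> is not, because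
  \<open>(l - 1) [k] = l\<^sup>k - 1\<close>.\<close>

lemma gauss_root_of_unity:
  assumes "l ^ m = 1" and prim: "\<And>j. 0 < j \<Longrightarrow> j < m \<Longrightarrow> l ^ j \<noteq> 1" and j: "0 < j" "j < m"
  shows "gauss l m j = 0"
proof -
  obtain i n where [simp]: "j = Suc i" "m = Suc n"
    using j by (metis Suc_pred less_trans)
  have geo: "(l - 1) * (\<Sum>i\<le>k. l ^ i) = l ^ Suc k - 1" for k
    by (metis lessThan_Suc_atMost power_diff_1_eq)
  have "l \<noteq> 1" using prim[of 1] j by auto
  then have "(\<Sum>i\<le>n. l ^ i) = 0"
    using geo[of n] assms(1) by simp
  moreover have "(\<Sum>i\<le>i. l ^ i) \<noteq> 0"
    using geo[of i] prim[of j] j by auto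
  ultimately show ?thesis
    using gauss_absorb[of l i n] by simp
qed

text \<open>On \<open>F \<otimes> F\<close> the operators \<open>u = g \<otimes> x\<close> and \<open>v = x \<otimes> 1\<close> satisfy \<open>u v = l v u\<close>, and \<open>x\<close> acts on a product as
  \<open>u + v\<close>; this is the quantum binomial theorem for \<open>(u + v)\<^sup>k\<close>.\<close>

lemma skew_funpow_mult:
  assumes comm: "\<And>f. free_hom scalar \<gamma> (skew \<gamma> \<xi> f) = scalar l * skew \<gamma> \<xi> (free_hom scalar \<gamma> f)"
  shows "(skew \<gamma> \<xi> ^^ k) (a * b)
    = (\<Sum>j\<le>k. scalar (gauss l k j) * ((skew \<gamma> \<xi> ^^ j) ((free_hom scalar \<gamma> ^^ (k - j)) a) * (skew \<gamma> \<xi> ^^ (k - j)) b))"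
proof (induction k)
  case 0
  then show ?case by simp
next
  case (Suc k)
  define G where "G = free_hom scalar \<gamma>"
  define D where "D = skew \<gamma> \<xi>"
  have linG: "linear_op G" and linD: "linear_op D"
    by (simp_all add: G_def D_def linear_op_free_hom linear_op_skew)
  have GD: "G ((D ^^ j) f) = scalar (l ^ j) * (D ^^ j) (G f)" for j f
  proof (induction j)
    case (Suc j)
    then show ?case
      using comm by (simp add: linear_op_scale[OF linD] scalar_mult mult.assoc flip: G_def D_def)
  qed simp
  define P where "P j = (D ^^ j) ((G ^^ (Suc k - j)) a) * (D ^^ (Suc k - j)) b" for j
  have step: "D ((D ^^ j) ((G ^^ (k - j)) a) * (D ^^ (k - j)) b) = scalar (l ^ j) * P j + P (Suc j)"
    if "j \<le> k" for j
    using that GD[of j "(G ^^ (k - j)) a"] skew_mult[of \<gamma> \<xi>]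
    by (simp add: P_def Suc_diff_le mult.assoc flip: G_def D_def)
  have "(D ^^ Suc k) (a * b) = (\<Sum>j\<le>k. scalar (gauss l k j) * (scalar (l ^ j) * P j + P (Suc j)))"
    using Suc.IH step by (simp add: linear_op_sum[OF linD] linear_op_scale[OF linD] flip: G_def D_def)
  also have "\<dots> = (\<Sum>j\<le>k. scalar (gauss l k j * l ^ j) * P j) + (\<Sum>j\<le>k. scalar (gauss l k j) * P (Suc j))"
    by (simp add: distrib_left sum.distrib scalar_mult mult.assoc)
  also have "(\<Sum>j\<le>k. scalar (gauss l k j * l ^ j) * P j) = (\<Sum>j\<le>Suc k. scalar (gauss l k j * l ^ j) * P j)"
    by (simp add: gauss_above)
  also have "\<dots> = P 0 + (\<Sum>j\<le>k. scalar (gauss l k (Suc j) * l ^ Suc j) * P (Suc j))"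
    by (subst sum.atMost_Suc_shift) simp
  also have "\<dots> + (\<Sum>j\<le>k. scalar (gauss l k j) * P (Suc j))
      = P 0 + (\<Sum>j\<le>k. scalar (gauss l (Suc k) (Suc j)) * P (Suc j))"
    by (simp add: scalar_add distrib_right sum.distrib mult.commute[of "l ^ _"] add_ac del: power_Suc)
  also have "\<dots> = (\<Sum>j\<le>Suc k. scalar (gauss l (Suc k) j) * P j)"
    by (subst sum.atMost_Suc_shift) simp
  finally show ?case by (simp only: P_def G_def D_def)
qed

text \<open>Only the terms \<open>j = 0\<close> and \<open>j = m\<close> of the binomial expansion survive, so \<open>x\<^sup>m\<close> obeys a skew Leibniz rule and
  is zero when it kills the letters.\<close>

lemma skew_funpow_eq_zero:
  fixes \<gamma> \<xi> :: "'a \<Rightarrow> ('a fword \<Rightarrow>\<^sub>0 'b::field)"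
  assumes comm: "\<And>f. free_hom scalar \<gamma> (skew \<gamma> \<xi> f) = scalar l * skew \<gamma> \<xi> (free_hom scalar \<gamma> f)"
    and "l ^ m = 1" and prim: "\<And>j. 0 < j \<Longrightarrow> j < m \<Longrightarrow> l ^ j \<noteq> 1" and m: "m > 0"
    and gen: "\<And>y. (skew \<gamma> \<xi> ^^ m) (letter y) = 0"
  shows "(skew \<gamma> \<xi> ^^ m) f = 0"
proof -
  let ?Z = "\<lambda>_ :: 'a fword \<Rightarrow>\<^sub>0 'b. 0 :: 'a fword \<Rightarrow>\<^sub>0 'b"
  have lin: "linear_op (skew \<gamma> \<xi> ^^ m)"
    by (intro linear_op_funpow linear_op_skew)
  have "linear_op ?Z"
    by (simp add: linear_op_def)
  moreover have "(skew \<gamma> \<xi> ^^ m) (word w) = ?Z (word w)" for w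
  proof (induction w)
    case Nil
    have "(skew \<gamma> \<xi> ^^ k) 0 = 0" for k
      using linear_op_zero[OF linear_op_funpow[OF linear_op_skew]] .
    with m show ?case
      by (cases m) (simp_all add: funpow_swap1)
  next
    case (Cons y w)
    have "{..m} = insert 0 (insert m {0<..<m})" using m by auto
    moreover have "gauss l m j = 0" if "j \<in> {0<..<m}" for j
      using that assms(2) prim by (simp add: gauss_root_of_unity)
    ultimately show ?case
      using m Cons gen[of y]
      by (simp add: word_Cons skew_funpow_mult[OF comm] gauss_self)
  qed
  ultimately show ?thesis
    using linear_op_eq_on_words[OF lin] by blast
qed

text \<open>Both sides obey the same Leibniz rule, namely \<open>f(ab) = g(g(a)) f(b) + f(a) g(b)\<close>.\<close>

lemma free_hom_skew_commute:
  assumes gen: "\<And>y. free_hom scalar \<gamma> (\<xi> y) = scalar l * skew \<gamma> \<xi> (\<gamma> y)"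
  shows "free_hom scalar \<gamma> (skew \<gamma> \<xi> f) = scalar l * skew \<gamma> \<xi> (free_hom scalar \<gamma> f)"
proof (rule linear_op_eq_on_words[where f = f])
  show "linear_op (\<lambda>f. free_hom scalar \<gamma> (skew \<gamma> \<xi> f))"
    by (intro linear_op_comp[OF linear_op_free_hom] linear_op_skew)
  show "linear_op (\<lambda>f. scalar l * skew \<gamma> \<xi> (free_hom scalar \<gamma> f))"
    by (intro linear_op_times_left linear_op_comp[OF linear_op_skew] linear_op_free_hom)
  show "free_hom scalar \<gamma> (skew \<gamma> \<xi> (word w)) = scalar l * skew \<gamma> \<xi> (free_hom scalar \<gamma> (word w))" for w
  proof (induction w)
    case Nil
    then show ?case by simp
  next
    case (Cons y w)
    then show ?case
      by (simp add: word_Cons skew_mult scalar.free_hom_mult scalar.free_hom_add gen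
          distrib_left mult.assoc scalar_left_commute[of "free_hom scalar \<gamma> (\<gamma> y)"])
  qed
qed

section \<open>Actions on presented algebras\<close>

definition rep :: "('g fword \<Rightarrow>\<^sub>0 'k::field) set \<Rightarrow> ('g fword \<Rightarrow>\<^sub>0 'k) set \<Rightarrow> ('g fword \<Rightarrow>\<^sub>0 'k)" where
  "rep S c = (SOME f. coset S f = c)"

lemma coset_rep [simp]: "coset S (rep S (coset S f)) = coset S f"
  unfolding rep_def by (rule someI) (rule refl)

lemma free_hom_funpow_id:
  assumes "\<And>y. (free_hom scalar \<gamma> ^^ n) (letter y) = letter y"
  shows "(free_hom scalar \<gamma> ^^ n) f = f"
proof (rule linear_op_eq_on_words[OF linear_op_funpow[OF linear_op_free_hom] linear_op_id])
  have mult: "(free_hom scalar \<gamma> ^^ k) (a * b) = (free_hom scalar \<gamma> ^^ k) a * (free_hom scalar \<gamma> ^^ k) b"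
    and one: "(free_hom scalar \<gamma> ^^ k) 1 = 1" for k a b
    by (induction k) (simp_all add: scalar.free_hom_mult)
  show "(free_hom scalar \<gamma> ^^ n) (word w) = word w" for w
  proof (induction w)
    case Nil
    then show ?case by (simp add: one)
  next
    case (Cons y w)
    then show ?case by (simp only: word_Cons mult assms)
  qed
qed

lemma free_hom_relation_ideal:
  assumes gens: "\<And>r. r \<in> S \<Longrightarrow> free_hom scalar \<gamma> r \<in> relation_ideal S" and f: "f \<in> relation_ideal S"
  shows "free_hom scalar \<gamma> f \<in> relation_ideal S"
proof -
  have "relation_ideal S \<subseteq> {f. free_hom scalar \<gamma> f \<in> relation_ideal S}"
    using gens by (intro relation_ideal_least)
      (auto simp: relation_ideal_zero scalar.free_hom_add scalar.free_hom_mult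
        intro: relation_ideal_add relation_ideal_mult_left relation_ideal_mult_right)
  with f show ?thesis by auto
qed

text \<open>For a relation \<open>r\<close>, the three terms of \<open>x(a r b) = g(a r) x(b) + g(a) x(r) b + x(a) r b\<close> contain one of the
  factors \<open>g(r)\<close>, \<open>x(r)\<close>, \<open>r\<close>.\<close>

lemma skew_relation_ideal:
  assumes gens: "\<And>r. r \<in> S \<Longrightarrow> free_hom scalar \<gamma> r \<in> relation_ideal S" "\<And>r. r \<in> S \<Longrightarrow> skew \<gamma> \<xi> r \<in> relation_ideal S"
    and f: "f \<in> relation_ideal S"
  shows "skew \<gamma> \<xi> f \<in> relation_ideal S"
proof -
  have "relation_ideal S \<subseteq> {f \<in> relation_ideal S. skew \<gamma> \<xi> f \<in> relation_ideal S}"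
    using gens(2) by (intro relation_ideal_least)
      (auto simp: relation_ideal_zero linear_op_zero[OF linear_op_skew] linear_op_add[OF linear_op_skew] skew_mult
        intro: relation_ideal_base relation_ideal_add relation_ideal_mult_left relation_ideal_mult_right
          free_hom_relation_ideal[OF gens(1)])
  with f show ?thesis by auto
qed

lemma module_algebraD:
  assumes "module_algebra S \<delta> \<epsilon> S' \<rho>"
  shows "\<rho> \<in> carrier (presented S) \<rightarrow>\<^sub>E (carrier (presented S') \<rightarrow>\<^sub>E carrier (presented S'))"
    and "linear_between S' S' (\<rho> (coset S h))"
    and "linear_between S S' (\<lambda>h. \<rho> h (coset S' r))"
    and "\<rho> (coset S 1) (coset S' r) = coset S' r"
    and "\<rho> (coset S (h * h')) (coset S' r) = \<rho> (coset S h) (\<rho> (coset S h') (coset S' r))"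
    and "\<rho> (coset S h) (coset S' 1) = coset S' (scalar (free_hom id \<epsilon> h))"
    and "\<rho> (coset S h) (coset S' (a * b)) =
        (\<Oplus>\<^bsub>presented S'\<^esub>p\<in>Poly_Mapping.keys (free_hom scalar \<delta> h).
           scale S' (Poly_Mapping.lookup (free_hom scalar \<delta> h) p)
             (\<rho> (coset S (Poly_Mapping.single (fst p) 1)) (coset S' a) \<otimes>\<^bsub>presented S'\<^esub>
              \<rho> (coset S (Poly_Mapping.single (snd p) 1)) (coset S' b)))"
  using assms unfolding module_algebra_def Let_def
  by (simp_all add: carrier_presented coset_one scale_coset flip: coset_mult)

lemma module_algebra_in_carrier:
  assumes "module_algebra S \<delta> \<epsilon> S' \<rho>"
  shows "\<rho> (coset S h) (coset S' r) \<in> carrier (presented S')"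
  using linear_betweenD(1)[OF module_algebraD(2)[OF assms]] .

context
  fixes n m :: nat and lam :: "'k::field" and S' :: "('g fword \<Rightarrow>\<^sub>0 'k) set" and \<rho>
  assumes \<rho>: "module_algebra (taft_relations n lam m) taft_comult taft_counit S' \<rho>"
begin

text \<open>The coproduct axiom is stated as a sum over the support of the comultiplication; here it is evaluated at the
  two generators of the Taft algebra.\<close>

lemma taft_action_mult:
  "\<rho> (taft_g n lam m) (coset S' (a * b))
    = \<rho> (taft_g n lam m) (coset S' a) \<otimes>\<^bsub>presented S'\<^esub> \<rho> (taft_g n lam m) (coset S' b)" (is ?g)
  "\<rho> (taft_x n lam m) (coset S' (a * b))
    = \<rho> (taft_g n lam m) (coset S' a) \<otimes>\<^bsub>presented S'\<^esub> \<rho> (taft_x n lam m) (coset S' b)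
      \<oplus>\<^bsub>presented S'\<^esub> \<rho> (taft_x n lam m) (coset S' a) \<otimes>\<^bsub>presented S'\<^esub> coset S' b" (is ?x)
proof -
  let ?S = "taft_relations n lam m"
  let ?t = "\<lambda>p. \<rho> (coset ?S (Poly_Mapping.single (fst p) 1)) (coset S' a) \<otimes>\<^bsub>presented S'\<^esub>
              \<rho> (coset ?S (Poly_Mapping.single (snd p) 1)) (coset S' b)"
  have closed: "\<exists>u. \<rho> (coset ?S h) (coset S' r) = coset S' u" for h r
    using module_algebra_in_carrier[OF \<rho>, of h r] unfolding carrier_presented by blast
  have "\<exists>u. ?t p = coset S' u" for p
    using closed[of "Poly_Mapping.single (fst p) 1" a] closed[of "Poly_Mapping.single (snd p) 1" b]
    by (auto simp: coset_mult)
  then obtain u where u: "\<And>p. ?t p = coset S' (u p)" by metis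
  have expand: "\<rho> (coset ?S h) (coset S' (a * b)) = coset S' (\<Sum>p\<in>Poly_Mapping.keys (free_hom scalar taft_comult h).
      scalar (Poly_Mapping.lookup (free_hom scalar taft_comult h) p) * u p)" for h
    unfolding module_algebraD(7)[OF \<rho>] u scale_coset finsum_coset ..
  have unit: "\<rho> (coset ?S (word [])) (coset S' b) = coset S' b"
    using module_algebraD(4)[OF \<rho>] by simp
  show ?g
    using expand[of "letter Gr"] u[of "(FWord [Gr], FWord [Gr])"] by (simp add: taft_g_def letter_def scalar.free_hom_single)
  have "Poly_Mapping.keys (taft_comult Sk :: _ \<Rightarrow>\<^sub>0 'k) = {(FWord [Gr], FWord [Sk]), (FWord [Sk], 0 :: taft_gen fword)}"
    by (auto simp: in_keys_iff lookup_add lookup_single when_def split: if_splits)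
  then have "\<rho> (taft_x n lam m) (coset S' (a * b)) = coset S' (u (FWord [Gr], FWord [Sk]) + u (FWord [Sk], 0))"
    using expand[of "letter Sk"] by (simp add: taft_x_def lookup_add lookup_single when_def)
  then show ?x
    using u[of "(FWord [Gr], FWord [Sk])"] u[of "(FWord [Sk], 0)"] unit
    by (simp add: taft_x_def taft_g_def letter_def flip: coset_add)
qed

text \<open>Representatives of the images of the generators determine the whole action: multiplicativity and the skew
  Leibniz rule carry them to words in the \<open>Y\<^sub>i\<^sub>j\<close>, and the module law to words in \<open>g\<close> and \<open>x\<close>.\<close>

lemma taft_action_eq_act:
  assumes g: "\<And>y. \<rho> (taft_g n lam m) (coset S' (letter y)) = coset S' (\<gamma> y)"
    and x: "\<And>y. \<rho> (taft_x n lam m) (coset S' (letter y)) = coset S' (\<xi> y)"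
  shows "\<rho> (coset (taft_relations n lam m) h) (coset S' f) = coset S' (act \<gamma> \<xi> h f)"
proof -
  let ?S = "taft_relations n lam m"
  note lin = module_algebraD(2)[OF \<rho>]
  have G: "\<rho> (taft_g n lam m) (coset S' f) = coset S' (free_hom scalar \<gamma> f)" for f
    unfolding taft_g_def
  proof (rule linear_between_eq_coset[OF lin linear_op_free_hom])
    show "\<rho> (coset ?S (letter Gr)) (coset S' (word w)) = coset S' (free_hom scalar \<gamma> (word w))" for w
    proof (induction w)
      case Nil
      show ?case using module_algebraD(6)[OF \<rho>, of "letter Gr"] by simp
    next
      case (Cons y w)
      then show ?case
        using taft_action_mult(1)[of "letter y" "word w"] g[of y]
        by (simp add: word_Cons taft_g_def coset_mult scalar.free_hom_mult)
    qed
  qed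
  have X: "\<rho> (taft_x n lam m) (coset S' f) = coset S' (skew \<gamma> \<xi> f)" for f
    unfolding taft_x_def
  proof (rule linear_between_eq_coset[OF lin linear_op_skew])
    show "\<rho> (coset ?S (letter Sk)) (coset S' (word w)) = coset S' (skew \<gamma> \<xi> (word w))" for w
    proof (induction w)
      case Nil
      show ?case using module_algebraD(6)[OF \<rho>, of "letter Sk"] by simp
    next
      case (Cons y w)
      then show ?case
        using taft_action_mult(2)[of "letter y" "word w"] g[of y] x[of y]
        by (simp add: word_Cons taft_x_def coset_mult coset_add skew_mult)
    qed
  qed
  have word: "\<rho> (coset ?S (word w)) (coset S' f) = coset S' (act \<gamma> \<xi> (word w) f)" for w
  proof (induction w)
    case Nil
    show ?case using module_algebraD(4)[OF \<rho>] by simp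
  next
    case (Cons y w)
    then show ?case
      using G X by (cases y) (simp_all add: word_Cons module_algebraD(5)[OF \<rho>] act_mult flip: taft_g_def taft_x_def)
  qed
  show ?thesis
    by (rule linear_between_eq_coset[OF module_algebraD(3)[OF \<rho>] linear_op_act_left word])
qed

end

text \<open>The conditions on the values of \<open>g\<close> and \<open>x\<close> on letters under which they define an action on the quotient.
  The conditions on powers and on commutation are equations in the free algebra: operators that are linear on
  letters and relations without linear part give the same conditions there as in the quotient.\<close>

locale taft_descent =
  fixes S' :: "('g fword \<Rightarrow>\<^sub>0 'k::field) set" and \<gamma> \<xi> :: "'g \<Rightarrow> ('g fword \<Rightarrow>\<^sub>0 'k)"
    and n m :: nat and lam :: 'k
  assumes g_rel: "\<And>r. r \<in> S' \<Longrightarrow> free_hom scalar \<gamma> r \<in> relation_ideal S'"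
    and x_rel: "\<And>r. r \<in> S' \<Longrightarrow> skew \<gamma> \<xi> r \<in> relation_ideal S'"
    and g_pow: "\<And>y. (free_hom scalar \<gamma> ^^ n) (letter y) = letter y"
    and x_pow: "\<And>y. (skew \<gamma> \<xi> ^^ m) (letter y) = 0"
    and g_x: "\<And>y. free_hom scalar \<gamma> (\<xi> y) = scalar lam * skew \<gamma> \<xi> (\<gamma> y)"
    and lam: "lam ^ m = 1" "\<And>j. 0 < j \<Longrightarrow> j < m \<Longrightarrow> lam ^ j \<noteq> 1" "m > 0"
begin

lemma act_relation_ideal: "f \<in> relation_ideal S' \<Longrightarrow> act \<gamma> \<xi> h f \<in> relation_ideal S'"
proof -
  assume f: "f \<in> relation_ideal S'"
  have "act_word \<gamma> \<xi> w f \<in> relation_ideal S'" for w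
  proof (induction w)
    case (Cons y w)
    then show ?case
      by (cases y) (simp_all add: free_hom_relation_ideal[OF g_rel] skew_relation_ideal[OF g_rel x_rel])
  qed (simp add: f)
  then show ?thesis
    unfolding act_def lin_ext_def
    by (induction rule: infinite_finite_induct[of _ "Poly_Mapping.keys h"])
      (auto simp: relation_ideal_zero intro: relation_ideal_add relation_ideal_mult_left)
qed

text \<open>The elements that act as zero form a two-sided ideal, which contains the Taft relations: two of them by
  propagation from letters, and \<open>x\<^sup>m\<close> by the binomial argument.\<close>

lemma act_taft_ideal: "h \<in> relation_ideal (taft_relations n lam m) \<Longrightarrow> act \<gamma> \<xi> h f = 0"
proof -
  have "relation_ideal (taft_relations n lam m) \<subseteq> {h. \<forall>f. act \<gamma> \<xi> h f = 0}"
  proof (rule relation_ideal_least)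
    have "(skew \<gamma> \<xi> ^^ m) f = 0" for f
      using free_hom_skew_commute[OF g_x] lam x_pow by (rule skew_funpow_eq_zero)
    then show "taft_relations n lam m \<subseteq> {h. \<forall>f. act \<gamma> \<xi> h f = 0}"
      by (auto simp: taft_relations_def Let_def linear_op_diff[OF linear_op_act_left] act_mult act_power
          free_hom_funpow_id[OF g_pow] free_hom_skew_commute[OF g_x] act_Gr[abs_def] act_Sk[abs_def] cong: if_cong)
  qed (simp_all add: linear_op_zero[OF linear_op_act_left] linear_op_add[OF linear_op_act_left] act_mult
        linear_op_zero[OF linear_op_act])
  then show "h \<in> relation_ideal (taft_relations n lam m) \<Longrightarrow> act \<gamma> \<xi> h f = 0" by auto
qed

definition descended where
  "descended = (\<lambda>h\<in>carrier (presented (taft_relations n lam m)). \<lambda>r\<in>carrier (presented S').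
     coset S' (act \<gamma> \<xi> (rep (taft_relations n lam m) h) (rep S' r)))"

lemma descended_coset:
  "descended (coset (taft_relations n lam m) h) (coset S' f) = coset S' (act \<gamma> \<xi> h f)"
proof -
  let ?S = "taft_relations n lam m"
  have "act \<gamma> \<xi> (rep ?S (coset ?S h)) r = act \<gamma> \<xi> h r" for r
    using act_taft_ideal[of "rep ?S (coset ?S h) - h" r] coset_rep[of ?S h]
    unfolding coset_eq_iff by (simp add: linear_op_diff[OF linear_op_act_left])
  moreover have "coset S' (act \<gamma> \<xi> h (rep S' (coset S' f))) = coset S' (act \<gamma> \<xi> h f)"
    by (rule coset_cong_linear_op[OF linear_op_act act_relation_ideal coset_rep])
  ultimately show ?thesis
    by (simp add: descended_def)
qed

lemma module_algebra_descended:
  "module_algebra (taft_relations n lam m) taft_comult taft_counit S' descended"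
proof -
  let ?S = "taft_relations n lam m"
  have product: "descended (coset ?S h) (coset S' a \<otimes>\<^bsub>presented S'\<^esub> coset S' b) =
        (\<Oplus>\<^bsub>presented S'\<^esub>p\<in>Poly_Mapping.keys (free_hom scalar taft_comult h).
           scale S' (Poly_Mapping.lookup (free_hom scalar taft_comult h) p)
             (descended (coset ?S (Poly_Mapping.single (fst p) 1)) (coset S' a) \<otimes>\<^bsub>presented S'\<^esub>
              descended (coset ?S (Poly_Mapping.single (snd p) 1)) (coset S' b)))" for h a b
    unfolding descended_coset coset_simps
    by (simp add: act_product act_pair_def lin_ext_def[of _ _ "free_hom _ _ _"]
        act_def[of _ _ "Poly_Mapping.single _ _"])
  have ext: "descended \<in> carrier (presented ?S) \<rightarrow>\<^sub>E (carrier (presented S') \<rightarrow>\<^sub>E carrier (presented S'))"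
    by (auto simp: descended_def)
  have left: "linear_between S' S' (descended (coset ?S h))" for h
    unfolding linear_between_def carrier_presented
    by (auto simp: descended_coset coset_add scale_coset linear_op_add[OF linear_op_act] linear_op_scale[OF linear_op_act])
  have right: "linear_between ?S S' (\<lambda>h. descended h (coset S' r))" for r
    unfolding linear_between_def carrier_presented
    by (auto simp: descended_coset coset_add scale_coset linear_op_add[OF linear_op_act_left] linear_op_scale[OF linear_op_act_left])
  have rest: "descended \<one>\<^bsub>presented ?S\<^esub> (coset S' r) = coset S' r"
    "descended (coset ?S h \<otimes>\<^bsub>presented ?S\<^esub> coset ?S h') (coset S' r) = descended (coset ?S h) (descended (coset ?S h') (coset S' r))"
    "descended (coset ?S h) \<one>\<^bsub>presented S'\<^esub> = scale S' (free_hom id taft_counit h) \<one>\<^bsub>presented S'\<^esub>" for h h' r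
    by (simp_all only: coset_one coset_mult scale_coset descended_coset act_one act_mult act_counit mult_1_right)
  show ?thesis
    unfolding module_algebra_def Let_def
  proof (intro conjI ballI allI ext rest(3))
    fix h assume "h \<in> carrier (presented ?S)"
    then obtain h0 where "h = coset ?S h0"
      unfolding carrier_presented by blast
    then show "linear_between S' S' (descended h)" by (simp only: left)
  next
    fix r assume "r \<in> carrier (presented S')"
    then obtain r0 where "r = coset S' r0"
      unfolding carrier_presented by blast
    then show "linear_between ?S S' (\<lambda>h. descended h r)" and "descended \<one>\<^bsub>presented ?S\<^esub> r = r"
      by (simp_all only: right rest)
  next
    fix h h' r assume "h \<in> carrier (presented ?S)" "h' \<in> carrier (presented ?S)" "r \<in> carrier (presented S')"
    then obtain h0 h1 r0 where "h = coset ?S h0" "h' = coset ?S h1" "r = coset S' r0"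
      unfolding carrier_presented by blast
    then show "descended (h \<otimes>\<^bsub>presented ?S\<^esub> h') r = descended h (descended h' r)"
      by (simp only: rest)
  next
    fix f a b assume "a \<in> carrier (presented S')" "b \<in> carrier (presented S')"
    then obtain a0 b0 where "a = coset S' a0" "b = coset S' b0"
      unfolding carrier_presented by blast
    then show "descended (coset ?S f) (a \<otimes>\<^bsub>presented S'\<^esub> b) =
        (\<Oplus>\<^bsub>presented S'\<^esub>p\<in>Poly_Mapping.keys (free_hom scalar taft_comult f).
           scale S' (Poly_Mapping.lookup (free_hom scalar taft_comult f) p)
             (descended (coset ?S (Poly_Mapping.single (fst p) 1)) a \<otimes>\<^bsub>presented S'\<^esub>
              descended (coset ?S (Poly_Mapping.single (snd p) 1)) b))"
      by (simp only: product)
  qed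
qed

end

section \<open>Automorphisms of a presented algebra\<close>

definition hom_induced :: "('g fword \<Rightarrow>\<^sub>0 'k::field) set \<Rightarrow> ('g \<Rightarrow> ('g fword \<Rightarrow>\<^sub>0 'k))
    \<Rightarrow> ('g fword \<Rightarrow>\<^sub>0 'k) set \<Rightarrow> ('g fword \<Rightarrow>\<^sub>0 'k) set" where
  "hom_induced S \<gamma> = (\<lambda>c\<in>carrier (presented S). coset S (free_hom scalar \<gamma> (rep S c)))"

lemma hom_induced_coset:
  assumes "\<And>r. r \<in> S \<Longrightarrow> free_hom scalar \<gamma> r \<in> relation_ideal S"
  shows "hom_induced S \<gamma> (coset S f) = coset S (free_hom scalar \<gamma> f)"
  unfolding hom_induced_def
  using coset_cong_linear_op[OF linear_op_free_hom free_hom_relation_ideal[OF assms] coset_rep] by simp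

text \<open>Finite order on letters supplies the inverse.\<close>

lemma hom_induced_in_algebra_auts:
  assumes rel: "\<And>r. r \<in> S \<Longrightarrow> free_hom scalar \<gamma> r \<in> relation_ideal S"
    and pow: "\<And>y. (free_hom scalar \<gamma> ^^ n) (letter y) = letter y" and n: "n > 0"
  shows "hom_induced S \<gamma> \<in> algebra_auts S"
proof -
  note ind = hom_induced_coset[OF rel]
  have iter: "(hom_induced S \<gamma> ^^ k) (coset S f) = coset S ((free_hom scalar \<gamma> ^^ k) f)" for k f
    by (induction k) (simp_all add: ind)
  have closed: "hom_induced S \<gamma> \<in> carrier (presented S) \<rightarrow> carrier (presented S)"
    by (auto simp: carrier_presented ind)
  have closed': "(hom_induced S \<gamma> ^^ k) \<in> carrier (presented S) \<rightarrow> carrier (presented S)" for k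
    by (auto simp: carrier_presented iter)
  obtain k where k: "n = Suc k" using n gr0_implies_Suc by blast
  have id: "(hom_induced S \<gamma> ^^ n) (coset S f) = coset S f" for f
    by (simp only: iter free_hom_funpow_id[OF pow])
  have "bij_betw (hom_induced S \<gamma>) (carrier (presented S)) (carrier (presented S))"
  proof (rule bij_betw_byWitness[where f' = "hom_induced S \<gamma> ^^ k"])
    show "\<forall>c\<in>carrier (presented S). (hom_induced S \<gamma> ^^ k) (hom_induced S \<gamma> c) = c"
      using id by (auto simp: carrier_presented k funpow_swap1)
    show "\<forall>c\<in>carrier (presented S). hom_induced S \<gamma> ((hom_induced S \<gamma> ^^ k) c) = c"
      using id by (auto simp: carrier_presented k)
  qed (use closed closed'[of k] in auto)
  moreover have "hom_induced S \<gamma> \<in> extensional (carrier (presented S))"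
    by (simp add: hom_induced_def)
  moreover have "hom_induced S \<gamma> \<in> ring_hom (presented S) (presented S)"
    by (rule ring_hom_memI) (auto simp: carrier_presented ind coset_simps scalar.free_hom_mult scalar.free_hom_add)
  moreover have "linear_between S S (hom_induced S \<gamma>)"
    unfolding linear_between_def
    by (auto simp: carrier_presented ind coset_simps scalar.free_hom_add scalar.free_hom_scale)
  ultimately show ?thesis
    by (simp add: algebra_auts_def Bij_def)
qed

text \<open>Automorphisms are extensional functions, so agreement on the generators gives equality.\<close>

lemma algebra_auts_eqI:
  assumes \<phi>: "\<phi> \<in> algebra_auts S" and \<psi>: "\<psi> \<in> algebra_auts S"
    and eq: "\<And>y. \<phi> (coset S (letter y)) = \<psi> (coset S (letter y))"
  shows "\<phi> = \<psi>"
proof (rule extensionalityI)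
  show "\<phi> \<in> extensional (carrier (presented S))" "\<psi> \<in> extensional (carrier (presented S))"
    using \<phi> \<psi> by (simp_all add: algebra_auts_def Bij_def)
  have \<phi>h: "\<phi> \<in> ring_hom (presented S) (presented S)" "linear_between S S \<phi>"
    and \<psi>h: "\<psi> \<in> ring_hom (presented S) (presented S)" "linear_between S S \<psi>"
    using \<phi> \<psi> by (simp_all add: algebra_auts_def)
  have words: "\<phi> (coset S (word w)) = \<psi> (coset S (word w))" for w
  proof (induction w)
    case Nil
    then show ?case
      using ring_hom_one[OF \<phi>h(1)] ring_hom_one[OF \<psi>h(1)] by (simp add: coset_one)
  next
    case (Cons y w)
    then show ?case
      using ring_hom_mult[OF \<phi>h(1), of "coset S (letter y)" "coset S (word w)"]
        ring_hom_mult[OF \<psi>h(1), of "coset S (letter y)" "coset S (word w)"] eq[of y]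
      by (simp add: coset_mult word_Cons)
  qed
  have "\<phi> (coset S f) = \<psi> (coset S f)" for f
  proof (induction f rule: poly_mapping_span_induct)
    case (single w c)
    have "Poly_Mapping.single w c = scalar c * word (letters w)"
      by (simp add: scalar_times_single)
    then show ?case by (simp only: linear_betweenD[OF \<phi>h(2)] linear_betweenD[OF \<psi>h(2)] words)
  next
    case (add f g)
    then show ?case by (simp add: linear_betweenD[OF \<phi>h(2)] linear_betweenD[OF \<psi>h(2)])
  qed
  then show "\<phi> c = \<psi> c" if "c \<in> carrier (presented S)" for c
    using that by (auto simp: carrier_presented)
qed

section \<open>Linear and quadratic forms\<close>

definition lin_form :: "('g::finite \<Rightarrow> 'k::field) \<Rightarrow> ('g fword \<Rightarrow>\<^sub>0 'k)" where
  "lin_form c = (\<Sum>y\<in>UNIV. scalar (c y) * letter y)"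

definition quad_form :: "('g::finite \<Rightarrow> 'g \<Rightarrow> 'k::field) \<Rightarrow> ('g fword \<Rightarrow>\<^sub>0 'k)" where
  "quad_form M = (\<Sum>y\<in>UNIV. \<Sum>z\<in>UNIV. scalar (M y z) * (letter y * letter z))"

lemma lookup_mult_low:
  fixes f g :: "'g fword \<Rightarrow>\<^sub>0 'k::field"
  shows "Poly_Mapping.lookup (f * g) 0 = Poly_Mapping.lookup f 0 * Poly_Mapping.lookup g 0" (is "?P0 f g")
    and "Poly_Mapping.lookup (f * g) (FWord [y]) = Poly_Mapping.lookup f 0 * Poly_Mapping.lookup g (FWord [y])
          + Poly_Mapping.lookup f (FWord [y]) * Poly_Mapping.lookup g 0" (is "?P1 f g")
    and "Poly_Mapping.lookup (f * g) (FWord [y, z]) = Poly_Mapping.lookup f 0 * Poly_Mapping.lookup g (FWord [y, z])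
          + Poly_Mapping.lookup f (FWord [y]) * Poly_Mapping.lookup g (FWord [z])
          + Poly_Mapping.lookup f (FWord [y, z]) * Poly_Mapping.lookup g 0" (is "?P2 f g")
proof -
  have "?P0 f g \<and> ?P1 f g \<and> ?P2 f g"
  proof (induction f rule: poly_mapping_span_induct)
    case (single u c)
    show ?case
    proof (induction g rule: poly_mapping_span_induct)
      case (single v d)
      show ?case
        by (cases u; cases v)
          (auto simp: mult_single lookup_single when_def zero_fword_def plus_fword_def
            append_eq_Cons_conv simp del: FWord_zero)
    qed (simp add: distrib_left lookup_add algebra_simps)
  qed (simp add: distrib_right lookup_add algebra_simps)
  then show "?P0 f g" "?P1 f g" "?P2 f g" by auto
qed

lemma lookup_scalar [simp]:
  "Poly_Mapping.lookup (scalar c :: 'g fword \<Rightarrow>\<^sub>0 'k::field) 0 = c"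
  "Poly_Mapping.lookup (scalar c :: 'g fword \<Rightarrow>\<^sub>0 'k::field) (FWord (y # w)) = 0"
  by (simp_all add: scalar_def lookup_single zero_fword_def del: FWord_zero)

lemma lookup_letter:
  "Poly_Mapping.lookup (letter y) 0 = (0::'k::field)"
  "Poly_Mapping.lookup (letter y) (FWord [z]) = (if z = y then 1 else (0::'k))"
  "Poly_Mapping.lookup (letter y) (FWord [z, z']) = (0::'k)"
  by (auto simp: letter_def lookup_single when_def zero_fword_def simp del: FWord_zero)

lemma lookup_lin_form:
  "Poly_Mapping.lookup (lin_form c) 0 = 0"
  "Poly_Mapping.lookup (lin_form c) (FWord [y]) = c y"
  "Poly_Mapping.lookup (lin_form c) (FWord [y, z]) = 0"
  by (simp_all add: lin_form_def lookup_sum lookup_letter if_distrib[of "\<lambda>t. _ * t"] cong: if_cong)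

lemma lookup_quad_form:
  "Poly_Mapping.lookup (quad_form M) 0 = 0"
  "Poly_Mapping.lookup (quad_form M) (FWord [y]) = 0"
  "Poly_Mapping.lookup (quad_form M) (FWord [y, z]) = M y z"
proof -
  have *: "(\<Sum>u\<in>UNIV. \<Sum>v\<in>UNIV. M u v * ((if y = u then 1 else 0) * (if z = v then 1 else 0)))
      = (\<Sum>u\<in>UNIV. if y = u then \<Sum>v\<in>UNIV. if z = v then M u v else 0 else 0)"
    by (intro sum.cong refl) (simp add: if_distrib cong: if_cong)
  then show "Poly_Mapping.lookup (quad_form M) (FWord [y, z]) = M y z"
    by (simp add: quad_form_def lookup_sum lookup_mult_low(3) lookup_letter *)
qed (simp_all add: quad_form_def lookup_sum lookup_mult_low lookup_letter)

lemma letter_eq_lin_form: "letter y = lin_form (\<lambda>z. if z = y then 1 else 0)"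
  unfolding lin_form_def
  by (simp add: if_distrib[of scalar] if_distrib[of "\<lambda>t. t * _"] cong: if_cong)

lemma lin_form_scale: "scalar k * lin_form c = lin_form (\<lambda>z. k * c z)"
  by (simp add: lin_form_def scalar_mult sum_distrib_left mult.assoc)

lemma lin_form_mult: "lin_form c * lin_form d = quad_form (\<lambda>y z. c y * d z)"
proof -
  have "(scalar a * f) * (scalar b * g) = scalar (a * b) * (f * g)" for a b :: 'b and f g :: "'a fword \<Rightarrow>\<^sub>0 'b"
    by (simp only: scalar_mult mult.assoc scalar_left_commute[of f b g])
  then show ?thesis
    by (simp add: lin_form_def quad_form_def sum_product)
qed

lemma quad_form_add: "quad_form M + quad_form N = quad_form (\<lambda>y z. M y z + N y z)"
  and quad_form_diff: "quad_form M - quad_form N = quad_form (\<lambda>y z. M y z - N y z)"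
  and quad_form_scale: "scalar k * quad_form M = quad_form (\<lambda>y z. k * M y z)"
  by (simp_all add: quad_form_def scalar_add scalar_diff scalar_mult distrib_right left_diff_distrib
      sum.distrib sum_subtractf sum_distrib_left mult.assoc)

definition prod_matrix :: "'g \<Rightarrow> 'g \<Rightarrow> 'g \<Rightarrow> 'g \<Rightarrow> 'k::field" where
  "prod_matrix a b = (\<lambda>y z. (if y = a then 1 else 0) * (if z = b then 1 else 0))"

lemma letter_mult: "letter a * letter b = quad_form (prod_matrix a b)"
  by (simp add: letter_eq_lin_form lin_form_mult prod_matrix_def)

text \<open>The coefficients of the quadratic form \<open>x(a b) = g(a) x(b) + x(a) b\<close> for two generators \<open>a\<close> and \<open>b\<close>; row \<open>y\<close>
  of \<open>g\<close> or \<open>x\<close> holds the coordinates of the image of the generator \<open>y\<close>.\<close>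

definition skew_matrix :: "('g \<Rightarrow> 'g \<Rightarrow> 'k::field) \<Rightarrow> ('g \<Rightarrow> 'g \<Rightarrow> 'k) \<Rightarrow> 'g \<Rightarrow> 'g \<Rightarrow> 'g \<Rightarrow> 'g \<Rightarrow> 'k" where
  "skew_matrix g x a b = (\<lambda>u v. g a u * x b v + x a u * (if v = b then 1 else 0))"

lemma skew_letter_mult:
  "skew (\<lambda>y. lin_form (g y)) (\<lambda>y. lin_form (x y)) (letter a * letter b) = quad_form (skew_matrix g x a b)"
  unfolding skew_mult skew_letter scalar.free_hom_letter
  by (simp add: letter_eq_lin_form lin_form_mult quad_form_add skew_matrix_def)

lemma free_hom_letter_mult:
  "free_hom scalar (\<lambda>y. lin_form (g y)) (letter a * letter b) = quad_form (\<lambda>u v. g a u * g b v)"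
  by (simp add: scalar.free_hom_mult lin_form_mult)

text \<open>On linear forms \<open>x\<close> acts as a matrix; the twist \<open>g\<close> enters only in degree two and higher.\<close>

lemma skew_lin_form:
  "skew \<gamma> (\<lambda>y. lin_form (x y)) (lin_form c) = lin_form (\<lambda>z. \<Sum>y\<in>UNIV. c y * x y z)"
proof -
  have "skew \<gamma> (\<lambda>y. lin_form (x y)) (lin_form c) = (\<Sum>y\<in>UNIV. scalar (c y) * lin_form (x y))"
    by (simp add: lin_form_def[of c] linear_op_sum[OF linear_op_skew] linear_op_scale[OF linear_op_skew])
  also have "\<dots> = (\<Sum>y\<in>UNIV. \<Sum>z\<in>UNIV. scalar (c y * x y z) * letter z)"
    by (simp add: lin_form_def sum_distrib_left scalar_mult mult.assoc)
  also have "\<dots> = (\<Sum>z\<in>UNIV. \<Sum>y\<in>UNIV. scalar (c y * x y z) * letter z)"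
    by (rule sum.swap)
  also have "\<dots> = lin_form (\<lambda>z. \<Sum>y\<in>UNIV. c y * x y z)"
  proof -
    have "scalar (\<Sum>y\<in>J. h y) = (\<Sum>y\<in>J. scalar (h y) :: 'a fword \<Rightarrow>\<^sub>0 'b)" for h and J :: "'a set"
      by (induction J rule: infinite_finite_induct) (simp_all add: scalar_add)
    then show ?thesis by (simp add: lin_form_def sum_distrib_right)
  qed
  finally show ?thesis .
qed

section \<open>The relations of quantum matrices in low degree\<close>

lemma UNIV_index: "(UNIV :: (2 \<times> 2) set) = {(1, 1), (1, 2), (2, 1), (2, 2)}"
  using exhaust_2 by fastforce

lemma all_index: "(\<forall>p :: 2 \<times> 2. P p) \<longleftrightarrow> P (1, 1) \<and> P (1, 2) \<and> P (2, 1) \<and> P (2, 2)"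
  by (simp add: split_paired_all forall_2 conj_assoc)

text \<open>The coefficients of the form with matrix \<open>M\<close> after rewriting to the ordered monomials
  \<open>A\<^sup>2, B\<^sup>2, C\<^sup>2, D\<^sup>2, AB, AC, BD, CD, AD, BC\<close>, multiplied by \<open>q\<close> where a rewriting step divides by \<open>q\<close>.\<close>

definition null_quad :: "'k::field \<Rightarrow> (2 \<times> 2 \<Rightarrow> 2 \<times> 2 \<Rightarrow> 'k) \<Rightarrow> bool" where
  "null_quad q M \<longleftrightarrow> (let A = (1, 1); B = (1, 2); C = (2, 1); D = (2, 2) in
     M A A = 0 \<and> M B B = 0 \<and> M C C = 0 \<and> M D D = 0 \<and>
     q * M A B + M B A = 0 \<and> q * M A C + M C A = 0 \<and> q * M B D + M D B = 0 \<and> q * M C D + M D C = 0 \<and>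
     M A D + M D A = 0 \<and> M B C + M C B = (q - inverse q) * M D A)"

lemma null_quad_add:
  assumes "null_quad q M" "null_quad q N"
  shows "null_quad q (\<lambda>y z. M y z + N y z)"
proof -
  have comb: "k * a + b = t * c \<Longrightarrow> k * a' + b' = t * c' \<Longrightarrow> k * (a + a') + (b + b') = t * (c + c')"
    for k a b t c a' b' c' :: 'a
    by (metis (no_types, opaque_lifting) add.assoc add.left_commute distrib_left)
  show ?thesis
    using assms comb[of q _ _ 0 0 _ _ 0] comb[of 1 _ _ 0 0 _ _ 0] comb[of 1 _ _ "q - inverse q"]
    unfolding null_quad_def Let_def by simp
qed

lemma qmat_relations_eq:
  "qmat_relations q = quad_form `
    {\<lambda>y z. prod_matrix (1, 1) (1, 2) y z - q * prod_matrix (1, 2) (1, 1) y z,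
     \<lambda>y z. prod_matrix (1, 1) (2, 1) y z - q * prod_matrix (2, 1) (1, 1) y z,
     \<lambda>y z. prod_matrix (1, 2) (2, 2) y z - q * prod_matrix (2, 2) (1, 2) y z,
     \<lambda>y z. prod_matrix (2, 1) (2, 2) y z - q * prod_matrix (2, 2) (2, 1) y z,
     \<lambda>y z. prod_matrix (1, 2) (2, 1) y z - prod_matrix (2, 1) (1, 2) y z,
     \<lambda>y z. prod_matrix (1, 1) (2, 2) y z - (prod_matrix (2, 2) (1, 1) y z
       + (q - inverse q) * prod_matrix (1, 2) (2, 1) y z)}"
  by (simp add: qmat_relations_def Let_def mult.assoc letter_mult quad_form_scale quad_form_diff quad_form_add)

text \<open>The relations are homogeneous of degree two, so \<open>a r b\<close> has the same part of degree at most two as \<open>a\<^sub>0 b\<^sub>0 r\<close>,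
  where \<open>a\<^sub>0\<close> and \<open>b\<^sub>0\<close> are the constant terms.  Hence the elements without constant and linear part whose
  quadratic part satisfies the ten equations form a two-sided ideal.\<close>

lemma relation_ideal_qmat_low:
  assumes "f \<in> relation_ideal (qmat_relations q)"
  shows "Poly_Mapping.lookup f (FWord [y]) = 0"
    and "null_quad q (\<lambda>y z. Poly_Mapping.lookup f (FWord [y, z]))"
proof -
  let ?J = "{f. Poly_Mapping.lookup f 0 = 0 \<and> (\<forall>y. Poly_Mapping.lookup f (FWord [y]) = 0) \<and>
    null_quad q (\<lambda>y z. Poly_Mapping.lookup f (FWord [y, z]))}"
  have scale: "null_quad q (\<lambda>y z. c * M y z)" if "null_quad q M" for c M
    using that unfolding null_quad_def Let_def
    by (simp add: mult.left_commute[of _ c] flip: distrib_left)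
  have "relation_ideal (qmat_relations q) \<subseteq> ?J"
  proof (rule relation_ideal_least)
    show "qmat_relations q \<subseteq> ?J"
      unfolding qmat_relations_eq
      by (auto simp: lookup_quad_form) (simp_all add: null_quad_def prod_matrix_def)
    show "0 \<in> ?J" by (simp add: null_quad_def)
  next
    fix f g assume "f \<in> ?J" "g \<in> ?J"
    then show "f + g \<in> ?J" by (auto simp: lookup_add intro: null_quad_add)
  next
    fix h f assume "f \<in> ?J"
    then have f: "Poly_Mapping.lookup f 0 = 0" "\<And>y. Poly_Mapping.lookup f (FWord [y]) = 0"
      "null_quad q (\<lambda>y z. Poly_Mapping.lookup f (FWord [y, z]))" by blast+
    then show "h * f \<in> ?J" "f * h \<in> ?J"
      using scale[of "\<lambda>y z. Poly_Mapping.lookup f (FWord [y, z])" "Poly_Mapping.lookup h 0"]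
      by (simp_all add: lookup_mult_low f mult.commute del: split_paired_All)
  qed
  with assms show "Poly_Mapping.lookup f (FWord [y]) = 0"
    and "null_quad q (\<lambda>y z. Poly_Mapping.lookup f (FWord [y, z]))" by blast+
qed

text \<open>Six of the sixteen coefficients are free, and they determine the multipliers of the six relations in an
  explicit combination.\<close>

lemma quad_form_in_relation_ideal_iff:
  "quad_form M \<in> relation_ideal (qmat_relations q) \<longleftrightarrow> null_quad q M"
proof
  assume "quad_form M \<in> relation_ideal (qmat_relations q)"
  from relation_ideal_qmat_low(2)[OF this] show "null_quad q M"
    by (simp add: lookup_quad_form)
next
  assume null: "null_quad q M"
  let ?A = "letter (1, 1) :: _ \<Rightarrow>\<^sub>0 'a" and ?B = "letter (1, 2) :: _ \<Rightarrow>\<^sub>0 'a"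
  let ?C = "letter (2, 1) :: _ \<Rightarrow>\<^sub>0 'a" and ?D = "letter (2, 2) :: _ \<Rightarrow>\<^sub>0 'a"
  let ?N = "scalar (M (1, 1) (1, 2)) * (?A * ?B - scalar q * ?B * ?A)
    + scalar (M (1, 1) (2, 1)) * (?A * ?C - scalar q * ?C * ?A)
    + scalar (M (1, 2) (2, 2)) * (?B * ?D - scalar q * ?D * ?B)
    + scalar (M (2, 1) (2, 2)) * (?C * ?D - scalar q * ?D * ?C)
    + scalar (M (1, 2) (2, 1) + (q - inverse q) * M (1, 1) (2, 2)) * (?B * ?C - ?C * ?B)
    + scalar (M (1, 1) (2, 2)) * (?A * ?D - (?D * ?A + scalar (q - inverse q) * ?B * ?C))"
  have "?N \<in> relation_ideal (qmat_relations q)"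
    by (intro relation_ideal_add relation_ideal_mult_left relation_ideal_base)
      (simp_all add: qmat_relations_def Let_def)
  moreover have "quad_form M = ?N"
  proof -
    have coeffs: "M (1, 1) (1, 1) = 0" "M (1, 2) (1, 2) = 0" "M (2, 1) (2, 1) = 0" "M (2, 2) (2, 2) = 0"
      "M (1, 2) (1, 1) = - (q * M (1, 1) (1, 2))" "M (2, 1) (1, 1) = - (q * M (1, 1) (2, 1))"
      "M (2, 2) (1, 2) = - (q * M (1, 2) (2, 2))" "M (2, 2) (2, 1) = - (q * M (2, 1) (2, 2))"
      "M (2, 2) (1, 1) = - M (1, 1) (2, 2)"
      "M (2, 1) (1, 2) = - (q - inverse q) * M (1, 1) (2, 2) - M (1, 2) (2, 1)"
      using null unfolding null_quad_def Let_def by (auto simp: add_eq_0_iff algebra_simps)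
    have "\<forall>y z. M y z = M (1, 1) (1, 2) * (prod_matrix (1, 1) (1, 2) y z - q * prod_matrix (1, 2) (1, 1) y z)
      + M (1, 1) (2, 1) * (prod_matrix (1, 1) (2, 1) y z - q * prod_matrix (2, 1) (1, 1) y z)
      + M (1, 2) (2, 2) * (prod_matrix (1, 2) (2, 2) y z - q * prod_matrix (2, 2) (1, 2) y z)
      + M (2, 1) (2, 2) * (prod_matrix (2, 1) (2, 2) y z - q * prod_matrix (2, 2) (2, 1) y z)
      + (M (1, 2) (2, 1) + (q - inverse q) * M (1, 1) (2, 2))
        * (prod_matrix (1, 2) (2, 1) y z - prod_matrix (2, 1) (1, 2) y z)
      + M (1, 1) (2, 2) * (prod_matrix (1, 1) (2, 2) y z - (prod_matrix (2, 2) (1, 1) y z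
          + (q - inverse q) * prod_matrix (1, 2) (2, 1) y z))" (is "\<forall>y z. M y z = ?R y z")
      unfolding all_index coeffs by (simp add: prod_matrix_def algebra_simps)
    then have "M = ?R" by (intro ext) blast
    then have "quad_form M = quad_form ?R" by (rule arg_cong)
    also have "\<dots> = ?N"
      by (simp only: mult.assoc letter_mult quad_form_scale quad_form_diff quad_form_add)
    finally show ?thesis .
  qed
  ultimately show "quad_form M \<in> relation_ideal (qmat_relations q)" by (simp only:)
qed

lemma ball_qmat_relations:
  "(\<forall>r\<in>qmat_relations q. P r) \<longleftrightarrow>
    P (letter (1, 1) * letter (1, 2) - scalar q * (letter (1, 2) * letter (1, 1))) \<and>
    P (letter (1, 1) * letter (2, 1) - scalar q * (letter (2, 1) * letter (1, 1))) \<and>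
    P (letter (1, 2) * letter (2, 2) - scalar q * (letter (2, 2) * letter (1, 2))) \<and>
    P (letter (2, 1) * letter (2, 2) - scalar q * (letter (2, 2) * letter (2, 1))) \<and>
    P (letter (1, 2) * letter (2, 1) - letter (2, 1) * letter (1, 2)) \<and>
    P (letter (1, 1) * letter (2, 2) - (letter (2, 2) * letter (1, 1)
      + scalar (q - inverse q) * (letter (1, 2) * letter (2, 1))))"
  by (simp add: qmat_relations_def Let_def mult.assoc)

lemma skew_qmat_relations_iff:
  fixes g x :: "2 \<times> 2 \<Rightarrow> 2 \<times> 2 \<Rightarrow> 'k::field"
  defines "N \<equiv> skew_matrix g x"
  shows "(\<forall>r\<in>qmat_relations q. skew (\<lambda>y. lin_form (g y)) (\<lambda>y. lin_form (x y)) r \<in> relation_ideal (qmat_relations q))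
    \<longleftrightarrow> null_quad q (\<lambda>y z. N (1, 1) (1, 2) y z - q * N (1, 2) (1, 1) y z) \<and>
        null_quad q (\<lambda>y z. N (1, 1) (2, 1) y z - q * N (2, 1) (1, 1) y z) \<and>
        null_quad q (\<lambda>y z. N (1, 2) (2, 2) y z - q * N (2, 2) (1, 2) y z) \<and>
        null_quad q (\<lambda>y z. N (2, 1) (2, 2) y z - q * N (2, 2) (2, 1) y z) \<and>
        null_quad q (\<lambda>y z. N (1, 2) (2, 1) y z - N (2, 1) (1, 2) y z) \<and>
        null_quad q (\<lambda>y z. N (1, 1) (2, 2) y z - (N (2, 2) (1, 1) y z + (q - inverse q) * N (1, 2) (2, 1) y z))"
  unfolding ball_qmat_relations linear_op_diff[OF linear_op_skew]
    linear_op_add[OF linear_op_skew] linear_op_scale[OF linear_op_skew] skew_letter_mult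
    quad_form_scale quad_form_diff quad_form_add N_def[symmetric] quad_form_in_relation_ideal_iff ..

lemma free_hom_qmat_relations:
  fixes g :: "2 \<times> 2 \<Rightarrow> 2 \<times> 2 \<Rightarrow> 'k::field"
  assumes "null_quad q (\<lambda>y z. g (1, 1) y * g (1, 2) z - q * (g (1, 2) y * g (1, 1) z))"
    and "null_quad q (\<lambda>y z. g (1, 1) y * g (2, 1) z - q * (g (2, 1) y * g (1, 1) z))"
    and "null_quad q (\<lambda>y z. g (1, 2) y * g (2, 2) z - q * (g (2, 2) y * g (1, 2) z))"
    and "null_quad q (\<lambda>y z. g (2, 1) y * g (2, 2) z - q * (g (2, 2) y * g (2, 1) z))"
    and "null_quad q (\<lambda>y z. g (1, 2) y * g (2, 1) z - g (2, 1) y * g (1, 2) z)"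
    and "null_quad q (\<lambda>y z. g (1, 1) y * g (2, 2) z
      - (g (2, 2) y * g (1, 1) z + (q - inverse q) * (g (1, 2) y * g (2, 1) z)))"
    and "r \<in> qmat_relations q"
  shows "free_hom scalar (\<lambda>y. lin_form (g y)) r \<in> relation_ideal (qmat_relations q)"
proof -
  have "\<forall>r\<in>qmat_relations q. free_hom scalar (\<lambda>y. lin_form (g y)) r \<in> relation_ideal (qmat_relations q)"
    unfolding ball_qmat_relations linear_op_diff[OF linear_op_free_hom]
      linear_op_add[OF linear_op_free_hom] linear_op_scale[OF linear_op_free_hom] free_hom_letter_mult
      quad_form_scale quad_form_diff quad_form_add quad_form_in_relation_ideal_iff
    using assms by blast
  with assms show ?thesis by blast
qed

section \<open>Rank one matrices of size two\<close>

lemma rank_one_iff: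
  fixes T :: "2 \<Rightarrow> 2 \<Rightarrow> 'k::field"
  assumes nz: "T 1 1 \<noteq> 0"
  shows "rank ((\<chi> i j. T i j) :: 'k^2^2) = 1 \<longleftrightarrow> T 1 1 * T 2 2 = T 1 2 * T 2 1"
proof -
  define M :: "'k^2^2" where "M = (\<chi> i j. T i j)"
  have "T 1 1 * T 2 2 = T 1 2 * T 2 1" if r: "rank M = 1"
  proof (rule ccontr)
    assume "\<not> ?thesis"
    then have "det M \<noteq> 0" by (simp add: det_2 M_def)
    then have "vec.span (rows M) = UNIV"
      using invertible_det_nz[of M] invertible_left_inverse[of M] matrix_left_invertible_span_rows_gen[of M] by auto
    then have "vec.dim (rows M) = CARD(2)"
      by (metis vec.dim_span vec_dim_card)
    with r show False by (simp add: row_rank_def_gen)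
  qed
  moreover have "rank M = 1" if d: "T 1 1 * T 2 2 = T 1 2 * T 2 1"
  proof -
    have "rows M = (\<lambda>i. row i M) ` UNIV"
      by (auto simp: rows_def)
    then have rows: "rows M = insert (row 2 M) {row 1 M}"
      by (auto simp: UNIV_2)
    have "row 2 M = (T 2 1 / T 1 1) *s row 1 M"
      using nz d by (simp add: vec_eq_iff forall_2 row_def M_def field_simps)
    then have "row 2 M \<in> vec.span {row 1 M}"
      by (auto simp: vec.span_singleton)
    moreover have "row 1 M \<noteq> 0"
      using nz by (auto simp: vec_eq_iff row_def M_def)
    ultimately show ?thesis
      by (simp add: row_rank_def_gen rows vec.dim_insert)
  qed
  ultimately show ?thesis unfolding M_def by blast
qed

section \<open>The equations for diagonal automorphisms\<close>

abbreviation (input) "iA \<equiv> (1, 1) :: 2 \<times> 2"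
abbreviation (input) "iB \<equiv> (1, 2) :: 2 \<times> 2"
abbreviation (input) "iC \<equiv> (2, 1) :: 2 \<times> 2"
abbreviation (input) "iD \<equiv> (2, 2) :: 2 \<times> 2"

definition by_index :: "'a \<Rightarrow> 'a \<Rightarrow> 'a \<Rightarrow> 'a \<Rightarrow> 2 \<times> 2 \<Rightarrow> 'a" where
  "by_index a b c d p = table a b c d (fst p) (snd p)"

lemma by_index_simps [simp]:
  "by_index a b c d iA = a" "by_index a b c d iB = b" "by_index a b c d iC = c" "by_index a b c d iD = d"
  by (simp_all add: by_index_def table_def)

lemma eq_by_index_iff: "f = by_index a b c d \<longleftrightarrow> f iA = a \<and> f iB = b \<and> f iC = c \<and> f iD = d"
proof -
  have "f = by_index a b c d \<longleftrightarrow> (\<forall>p. f p = by_index a b c d p)" by (rule fun_eq_iff)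
  then show ?thesis unfolding all_index by simp
qed

definition diagonal :: "('i \<Rightarrow> 'k::zero) \<Rightarrow> 'i \<Rightarrow> 'i \<Rightarrow> 'k" where
  "diagonal w = (\<lambda>y u. if u = y then w y else 0)"

text \<open>The equations for diagonal \<open>g\<close> with weights \<open>w\<close> and \<open>x\<close> with zero diagonal.  The six blocks come from the
  relations for \<open>AB, AC, BD, CD, BC, AD\<close> in this order, and each line is one coefficient.\<close>

definition diagonal_system :: "'k::field \<Rightarrow> (2 \<times> 2 \<Rightarrow> 'k) \<Rightarrow> (2 \<times> 2 \<Rightarrow> 2 \<times> 2 \<Rightarrow> 'k) \<Rightarrow> bool" where
  "diagonal_system q w x \<longleftrightarrow>
    ((x iB iA = 0 \<or> w iA = q) \<and>
     (x iA iB = 0 \<or> q * w iB = 1) \<and>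
     (q = 0 \<or> x iB iC = 0 \<or> w iA = 1) \<and>
     (x iA iD = 0 \<or> q * (q * w iB) = 1) \<and>
     (x iB iD = 0 \<or> w iA = q) \<and>
     x iA iC - q * (w iB * x iA iC) = - ((q - inverse q) * (q * x iB iD))) \<and>
    ((x iC iA = 0 \<or> w iA = q) \<and>
     (x iA iC = 0 \<or> q * w iC = 1) \<and>
     (q = 0 \<or> x iC iB = 0 \<or> w iA = 1) \<and>
     (x iA iD = 0 \<or> q * (q * w iC) = 1) \<and>
     (x iC iD = 0 \<or> w iA = q) \<and>
     x iA iB - q * (w iC * x iA iB) = - ((q - inverse q) * (q * x iC iD))) \<and>
    ((x iD iB = 0 \<or> w iB = q) \<and>
     (x iB iD = 0 \<or> q * w iD = 1) \<and>
     (x iD iA = 0 \<or> w iB = q * q) \<and>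
     (q = 0 \<or> x iB iC = 0 \<or> w iD = 1) \<and>
     (x iB iA = 0 \<or> q * w iD = 1) \<and>
     w iB * x iD iC - q * x iD iC = - ((q - inverse q) * (q * (w iD * x iB iA)))) \<and>
    ((x iD iC = 0 \<or> w iC = q) \<and>
     (x iC iD = 0 \<or> q * w iD = 1) \<and>
     (x iD iA = 0 \<or> w iC = q * q) \<and>
     (q = 0 \<or> x iC iB = 0 \<or> w iD = 1) \<and>
     (x iC iA = 0 \<or> q * w iD = 1) \<and>
     w iC * x iD iB - q * x iD iB = - ((q - inverse q) * (q * (w iD * x iC iA)))) \<and>
    ((x iC iB = 0 \<or> w iB = 1) \<and>
     (x iB iC = 0 \<or> w iC = 1) \<and>
     (x iC iA = 0 \<or> w iB = q) \<and>
     (x iB iA = 0 \<or> q = w iC) \<and>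
     (x iC iD = 0 \<or> q * w iB = 1) \<and>
     (x iB iD = 0 \<or> q * w iC = 1)) \<and>
    ((x iD iA = 0 \<or> w iA = 1) \<and>
     (q = inverse q \<or> w iB = 0 \<or> x iC iB = 0) \<and>
     (q = inverse q \<or> x iB iC = 0) \<and>
     (x iA iD = 0 \<or> w iD = 1) \<and>
     q * (w iA * x iD iB) + (- x iD iB - (q - inverse q) * (w iB * x iC iA)) = 0 \<and>
     q * (w iA * x iD iC - (q - inverse q) * x iB iA) = x iD iC \<and>
     q * (x iA iB - (q - inverse q) * (w iB * x iC iD)) = w iD * x iA iB \<and>
     q * x iA iC + (- (w iD * x iA iC) - (q - inverse q) * x iB iD) = 0)"

lemma skew_diagonal_iff:
  assumes diag: "\<And>y. x y y = 0"
  shows "(\<forall>r\<in>qmat_relations q. skew (\<lambda>y. lin_form (diagonal w y)) (\<lambda>y. lin_form (x y)) r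
       \<in> relation_ideal (qmat_relations q)) \<longleftrightarrow> diagonal_system q w x"
  unfolding skew_qmat_relations_iff null_quad_def Let_def skew_matrix_def diagonal_def diagonal_system_def
  by (rule conj_cong, simp (no_asm) add: diag)
    (rule conj_cong, simp (no_asm) add: diag, rule conj_cong, simp (no_asm) add: diag,
      rule conj_cong, simp (no_asm) add: diag, rule conj_cong, simp (no_asm) add: diag, simp (no_asm) add: diag)

text \<open>All conditions on an action with diagonal \<open>g\<close>: the weights form a matrix of rank one and \<open>g\<^sup>n = 1\<close>, \<open>x\<close>
  multiplies weights by \<open>lam\<close> and is not zero, and \<open>x\<close> is compatible with the relations of quantum matrices.\<close>

definition weighted_solution :: "'k::field \<Rightarrow> nat \<Rightarrow> 'k \<Rightarrow> (2 \<times> 2 \<Rightarrow> 'k) \<Rightarrow> (2 \<times> 2 \<Rightarrow> 2 \<times> 2 \<Rightarrow> 'k) \<Rightarrow> bool" where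
  "weighted_solution q n lam w x \<longleftrightarrow>
    (\<forall>y. w y \<noteq> 0) \<and> w iA * w iD = w iB * w iC \<and> (\<forall>y. w y ^ n = 1) \<and>
    (\<forall>y z. x y z \<noteq> 0 \<longrightarrow> w z = lam * w y) \<and> \<not> (\<forall>y z. x y z = 0) \<and>
    diagonal_system q w x"

text \<open>The list of actions in coordinates: the weights of \<open>g\<close> and the matrix of \<open>x\<close>, whose rows are the images of
  \<open>A, B, C, D\<close>.\<close>

inductive weight_list :: "'k::field \<Rightarrow> nat \<Rightarrow> 'k \<Rightarrow> (2 \<times> 2 \<Rightarrow> 'k) \<Rightarrow> (2 \<times> 2 \<Rightarrow> 2 \<times> 2 \<Rightarrow> 'k) \<Rightarrow> bool"
  for q :: 'k and n lam where
  w1: "\<lbrakk>lam = q powi 2; mult_ord q dvd n; \<delta> \<noteq> 0\<rbrakk> \<Longrightarrow>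
    weight_list q n lam (by_index q (q powi -1) q (q powi -1))
      (by_index (by_index 0 0 0 0) (by_index \<delta> 0 0 0) (by_index 0 0 0 0) (by_index 0 0 \<delta> 0))"
| w2: "\<lbrakk>lam = q powi 2; mult_ord q dvd n; \<delta> \<noteq> 0\<rbrakk> \<Longrightarrow>
    weight_list q n lam (by_index q q (q powi -1) (q powi -1))
      (by_index (by_index 0 0 0 0) (by_index 0 0 0 0) (by_index \<delta> 0 0 0) (by_index 0 \<delta> 0 0))"
| w3: "\<lbrakk>lam = q powi 2; mult_ord q dvd n; \<delta> \<noteq> 0 \<or> \<epsilon> \<noteq> 0\<rbrakk> \<Longrightarrow>
    weight_list q n lam (by_index (q powi -3) (q powi -1) (q powi -1) q)
      (by_index (by_index 0 \<delta> \<epsilon> 0) (by_index 0 0 0 0) (by_index 0 0 0 0) (by_index 0 0 0 0))"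
| w4: "\<lbrakk>lam = q powi -2; mult_ord q dvd n; \<delta> \<noteq> 0\<rbrakk> \<Longrightarrow>
    weight_list q n lam (by_index q (q powi -1) q (q powi -1))
      (by_index (by_index 0 \<delta> 0 0) (by_index 0 0 0 0) (by_index 0 0 0 \<delta>) (by_index 0 0 0 0))"
| w5: "\<lbrakk>lam = q powi -2; mult_ord q dvd n; \<delta> \<noteq> 0\<rbrakk> \<Longrightarrow>
    weight_list q n lam (by_index q q (q powi -1) (q powi -1))
      (by_index (by_index 0 0 \<delta> 0) (by_index 0 0 0 \<delta>) (by_index 0 0 0 0) (by_index 0 0 0 0))"
| w6: "\<lbrakk>lam = q powi -2; mult_ord q dvd n; \<delta> \<noteq> 0 \<or> \<epsilon> \<noteq> 0\<rbrakk> \<Longrightarrow>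
    weight_list q n lam (by_index (q powi -1) q q (q powi 3))
      (by_index (by_index 0 0 0 0) (by_index 0 0 0 0) (by_index 0 0 0 0) (by_index 0 \<delta> \<epsilon> 0))"
| w7: "\<lbrakk>lam = q powi 4; mult_ord (q powi 2) dvd n; \<delta> \<noteq> 0\<rbrakk> \<Longrightarrow>
    weight_list q n lam (by_index (q powi -4) (q powi -2) (q powi -2) 1)
      (by_index (by_index 0 0 0 \<delta>) (by_index 0 0 0 0) (by_index 0 0 0 0) (by_index 0 0 0 0))"
| w8: "\<lbrakk>lam = q powi -4; mult_ord (q powi 2) dvd n; \<delta> \<noteq> 0\<rbrakk> \<Longrightarrow>
    weight_list q n lam (by_index 1 (q powi 2) (q powi 2) (q powi 4))
      (by_index (by_index 0 0 0 0) (by_index 0 0 0 0) (by_index 0 0 0 0) (by_index \<delta> 0 0 0))"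
| wi: "\<lbrakk>mult_ord q = 3; lam = q powi 2; mult_ord q dvd n; \<gamma> \<noteq> 0 \<or> \<delta> \<noteq> 0 \<or> \<epsilon> \<noteq> 0\<rbrakk> \<Longrightarrow>
    weight_list q n lam (by_index 1 (q powi -1) (q powi -1) q)
      (by_index (by_index 0 \<delta> \<epsilon> 0) (by_index 0 0 0 0) (by_index 0 0 0 0) (by_index \<gamma> 0 0 0))"
| wii: "\<lbrakk>mult_ord q = 3; lam = q powi -2; mult_ord q dvd n; \<gamma> \<noteq> 0 \<or> \<delta> \<noteq> 0 \<or> \<epsilon> \<noteq> 0\<rbrakk> \<Longrightarrow>
    weight_list q n lam (by_index (q powi -1) q q 1)
      (by_index (by_index 0 0 0 \<gamma>) (by_index 0 0 0 0) (by_index 0 0 0 0) (by_index 0 \<delta> \<epsilon> 0))"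

lemma powi_simps:
  fixes q :: "'k::field"
  shows "q powi 2 = q ^ 2" "q powi 3 = q ^ 3" "q powi 4 = q ^ 4"
    "q powi -1 = inverse q" "q powi -2 = inverse (q ^ 2)" "q powi -3 = inverse (q ^ 3)" "q powi -4 = inverse (q ^ 4)"
  by (simp_all add: power_int_minus)

text \<open>At \<open>a = 0\<close>, which is not a unit, both sides say \<open>n = 0\<close>.\<close>

lemma mult_ord_dvd_iff: "mult_ord (a :: 'k::field) dvd n \<longleftrightarrow> a ^ n = 1"
proof -
  let ?R = "ring_of_type_algebra :: 'k ring"
  interpret R: ring ?R by (rule ring_ring_of_type_algebra)
  interpret U: group "units_of ?R" by (rule R.units_group)
  have pow: "a [^]\<^bsub>units_of ?R\<^esub> k = a ^ k" for k :: nat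
    by (induction k) (simp_all add: units_of_def mult.commute)
  have one: "\<one>\<^bsub>units_of ?R\<^esub> = 1"
    by (simp add: units_of_def)
  have "\<exists>d. \<forall>k. a ^ k = 1 \<longleftrightarrow> d dvd k"
  proof (cases "a = 0")
    case True
    then have "\<forall>k. a ^ k = 1 \<longleftrightarrow> 0 dvd k" by (simp add: power_0_left)
    then show ?thesis by blast
  next
    case False
    then have "a \<in> Units ?R"
      by (auto simp: Units_def intro!: exI[of _ "inverse a"])
    then show ?thesis
      using U.pow_eq_id[of a] pow by (auto simp: units_of_def)
  qed
  then have "\<forall>k. a ^ k = 1 \<longleftrightarrow> mult_ord a dvd k"
    unfolding mult_ord_def U.ord_def pow one by (rule someI_ex)
  then show ?thesis by simp
qed

lemma mult_ord_eq_3_iff: "mult_ord (q :: 'k::field) = 3 \<longleftrightarrow> q ^ 3 = 1" if "q \<noteq> 0" "q \<noteq> 1"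
proof
  assume "q ^ 3 = 1"
  then have "mult_ord q dvd 3" using that by (simp add: mult_ord_dvd_iff)
  moreover have "prime (3::nat)" by simp
  moreover have "mult_ord q \<noteq> 1"
    using that mult_ord_dvd_iff[of q 1] by auto
  ultimately show "mult_ord q = 3" by (auto simp: prime_nat_iff)
qed (use that mult_ord_dvd_iff[of q 3] in auto)

text \<open>For nilpotency of \<open>x\<close>: rank \<open>2\<close> is needed only in the two families for order \<open>3\<close>, where \<open>x\<close> has chains
  \<open>D \<mapsto> A \<mapsto> B, C\<close> and \<open>A \<mapsto> D \<mapsto> B, C\<close>.\<close>

lemma weight_list_graded:
  assumes "weight_list q n lam w x"
  shows "\<exists>r :: 2 \<times> 2 \<Rightarrow> nat. (\<forall>y. r y \<le> 2) \<and> (\<forall>y z. x y z \<noteq> 0 \<longrightarrow> r z < r y)"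
  using assms
proof cases
  case (w1 \<delta>)
  then show ?thesis
    unfolding all_index by (intro exI[of _ "by_index 0 1 0 1"]) (simp only: by_index_simps, simp)
next
  case (w2 \<delta>)
  then show ?thesis
    unfolding all_index by (intro exI[of _ "by_index 0 0 1 1"]) (simp only: by_index_simps, simp)
next
  case (w3 \<delta> \<epsilon>)
  then show ?thesis
    unfolding all_index by (intro exI[of _ "by_index 1 0 0 0"]) (simp only: by_index_simps, simp)
next
  case (w4 \<delta>)
  then show ?thesis
    unfolding all_index by (intro exI[of _ "by_index 1 0 1 0"]) (simp only: by_index_simps, simp)
next
  case (w5 \<delta>)
  then show ?thesis
    unfolding all_index by (intro exI[of _ "by_index 1 1 0 0"]) (simp only: by_index_simps, simp)
next
  case (w6 \<delta> \<epsilon>)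
  then show ?thesis
    unfolding all_index by (intro exI[of _ "by_index 0 0 0 1"]) (simp only: by_index_simps, simp)
next
  case (w7 \<delta>)
  then show ?thesis
    unfolding all_index by (intro exI[of _ "by_index 1 0 0 0"]) (simp only: by_index_simps, simp)
next
  case (w8 \<delta>)
  then show ?thesis
    unfolding all_index by (intro exI[of _ "by_index 0 0 0 1"]) (simp only: by_index_simps, simp)
next
  case (wi \<gamma> \<delta> \<epsilon>)
  then show ?thesis
    unfolding all_index by (intro exI[of _ "by_index 1 0 0 2"]) (simp only: by_index_simps, simp)
next
  case (wii \<gamma> \<delta> \<epsilon>)
  then show ?thesis
    unfolding all_index by (intro exI[of _ "by_index 2 0 0 1"]) (simp only: by_index_simps, simp)
qed

lemma weight_list_sound:
  assumes q: "q \<noteq> 0" and l: "weight_list q n lam w x"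
  shows "weighted_solution q n lam w x"
proof -
  have pow: "(q ^ k) ^ n = 1" "inverse (q ^ k) ^ n = 1" if "q ^ n = 1" for k
    using that by (simp_all add: power_inverse flip: power_mult) (simp_all add: mult.commute[of k] power_mult)
  have pow2: "(q ^ 4) ^ n = 1" "inverse (q ^ 4) ^ n = 1" "inverse (q ^ 2) ^ n = 1" if "(q ^ 2) ^ n = 1"
  proof -
    have "(q ^ 4) ^ n = ((q ^ 2) ^ n) ^ 2"
      by (simp flip: power_mult)
    with that show "(q ^ 4) ^ n = 1" "inverse (q ^ 4) ^ n = 1" "inverse (q ^ 2) ^ n = 1"
      by (simp_all add: power_inverse)
  qed
  note defs = weighted_solution_def all_index diagonal_system_def
  note simps = powi_simps mult_ord_dvd_iff q
  note cubes = field_simps power2_eq_square power3_eq_cube power4_eq_xxxx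
  show ?thesis
    using l
  proof cases
    case (w1 \<delta>)
    with pow[of 1] show ?thesis unfolding defs w1 by (simp add: simps) (simp add: cubes q)?
  next
    case (w2 \<delta>)
    with pow[of 1] show ?thesis unfolding defs w2 by (simp add: simps) (simp add: cubes q)?
  next
    case (w3 \<delta> \<epsilon>)
    with pow[of 1] pow[of 3] show ?thesis unfolding defs w3 by (simp add: simps) (auto simp add: cubes q)?
  next
    case (w4 \<delta>)
    with pow[of 1] show ?thesis unfolding defs w4 by (simp add: simps) (simp add: cubes q)?
  next
    case (w5 \<delta>)
    with pow[of 1] show ?thesis unfolding defs w5 by (simp add: simps) (simp add: cubes q)?
  next
    case (w6 \<delta> \<epsilon>)
    with pow[of 1] pow[of 3] show ?thesis unfolding defs w6 by (simp add: simps) (auto simp add: cubes q)?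
  next
    case (w7 \<delta>)
    with pow2 show ?thesis unfolding defs w7 by (simp add: simps) (simp add: cubes q)?
  next
    case (w8 \<delta>)
    with pow2 show ?thesis unfolding defs w8 by (simp add: simps) (simp add: cubes q)?
  next
    case (wi \<gamma> \<delta> \<epsilon>)
    have "q ^ 3 = 1" "q ^ n = 1"
      using wi q mult_ord_dvd_iff[of q 3] mult_ord_dvd_iff[of q n] by simp_all
    with wi(4,6) pow[of 1] show ?thesis unfolding defs wi by (simp add: simps) (auto simp add: cubes q)?
  next
    case (wii \<gamma> \<delta> \<epsilon>)
    have "q ^ 3 = 1" "q ^ n = 1"
      using wii q mult_ord_dvd_iff[of q 3] mult_ord_dvd_iff[of q n] by simp_all
    with wii(4,6) pow[of 1] show ?thesis unfolding defs wii by (simp add: simps) (auto simp add: cubes q)?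
  qed
qed

section \<open>Solving the equations\<close>

text \<open>The system in a form ready for case analysis: each entry of \<open>x\<close>, when nonzero, fixes some weights, and the
  last eight equations couple the entries in pairs.\<close>

lemma diagonal_equations:
  fixes x :: "2 \<times> 2 \<Rightarrow> 2 \<times> 2 \<Rightarrow> 'k::field"
  assumes q: "q \<noteq> 0" "q ^ 2 \<noteq> 1" and w: "\<And>y. w y \<noteq> 0"
    and sol: "diagonal_system q w x"
  shows "x iB iC = 0" "x iC iB = 0"
    and "x iB iA \<noteq> 0 \<Longrightarrow> w iA = q \<and> q * w iD = 1 \<and> w iC = q"
    and "x iC iA \<noteq> 0 \<Longrightarrow> w iA = q \<and> q * w iD = 1 \<and> w iB = q"
    and "x iB iD \<noteq> 0 \<Longrightarrow> w iA = q \<and> q * w iD = 1 \<and> q * w iC = 1"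
    and "x iC iD \<noteq> 0 \<Longrightarrow> w iA = q \<and> q * w iD = 1 \<and> q * w iB = 1"
    and "x iA iB \<noteq> 0 \<Longrightarrow> q * w iB = 1" "x iA iC \<noteq> 0 \<Longrightarrow> q * w iC = 1"
    and "x iD iB \<noteq> 0 \<Longrightarrow> w iB = q" "x iD iC \<noteq> 0 \<Longrightarrow> w iC = q"
    and "x iA iD \<noteq> 0 \<Longrightarrow> q ^ 2 * w iB = 1 \<and> q ^ 2 * w iC = 1 \<and> w iD = 1"
    and "x iD iA \<noteq> 0 \<Longrightarrow> w iB = q ^ 2 \<and> w iC = q ^ 2 \<and> w iA = 1"
    and "(1 - q * w iB) * x iA iC = (1 - q ^ 2) * x iB iD"
    and "(1 - q * w iC) * x iA iB = (1 - q ^ 2) * x iC iD"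
    and "(w iB - q) * x iD iC = (1 - q ^ 2) * (w iD * x iB iA)"
    and "(w iC - q) * x iD iB = (1 - q ^ 2) * (w iD * x iC iA)"
    and "(w iD - q) * x iA iB = (1 - q ^ 2) * (w iB * x iC iD)"
    and "q * ((w iD - q) * x iA iC) = (1 - q ^ 2) * x iB iD"
    and "q * ((q * w iA - 1) * x iD iB) = (q ^ 2 - 1) * (w iB * x iC iA)"
    and "(q * w iA - 1) * x iD iC = (q ^ 2 - 1) * x iB iA"
proof -
  have ii: "q \<noteq> inverse q"
    using q by (metis power2_eq_square right_inverse)
  note eqs = sol[unfolded diagonal_system_def]
  have dis:
    "x iB iA = 0 \<or> w iA = q" "x iB iA = 0 \<or> q * w iD = 1" "x iB iA = 0 \<or> q = w iC"
    "x iC iA = 0 \<or> w iA = q" "x iC iA = 0 \<or> q * w iD = 1" "x iC iA = 0 \<or> w iB = q"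
    "x iB iD = 0 \<or> w iA = q" "x iB iD = 0 \<or> q * w iD = 1" "x iB iD = 0 \<or> q * w iC = 1"
    "x iC iD = 0 \<or> w iA = q" "x iC iD = 0 \<or> q * w iD = 1" "x iC iD = 0 \<or> q * w iB = 1"
    "x iA iB = 0 \<or> q * w iB = 1" "x iA iC = 0 \<or> q * w iC = 1"
    "x iD iB = 0 \<or> w iB = q" "x iD iC = 0 \<or> w iC = q"
    "x iA iD = 0 \<or> q * (q * w iB) = 1" "x iA iD = 0 \<or> q * (q * w iC) = 1" "x iA iD = 0 \<or> w iD = 1"
    "x iD iA = 0 \<or> w iB = q * q" "x iD iA = 0 \<or> w iC = q * q" "x iD iA = 0 \<or> w iA = 1"
    "q = inverse q \<or> w iB = 0 \<or> x iC iB = 0" "q = inverse q \<or> x iB iC = 0"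
    by (simp_all only: eqs simp_thms)
  show "x iB iC = 0" "x iC iB = 0"
    using dis(23,24) ii w by blast+
  show "x iB iA \<noteq> 0 \<Longrightarrow> w iA = q \<and> q * w iD = 1 \<and> w iC = q"
    and "x iC iA \<noteq> 0 \<Longrightarrow> w iA = q \<and> q * w iD = 1 \<and> w iB = q"
    and "x iB iD \<noteq> 0 \<Longrightarrow> w iA = q \<and> q * w iD = 1 \<and> q * w iC = 1"
    and "x iC iD \<noteq> 0 \<Longrightarrow> w iA = q \<and> q * w iD = 1 \<and> q * w iB = 1"
    and "x iA iB \<noteq> 0 \<Longrightarrow> q * w iB = 1" "x iA iC \<noteq> 0 \<Longrightarrow> q * w iC = 1"
    and "x iD iB \<noteq> 0 \<Longrightarrow> w iB = q" "x iD iC \<noteq> 0 \<Longrightarrow> w iC = q"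
    and "x iA iD \<noteq> 0 \<Longrightarrow> q ^ 2 * w iB = 1 \<and> q ^ 2 * w iC = 1 \<and> w iD = 1"
    and "x iD iA \<noteq> 0 \<Longrightarrow> w iB = q ^ 2 \<and> w iC = q ^ 2 \<and> w iA = 1"
    unfolding power2_eq_square mult.assoc using dis by - (metis+)
  have lin:
    "x iA iC - q * (w iB * x iA iC) = - ((q - inverse q) * (q * x iB iD))"
    "x iA iB - q * (w iC * x iA iB) = - ((q - inverse q) * (q * x iC iD))"
    "w iB * x iD iC - q * x iD iC = - ((q - inverse q) * (q * (w iD * x iB iA)))"
    "w iC * x iD iB - q * x iD iB = - ((q - inverse q) * (q * (w iD * x iC iA)))"
    "q * (x iA iB - (q - inverse q) * (w iB * x iC iD)) = w iD * x iA iB"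
    "q * x iA iC + (- (w iD * x iA iC) - (q - inverse q) * x iB iD) = 0"
    "q * (w iA * x iD iB) + (- x iD iB - (q - inverse q) * (w iB * x iC iA)) = 0"
    "q * (w iA * x iD iC - (q - inverse q) * x iB iA) = x iD iC"
    by (simp_all only: eqs simp_thms)
  have p: "(q - inverse q) * (q * t) = (q ^ 2 - 1) * t" for t
    using q by (simp add: field_simps power2_eq_square)
  have p': "q * ((q - inverse q) * t) = (q ^ 2 - 1) * t" for t
    using p[of t] by (simp add: mult.left_commute)
  show "(1 - q * w iB) * x iA iC = (1 - q ^ 2) * x iB iD"
    using lin(1) unfolding p by (simp add: algebra_simps)
  show "(1 - q * w iC) * x iA iB = (1 - q ^ 2) * x iC iD"
    using lin(2) unfolding p by (simp add: algebra_simps)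
  show "(w iB - q) * x iD iC = (1 - q ^ 2) * (w iD * x iB iA)"
    using lin(3) unfolding p by (simp add: algebra_simps)
  show "(w iC - q) * x iD iB = (1 - q ^ 2) * (w iD * x iC iA)"
    using lin(4) unfolding p by (simp add: algebra_simps)
  show "(w iD - q) * x iA iB = (1 - q ^ 2) * (w iB * x iC iD)"
    using lin(5) unfolding right_diff_distrib[of q] p' by (simp add: algebra_simps)
  show "(q * w iA - 1) * x iD iC = (q ^ 2 - 1) * x iB iA"
    using lin(8) unfolding right_diff_distrib[of q] p' by (simp add: algebra_simps)
  have alg: "b - a = - t" and alg': "a - b = t" if "a + (- b - t) = 0" for a b t :: 'k
    using that by (simp_all add: algebra_simps)
  have "(w iD - q) * x iA iC = - ((q - inverse q) * x iB iD)"
    using alg[OF lin(6)] by (simp only: left_diff_distrib)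
  then have "q * ((w iD - q) * x iA iC) = - (q * ((q - inverse q) * x iB iD))"
    by simp
  then show "q * ((w iD - q) * x iA iC) = (1 - q ^ 2) * x iB iD"
    unfolding p' by (simp add: algebra_simps)
  have "(q * w iA - 1) * x iD iB = (q - inverse q) * (w iB * x iC iA)"
    using alg'[OF lin(7)] by (simp only: left_diff_distrib mult.assoc mult_1_left)
  then have "q * ((q * w iA - 1) * x iD iB) = q * ((q - inverse q) * (w iB * x iC iA))"
    by simp
  then show "q * ((q * w iA - 1) * x iD iB) = (q ^ 2 - 1) * (w iB * x iC iA)"
    unfolding p' .
qed

text \<open>Write \<open>(Y,Z)\<close> for the coefficient of \<open>Z\<close> in \<open>x \<cdot> Y\<close>.  A nonzero entry at \<open>(B,A)\<close>, \<open>(C,A)\<close>, \<open>(B,D)\<close> or \<open>(C,D)\<close> fixes all weights, a coupling equation produces an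
  equal second entry, and every further entry would force \<open>q\<^sup>2 = 1\<close> or a pair of transposed entries: these are the
  families 1, 2, 5 and 4.  Otherwise the entries at \<open>(A,B)\<close>, \<open>(A,C)\<close>, or those at \<open>(D,B)\<close>, \<open>(D,C)\<close>, give families
  3 and 6; there an additional entry at \<open>(D,A)\<close> or \<open>(A,D)\<close> is possible, and it forces \<open>q\<^sup>3 = 1\<close>.  If only
  \<open>(A,D)\<close> and \<open>(D,A)\<close> are left, exactly one of them is nonzero.\<close>

lemma weight_list_complete:
  assumes q: "q \<noteq> 0" "q ^ 2 \<noteq> 1" and lam: "lam \<noteq> 1" "lam ^ 2 \<noteq> 1"
    and sol: "weighted_solution q n lam w x"
  shows "weight_list q n lam w x"
proof -
  note sol = sol[unfolded weighted_solution_def]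
  have w: "w y \<noteq> 0" and det: "w iA * w iD = w iB * w iC" and pow: "w y ^ n = 1"
    and shift: "x y z \<noteq> 0 \<Longrightarrow> w z = lam * w y" for y z
    using sol by blast+
  have nz: "\<not> (\<forall>y z. x y z = 0)"
    using sol by blast
  have diag: "x y y = 0" for y
    using shift[of y y] w[of y] lam by auto
  have opp: "x z y = 0" if "x y z \<noteq> 0" for y z
    using shift[of y z] shift[of z y] that w[of y] lam by (auto simp: power2_eq_square)
  have "q \<noteq> 1" using q by auto
  have inv: "t = inverse q" if "q * t = 1" for t
    using that by (simp add: inverse_unique)
  have sq: "q ^ 2 \<noteq> 1" "1 - q ^ 2 \<noteq> 0" "inverse q \<noteq> q" "q \<noteq> inverse q" "q \<noteq> q ^ 2" "inverse q * inverse q \<noteq> 1"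
    using q \<open>q \<noteq> 1\<close> by (auto simp: field_simps power2_eq_square)
  have "diagonal_system q w x"
    using sol by blast
  note eqs = diagonal_equations[OF q w this]
  note zero = diag eqs(1,2)
  have fac: "inverse q - q = (1 - q ^ 2) * inverse q"
    using q by (simp add: field_simps power2_eq_square)
  have ord: "mult_ord q dvd n" if "w y = q" for y
    using that pow[of y] q by (auto simp: mult_ord_dvd_iff)
  have q2: "q * inverse q = 1" "q ^ 2 * inverse q = q" "q * q \<noteq> 1" "inverse q * q = 1"
    using q by (simp_all add: power2_eq_square)
  consider (BA) "x iB iA \<noteq> 0" | (CA) "x iC iA \<noteq> 0" | (BD) "x iB iD \<noteq> 0" | (CD) "x iC iD \<noteq> 0"
    | (AB_AC) "x iB iA = 0" "x iC iA = 0" "x iB iD = 0" "x iC iD = 0" "x iA iB \<noteq> 0 \<or> x iA iC \<noteq> 0"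
    | (DB_DC) "x iB iA = 0" "x iC iA = 0" "x iB iD = 0" "x iC iD = 0" "x iD iB \<noteq> 0 \<or> x iD iC \<noteq> 0"
    | (AD_DA) "x iB iA = 0" "x iC iA = 0" "x iB iD = 0" "x iC iD = 0"
        "x iA iB = 0" "x iA iC = 0" "x iD iB = 0" "x iD iC = 0" by blast
  then show ?thesis
  proof cases
    case BA
    define \<delta> where "\<delta> = x iB iA"
    from eqs(3)[OF BA] have wt: "w iA = q" "w iD = inverse q" "w iC = q" by (metis inv)+
    have w': "w iB = inverse q" using det q unfolding wt by (simp add: field_simps)
    note wts = wt w'
    have \<delta>: "\<delta> \<noteq> 0" using BA by (simp add: \<delta>_def)
    have l: "lam = q ^ 2" using shift[OF BA] wts q by (simp add: field_simps power2_eq_square)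
    have same: "x iD iC = \<delta>"
      using eqs(15) sq(2) q unfolding wts \<delta>_def by (simp add: fac q2 mult.assoc flip: power2_eq_square)
    have zs: "x iA iB = 0" "x iC iD = 0"
      using opp[OF BA] opp[of "iD" "iC"] same \<delta> by auto
    have zs': "x iC iA = 0" "x iA iC = 0" "x iA iD = 0" "x iB iD = 0" "x iD iA = 0" "x iD iB = 0"
      using eqs(4) eqs(8) eqs(11) eqs(5) eqs(12) eqs(9) sq q2(3) \<open>q \<noteq> 1\<close> unfolding wts q2(1,2,4) by - (metis+)
    have "x = by_index (by_index 0 0 0 0) (by_index \<delta> 0 0 0) (by_index 0 0 0 0) (by_index 0 0 \<delta> 0)"
      by (simp add: eq_by_index_iff zero zs zs' same \<delta>_def[symmetric])
    moreover have "w = by_index q (q powi -1) q (q powi -1)"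
      by (simp add: eq_by_index_iff wts powi_simps)
    moreover have "lam = q powi 2" by (simp add: l powi_simps)
    ultimately show ?thesis
      using weight_list.w1[OF _ ord[OF wts(1)] \<delta>, of lam] by simp
  next
    case CA
    define \<delta> where "\<delta> = x iC iA"
    from eqs(4)[OF CA] have wt: "w iA = q" "w iD = inverse q" "w iB = q" by (metis inv)+
    have w': "w iC = inverse q" using det q unfolding wt by (simp add: field_simps)
    note wts = wt w'
    have \<delta>: "\<delta> \<noteq> 0" using CA by (simp add: \<delta>_def)
    have l: "lam = q ^ 2" using shift[OF CA] wts q by (simp add: field_simps power2_eq_square)
    have same: "x iD iB = \<delta>"
      using eqs(16) sq(2) q unfolding wts \<delta>_def by (simp add: fac q2 mult.assoc flip: power2_eq_square)
    have zs: "x iA iC = 0" "x iB iD = 0"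
      using opp[OF CA] opp[of "iD" "iB"] same \<delta> by auto
    have zs': "x iB iA = 0" "x iA iB = 0" "x iA iD = 0" "x iC iD = 0" "x iD iA = 0" "x iD iC = 0"
      using eqs(3) eqs(7) eqs(11) eqs(6) eqs(12) eqs(10) sq q2(3) \<open>q \<noteq> 1\<close> unfolding wts q2(1,2,4) by - (metis+)
    have "x = by_index (by_index 0 0 0 0) (by_index 0 0 0 0) (by_index \<delta> 0 0 0) (by_index 0 \<delta> 0 0)"
      by (simp add: eq_by_index_iff zero zs zs' same \<delta>_def[symmetric])
    moreover have "w = by_index q q (q powi -1) (q powi -1)"
      by (simp add: eq_by_index_iff wts powi_simps)
    moreover have "lam = q powi 2" by (simp add: l powi_simps)
    ultimately show ?thesis
      using weight_list.w2[OF _ ord[OF wts(1)] \<delta>, of lam] by simp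
  next
    case BD
    define \<delta> where "\<delta> = x iB iD"
    from eqs(5)[OF BD] have wt: "w iA = q" "w iD = inverse q" "w iC = inverse q" by (metis inv)+
    have w': "w iB = q" using det q unfolding wt by (simp add: field_simps)
    note wts = wt w'
    have \<delta>: "\<delta> \<noteq> 0" using BD by (simp add: \<delta>_def)
    have l: "lam = inverse (q ^ 2)" using shift[OF BD] wts q by (simp add: field_simps power2_eq_square)
    have same: "x iA iC = \<delta>"
      using eqs(13) sq(2) q unfolding wts \<delta>_def by (simp add: fac q2 mult.assoc flip: power2_eq_square)
    have zs: "x iD iB = 0" "x iC iA = 0"
      using opp[OF BD] opp[of "iA" "iC"] same \<delta> by auto
    have zs': "x iB iA = 0" "x iA iB = 0" "x iA iD = 0" "x iC iD = 0" "x iD iA = 0" "x iD iC = 0"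
      using eqs(3) eqs(7) eqs(11) eqs(6) eqs(12) eqs(10) sq q2(3) \<open>q \<noteq> 1\<close> unfolding wts q2(1,2,4) by - (metis+)
    have "x = by_index (by_index 0 0 \<delta> 0) (by_index 0 0 0 \<delta>) (by_index 0 0 0 0) (by_index 0 0 0 0)"
      by (simp add: eq_by_index_iff zero zs zs' same \<delta>_def[symmetric])
    moreover have "w = by_index q q (q powi -1) (q powi -1)"
      by (simp add: eq_by_index_iff wts powi_simps)
    moreover have "lam = q powi -2" by (simp add: l powi_simps)
    ultimately show ?thesis
      using weight_list.w5[OF _ ord[OF wts(1)] \<delta>, of lam] by simp
  next
    case CD
    define \<delta> where "\<delta> = x iC iD"
    from eqs(6)[OF CD] have wt: "w iA = q" "w iD = inverse q" "w iB = inverse q" by (metis inv)+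
    have w': "w iC = q" using det q unfolding wt by (simp add: field_simps)
    note wts = wt w'
    have \<delta>: "\<delta> \<noteq> 0" using CD by (simp add: \<delta>_def)
    have l: "lam = inverse (q ^ 2)" using shift[OF CD] wts q by (simp add: field_simps power2_eq_square)
    have same: "x iA iB = \<delta>"
      using eqs(14) sq(2) q unfolding wts \<delta>_def by (simp add: fac q2 mult.assoc flip: power2_eq_square)
    have zs: "x iD iC = 0" "x iB iA = 0"
      using opp[OF CD] opp[of "iA" "iB"] same \<delta> by auto
    have zs': "x iC iA = 0" "x iA iC = 0" "x iA iD = 0" "x iB iD = 0" "x iD iA = 0" "x iD iB = 0"
      using eqs(4) eqs(8) eqs(11) eqs(5) eqs(12) eqs(9) sq q2(3) \<open>q \<noteq> 1\<close> unfolding wts q2(1,2,4) by - (metis+)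
    have "x = by_index (by_index 0 \<delta> 0 0) (by_index 0 0 0 0) (by_index 0 0 0 \<delta>) (by_index 0 0 0 0)"
      by (simp add: eq_by_index_iff zero zs zs' same \<delta>_def[symmetric])
    moreover have "w = by_index q (q powi -1) q (q powi -1)"
      by (simp add: eq_by_index_iff wts powi_simps)
    moreover have "lam = q powi -2" by (simp add: l powi_simps)
    ultimately show ?thesis
      using weight_list.w4[OF _ ord[OF wts(1)] \<delta>, of lam] by simp
  next
    case AB_AC
    have "q * w iB = 1 \<or> x iA iC = 0" "q * w iC = 1 \<or> x iA iB = 0" "w iD = q \<or> x iA iB = 0" "w iD = q \<or> x iA iC = 0"
      using eqs(13,14,17,18) q unfolding AB_AC by simp_all
    then have "q * w iB = 1" "q * w iC = 1" and wD: "w iD = q"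
      using AB_AC(5) eqs(7,8) by blast+
    then have wt: "w iB = inverse q" "w iC = inverse q" "w iD = q"
      by (metis inv)+
    have wA: "w iA = inverse (q ^ 3)"
      using det q unfolding wt by (simp add: field_simps power2_eq_square power3_eq_cube)
    have "w iB = lam * w iA \<or> w iC = lam * w iA" using AB_AC(5) shift by blast
    then have l: "lam = q powi 2"
      using q unfolding wt wA powi_simps by (simp add: field_simps power2_eq_square power3_eq_cube)
    have zs: "x iD iB = 0" "x iD iC = 0" "x iA iD = 0"
      using eqs(9,10,11) sq q2(3) \<open>q \<noteq> 1\<close> unfolding wt q2(1,2,4) by - (metis+)
    have xeq: "x = by_index (by_index 0 (x iA iB) (x iA iC) 0) (by_index 0 0 0 0) (by_index 0 0 0 0) (by_index (x iD iA) 0 0 0)"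
      by (simp add: eq_by_index_iff zero zs AB_AC)
    show ?thesis
    proof (cases "x iD iA = 0")
      case True
      have "w = by_index (q powi -3) (q powi -1) (q powi -1) q"
        by (simp add: eq_by_index_iff wt wA powi_simps)
      with True xeq weight_list.w3[OF l ord[OF wt(3)] AB_AC(5)] show ?thesis by simp
    next
      case False
      from eqs(12)[OF this] have wA1: "w iA = 1" by blast
      with wA have "q ^ 3 = 1" by (metis inverse_eq_1_iff)
      then have "mult_ord q = 3" using mult_ord_eq_3_iff q \<open>q \<noteq> 1\<close> by blast
      moreover have "w = by_index 1 (q powi -1) (q powi -1) q"
        by (simp add: eq_by_index_iff wt wA1 powi_simps)
      ultimately show ?thesis
        using False xeq weight_list.wi[OF _ l ord[OF wt(3)], of "x iD iA" "x iA iB" "x iA iC"] by simp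
    qed
  next
    case DB_DC
    have "w iB = q \<or> x iD iC = 0" "w iC = q \<or> x iD iB = 0" "q * w iA = 1 \<or> x iD iB = 0" "q * w iA = 1 \<or> x iD iC = 0"
      using eqs(15,16,19,20) q unfolding DB_DC by simp_all
    then have "w iB = q" "w iC = q" and wA: "q * w iA = 1"
      using DB_DC(5) eqs(9,10) by blast+
    then have wt: "w iB = q" "w iC = q" "w iA = inverse q"
      by (metis inv)+
    have wD: "w iD = q ^ 3"
      using det q unfolding wt by (simp add: field_simps power2_eq_square power3_eq_cube)
    have "w iB = lam * w iD \<or> w iC = lam * w iD" using DB_DC(5) shift by blast
    then have l: "lam = q powi -2"
      using q unfolding wt wD powi_simps by (simp add: field_simps power2_eq_square power3_eq_cube)
    have zs: "x iA iB = 0" "x iA iC = 0" "x iD iA = 0"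
      using eqs(7,8,12) sq q2(3) \<open>q \<noteq> 1\<close> unfolding wt by - (metis+)
    have xeq: "x = by_index (by_index 0 0 0 (x iA iD)) (by_index 0 0 0 0) (by_index 0 0 0 0) (by_index 0 (x iD iB) (x iD iC) 0)"
      by (simp add: eq_by_index_iff zero zs DB_DC)
    show ?thesis
    proof (cases "x iA iD = 0")
      case True
      have "w = by_index (q powi -1) q q (q powi 3)"
        by (simp add: eq_by_index_iff wt wD powi_simps)
      with True xeq weight_list.w6[OF l ord[OF wt(1)] DB_DC(5)] show ?thesis by simp
    next
      case False
      from eqs(11)[OF this] have wD1: "w iD = 1" by blast
      with wD have "q ^ 3 = 1" by simp
      then have "mult_ord q = 3" using mult_ord_eq_3_iff q \<open>q \<noteq> 1\<close> by blast
      moreover have "w = by_index (q powi -1) q q 1"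
        by (simp add: eq_by_index_iff wt wD1 powi_simps)
      ultimately show ?thesis
        using False xeq weight_list.wii[OF _ l ord[OF wt(1)], of "x iA iD" "x iD iB" "x iD iC"] by simp
    qed
  next
    case AD_DA
    have xeq: "x = by_index (by_index 0 0 0 (x iA iD)) (by_index 0 0 0 0) (by_index 0 0 0 0) (by_index (x iD iA) 0 0 0)"
      by (simp add: eq_by_index_iff zero AD_DA)
    show ?thesis
    proof (cases "x iA iD = 0")
      case False
      from eqs(11)[OF this] have wt: "w iB = inverse (q ^ 2)" "w iC = inverse (q ^ 2)" "w iD = 1"
        by (metis inverse_unique)+
      have wA: "w iA = inverse (q ^ 4)"
        using det unfolding wt by (simp add: power4_eq_xxxx power2_eq_square mult.assoc)
      have l: "lam = q powi 4"
        using shift[OF False] q unfolding wt wA powi_simps by (simp add: field_simps)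
      have "mult_ord (q powi 2) dvd n"
        using pow[of iB] q unfolding wt powi_simps by (simp add: mult_ord_dvd_iff power_inverse)
      moreover have "w = by_index (q powi -4) (q powi -2) (q powi -2) 1"
        by (simp add: eq_by_index_iff wt wA powi_simps)
      ultimately show ?thesis
        using opp[OF False] xeq weight_list.w7[OF l _ False, of n] by simp
    next
      case True
      then have DA: "x iD iA \<noteq> 0" using nz xeq unfolding all_index zero AD_DA by blast
      from eqs(12)[OF this] have wt: "w iB = q ^ 2" "w iC = q ^ 2" "w iA = 1" by blast+
      have wD: "w iD = q ^ 4"
        using det unfolding wt by (simp add: power4_eq_xxxx power2_eq_square mult.assoc)
      have l: "lam = q powi -4"
        using shift[OF DA] q unfolding wt wD powi_simps by (simp add: field_simps)
      have "mult_ord (q powi 2) dvd n"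
        using pow[of iB] q unfolding wt powi_simps by (simp add: mult_ord_dvd_iff)
      moreover have "w = by_index 1 (q powi 2) (q powi 2) (q powi 4)"
        by (simp add: eq_by_index_iff wt wD powi_simps)
      ultimately show ?thesis
        using True xeq weight_list.w8[OF l _ DA, of n] by simp
    qed
  qed
qed

section \<open>Automorphisms that involve the transposition\<close>

text \<open>A torus element composed with the transposition sends \<open>Y\<^sub>i\<^sub>j\<close> to \<open>w\<^sub>j\<^sub>i Y\<^sub>j\<^sub>i\<close>.\<close>

definition antidiagonal :: "(2 \<times> 2 \<Rightarrow> 'k::zero) \<Rightarrow> 2 \<times> 2 \<Rightarrow> 2 \<times> 2 \<Rightarrow> 'k" where
  "antidiagonal w = (\<lambda>y u. if u = prod.swap y then w u else 0)"

text \<open>Going around the pair \<open>B, C\<close> once multiplies by \<open>lam\<^sup>2\<close>, which kills the block of \<open>x\<close> on \<open>B\<close> and \<open>C\<close>; the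
  entries at \<open>(A,A)\<close> and \<open>(D,D)\<close> vanish because \<open>lam \<noteq> 1\<close>.  The
  relations for \<open>AB\<close>, \<open>AC\<close>, \<open>BD\<close>, \<open>CD\<close> then contain the rows of \<open>A\<close> and \<open>D\<close> in isolation, and their \<open>BC\<close>
  coefficients leave \<open>(q\<^sup>2 - 1)\<close> times the rest.\<close>

lemma antidiagonal_no_skew:
  fixes x :: "2 \<times> 2 \<Rightarrow> 2 \<times> 2 \<Rightarrow> 'k::field"
  assumes q: "q \<noteq> 0" "q ^ 2 \<noteq> 1" and lam: "lam \<noteq> 1" "lam ^ 2 \<noteq> 1" and w: "\<And>y. w y \<noteq> 0"
    and shift: "\<And>y z. x y (prod.swap z) * w z = lam * w (prod.swap y) * x (prod.swap y) z"
    and sol: "\<forall>r\<in>qmat_relations q. skew (\<lambda>y. lin_form (antidiagonal w y)) (\<lambda>y. lin_form (x y)) r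
       \<in> relation_ideal (qmat_relations q)"
  shows "x y z = 0"
proof -
  have lam2: "t = 0" if "t = lam * (lam * t)" for t
    using that lam by (auto simp: power2_eq_square)
  have AA: "x iA iA = 0" and DD: "x iD iD = 0"
    using shift[of iA iA] shift[of iD iD] w[of iA] w[of iD] lam by simp_all
  have "x iB iC * w iB = lam * (lam * (x iB iC * w iB))" "x iC iB * w iC = lam * (lam * (x iC iB * w iC))"
    using shift[of iB iB] shift[of iC iC] by (simp_all add: mult_ac)
  then have BC: "x iB iC = 0" and CB: "x iC iB = 0"
    using w lam2 by (metis mult_eq_0_iff)+
  have "x iB iB = lam * x iC iC" "x iC iC = lam * x iB iB"
    using shift[of iB iC] shift[of iC iB] w[of iB] w[of iC] by simp_all
  then have BB: "x iB iB = 0" and CC: "x iC iC = 0"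
    using lam2 by metis+
  note zero = AA BB CC DD BC CB
  note eqs = sol[unfolded skew_qmat_relations_iff null_quad_def Let_def skew_matrix_def antidiagonal_def]
  have outer: "x iA iB = 0" "x iA iC = 0" "x iA iD = 0" "x iD iA = 0" "x iD iB = 0" "x iD iC = 0"
    using eqs q w by (simp_all add: zero)
  have "q \<noteq> inverse q"
    using q by (metis power2_eq_square right_inverse)
  then have inner: "x iB iA = 0" "x iB iD = 0" "x iC iA = 0" "x iC iD = 0"
    using eqs q w by (simp_all add: zero outer)
  have "\<forall>y z. x y z = 0"
    unfolding all_index by (simp add: zero outer inner)
  then show ?thesis by blast
qed

section \<open>The torus and the transposition\<close>

lemma Y_eq_coset: "Y q i j = coset (qmat_relations q) (letter (i, j))"
  by (simp add: Y_def)

lemma lin_form_diagonal: "lin_form (diagonal w y) = scalar (w y) * letter y"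
  unfolding letter_eq_lin_form lin_form_scale
  by (rule arg_cong[where f = lin_form], rule ext) (simp add: diagonal_def)

lemma lin_form_antidiagonal: "lin_form (antidiagonal w y) = scalar (w (prod.swap y)) * letter (prod.swap y)"
  unfolding letter_eq_lin_form lin_form_scale
  by (rule arg_cong[where f = lin_form], rule ext) (simp add: antidiagonal_def)

text \<open>The rank one condition is what makes a diagonal map respect the relation for \<open>AD\<close>.\<close>

lemma diagonal_relations:
  assumes "w iA * w iD = w iB * w iC" and "r \<in> qmat_relations q"
  shows "free_hom scalar (\<lambda>y. lin_form (diagonal w y)) r \<in> relation_ideal (qmat_relations q)"
proof -
  have "w iB * w iC = w iD * w iA"
    using assms(1) by (simp add: mult.commute)
  with assms(2) show ?thesis
    by (intro free_hom_qmat_relations) (simp_all add: null_quad_def diagonal_def)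
qed

lemma swap_relations:
  assumes "r \<in> qmat_relations q"
  shows "free_hom scalar (\<lambda>y. lin_form (antidiagonal (\<lambda>_. 1) y)) r \<in> relation_ideal (qmat_relations q)"
  using assms
  by (rule free_hom_qmat_relations[rotated -1])
    (simp_all add: null_quad_def antidiagonal_def)

lemma free_hom_diagonal_pow:
  "(free_hom scalar (\<lambda>y. lin_form (diagonal w y)) ^^ n) (letter y) = scalar (w y ^ n) * letter y"
  by (induction n)
    (simp_all add: lin_form_diagonal scalar.free_hom_scale mult.commute flip: scalar_mult mult.assoc)

text \<open>\<^const>\<open>transposition\<close> is a definite description, so that existence and uniqueness have to be supplied before
  anything can be said about it.\<close>

lemma transposition_spec:
  "transposition q \<in> algebra_auts (qmat_relations q) \<and> (\<forall>i j. transposition q (Y q i j) = Y q j i)"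
proof -
  let ?\<gamma> = "\<lambda>y. lin_form (antidiagonal (\<lambda>_. 1) y) :: (2 \<times> 2) fword \<Rightarrow>\<^sub>0 'a"
  let ?t = "hom_induced (qmat_relations q) ?\<gamma>"
  have "(free_hom scalar ?\<gamma> ^^ 2) (letter y) = letter y" for y
    by (simp add: numeral_2_eq_2 lin_form_antidiagonal)
  then have "?t \<in> algebra_auts (qmat_relations q)"
    by (intro hom_induced_in_algebra_auts[where n = 2] swap_relations) simp_all
  moreover have "?t (Y q i j) = Y q j i" for i j
    unfolding Y_eq_coset by (subst hom_induced_coset[OF swap_relations]) (simp_all add: lin_form_antidiagonal)
  ultimately have spec: "?t \<in> algebra_auts (qmat_relations q) \<and> (\<forall>i j. ?t (Y q i j) = Y q j i)"
    by blast
  show ?thesis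
    unfolding transposition_def
  proof (rule theI[where a = ?t])
    show "?t \<in> algebra_auts (qmat_relations q) \<and> (\<forall>i j. ?t (Y q i j) = Y q j i)"
      by (rule spec)
    fix \<phi> assume "\<phi> \<in> algebra_auts (qmat_relations q) \<and> (\<forall>i j. \<phi> (Y q i j) = Y q j i)"
    then show "\<phi> = ?t"
      using spec by (intro algebra_auts_eqI[of _ "qmat_relations q"]) (simp_all add: Y_eq_coset split_paired_all)
  qed
qed

lemma generate_transposition:
  assumes "t \<in> generate (BijGroup (carrier (Oq q))) {transposition q}"
  shows "t \<in> Bij (carrier (Oq q)) \<and> ((\<forall>i j. t (Y q i j) = Y q i j) \<or> (\<forall>i j. t (Y q i j) = Y q j i))"
proof -
  let ?G = "BijGroup (carrier (Oq q))"
  interpret G: group ?G by (rule group_BijGroup)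
  have tr: "transposition q \<in> Bij (carrier (Oq q))" "\<And>i j. transposition q (Y q i j) = Y q j i"
    using transposition_spec[of q] by (auto simp: algebra_auts_def)
  have Y: "Y q i j \<in> carrier (Oq q)" for i j
    by (simp add: Y_eq_coset)
  show ?thesis
    using assms
  proof (induction rule: generate.induct)
    case one
    have "\<one>\<^bsub>?G\<^esub> \<in> Bij (carrier (Oq q))"
      using G.one_closed by (simp add: BijGroup_def)
    moreover have "\<one>\<^bsub>?G\<^esub> (Y q i j) = Y q i j" for i j
      by (simp add: BijGroup_def Y)
    ultimately show ?case by blast
  next
    case (incl h)
    then show ?case using tr by simp
  next
    case (inv h)
    then have h: "h = transposition q" by simp
    have "inv_into (carrier (Oq q)) (transposition q) (Y q i j) = Y q j i" for i j
      using tr Y by (intro inv_into_f_eq) (auto simp: Bij_def bij_betw_def)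
    then have "(inv\<^bsub>?G\<^esub> h) (Y q i j) = Y q j i" for i j
      unfolding h inv_BijGroup[OF tr(1)] by (simp add: Y)
    moreover have "inv\<^bsub>?G\<^esub> h \<in> Bij (carrier (Oq q))"
      unfolding h inv_BijGroup[OF tr(1)] by (rule restrict_inv_into_Bij[OF tr(1)])
    ultimately show ?case by blast
  next
    case (eng h1 h2)
    then have "h1 \<otimes>\<^bsub>?G\<^esub> h2 = compose (carrier (Oq q)) h1 h2"
      by (simp add: BijGroup_def)
    with eng show ?case
      by (auto simp: compose_Bij compose_eq Y)
  qed
qed

lemma torus_transposition_cases:
  assumes "\<phi> \<in> torus_transposition q"
  obtains w where "\<And>y. w y \<noteq> 0" "w iA * w iD = w iB * w iC"
    "\<And>y. \<phi> (coset (qmat_relations q) (letter y)) = coset (qmat_relations q) (lin_form (diagonal w y))"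
  | w where "\<And>y. w y \<noteq> 0"
    "\<And>y. \<phi> (coset (qmat_relations q) (letter y)) = coset (qmat_relations q) (lin_form (antidiagonal w y))"
proof -
  let ?G = "BijGroup (carrier (Oq q))"
  from assms obtain \<psi> t where \<psi>: "\<psi> \<in> torus q" and t: "t \<in> generate ?G {transposition q}"
    and \<phi>: "\<phi> = \<psi> \<otimes>\<^bsub>?G\<^esub> t"
    by (auto simp: torus_transposition_def Let_def set_mult_def)
  from \<psi> obtain \<alpha> :: "'a^2^2" where rank: "rank \<alpha> = 1" and nz: "\<forall>i j. vec_nth (vec_nth \<alpha> i) j \<noteq> 0"
    and act: "\<forall>i j. \<psi> (Y q i j) = smult_Oq q (vec_nth (vec_nth \<alpha> i) j) (Y q i j)"
    and "\<psi> \<in> Bij (carrier (Oq q))"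
    by (auto simp: torus_def algebra_auts_def)
  with generate_transposition[OF t] have comp: "\<phi> (Y q i j) = \<psi> (t (Y q i j))" for i j
    by (simp add: \<phi> BijGroup_def compose_eq Y_eq_coset)
  define w where "w p = vec_nth (vec_nth \<alpha> (fst p)) (snd p)" for p
  have w: "w y \<noteq> 0" for y using nz by (simp add: w_def)
  have "\<alpha> = (\<chi> i j. vec_nth (vec_nth \<alpha> i) j)" by (simp add: vec_eq_iff)
  then have det: "w iA * w iD = w iB * w iC"
    using rank_one_iff[of "\<lambda>i j. vec_nth (vec_nth \<alpha> i) j"] rank nz by (simp add: w_def)
  from generate_transposition[OF t] consider "\<forall>i j. t (Y q i j) = Y q i j" | "\<forall>i j. t (Y q i j) = Y q j i"
    by blast
  then show thesis
  proof cases
    case 1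
    with comp act have "\<phi> (coset (qmat_relations q) (letter y)) = coset (qmat_relations q) (lin_form (diagonal w y))" for y
      by (cases y) (simp add: lin_form_diagonal w_def Y_eq_coset scale_coset)
    with w det show thesis by (rule that(1))
  next
    case 2
    with comp act have "\<phi> (coset (qmat_relations q) (letter y)) = coset (qmat_relations q) (lin_form (antidiagonal w y))" for y
      by (cases y) (simp add: lin_form_antidiagonal w_def Y_eq_coset scale_coset)
    with w show thesis by (rule that(2))
  qed
qed

lemma diagonal_in_torus_transposition:
  assumes w: "\<And>y. w y \<noteq> 0" and det: "w iA * w iD = w iB * w iC" and pow: "\<And>y. w y ^ n = 1" and n: "n > 0"
  shows "hom_induced (qmat_relations q) (\<lambda>y. lin_form (diagonal w y)) \<in> torus_transposition q"
proof -
  let ?G = "BijGroup (carrier (Oq q))"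
  let ?h = "hom_induced (qmat_relations q) (\<lambda>y. lin_form (diagonal w y))"
  interpret G: group ?G by (rule group_BijGroup)
  have aut: "?h \<in> algebra_auts (qmat_relations q)"
    using n by (intro hom_induced_in_algebra_auts[of _ _ n] diagonal_relations det)
      (simp_all add: free_hom_diagonal_pow pow)
  have "?h \<in> torus q"
    unfolding torus_def
  proof (intro CollectI conjI aut exI)
    let ?\<alpha> = "(\<chi> i j. w (i, j)) :: 'a^2^2"
    show "rank ?\<alpha> = 1"
      using rank_one_iff[of "\<lambda>i j. w (i, j)"] w det by simp
    show "\<forall>i j. vec_nth (vec_nth ?\<alpha> i) j \<noteq> 0" using w by simp
    show "\<forall>i j. ?h (Y q i j) = smult_Oq q (vec_nth (vec_nth ?\<alpha> i) j) (Y q i j)"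
      unfolding Y_eq_coset scale_coset
      by (intro allI, subst hom_induced_coset[OF diagonal_relations[OF det]]) (simp_all add: lin_form_diagonal)
  qed
  moreover have "\<one>\<^bsub>?G\<^esub> \<in> generate ?G {transposition q}"
    by (rule generate.one)
  moreover have "?h \<otimes>\<^bsub>?G\<^esub> \<one>\<^bsub>?G\<^esub> = ?h"
    using aut by (intro G.r_one) (simp add: BijGroup_def algebra_auts_def)
  ultimately show ?thesis
    unfolding torus_transposition_def Let_def set_mult_def by force
qed

section \<open>Classification of the actions\<close>

definition entry_images :: "'k::field \<Rightarrow> (2 \<times> 2 \<Rightarrow> 'k) \<Rightarrow> (2 \<times> 2 \<Rightarrow> 2 \<times> 2 \<Rightarrow> 'k)
    \<Rightarrow> (2 \<Rightarrow> 2 \<Rightarrow> ((2 \<times> 2) fword \<Rightarrow>\<^sub>0 'k) set) \<times> (2 \<Rightarrow> 2 \<Rightarrow> ((2 \<times> 2) fword \<Rightarrow>\<^sub>0 'k) set)" where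
  "entry_images q w x =
    (\<lambda>i j. coset (qmat_relations q) (lin_form (diagonal w (i, j))),
     \<lambda>i j. coset (qmat_relations q) (lin_form (x (i, j))))"

lemma entry_images_by_index:
  "entry_images q (by_index a b c d) (by_index r1 r2 r3 r4) =
    (diag_g q a b c d, table (coset (qmat_relations q) (lin_form r1)) (coset (qmat_relations q) (lin_form r2))
       (coset (qmat_relations q) (lin_form r3)) (coset (qmat_relations q) (lin_form r4)))"
  by (simp add: entry_images_def diag_g_def fun_eq_iff lin_form_diagonal Y_eq_coset scale_coset by_index_def table_def)

lemma lin_form_by_index:
  "lin_form (by_index a b c d) = scalar a * letter iA + (scalar b * letter iB + (scalar c * letter iC + scalar d * letter iD))"
  by (simp add: lin_form_def UNIV_index)

lemma coset_rows:
  "coset (qmat_relations q) (lin_form (by_index 0 0 0 0)) = \<zero>\<^bsub>Oq q\<^esub>"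
  "coset (qmat_relations q) (lin_form (by_index \<delta> 0 0 0)) = smult_Oq q \<delta> (Y q 1 1)"
  "coset (qmat_relations q) (lin_form (by_index 0 \<delta> 0 0)) = smult_Oq q \<delta> (Y q 1 2)"
  "coset (qmat_relations q) (lin_form (by_index 0 0 \<delta> 0)) = smult_Oq q \<delta> (Y q 2 1)"
  "coset (qmat_relations q) (lin_form (by_index 0 0 0 \<delta>)) = smult_Oq q \<delta> (Y q 2 2)"
  "coset (qmat_relations q) (lin_form (by_index 0 \<delta> \<epsilon> 0)) = smult_Oq q \<delta> (Y q 1 2) \<oplus>\<^bsub>Oq q\<^esub> smult_Oq q \<epsilon> (Y q 2 1)"
  by (simp_all add: lin_form_by_index Y_eq_coset coset_simps)

text \<open>Entry by entry.  Zero rows are rewritten first, since the rules for rows with one or two entries match them too.\<close>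

lemma action_list_eq: "action_list q n lam = {entry_images q w x |w x. weight_list q n lam w x}"
proof (intro equalityI subsetI)
  fix a assume mem: "a \<in> action_list q n lam"
  obtain a1 a2 where a: "a = (a1, a2)" by (cases a)
  from mem[unfolded a] have "\<exists>w x. weight_list q n lam w x \<and> entry_images q w x = a"
  proof cases
    case (entry_1 \<delta>)
    show ?thesis
      unfolding a entry_1(1,2)
      by (intro exI conjI, rule weight_list.w1[OF entry_1(3-)])
        (simp only: entry_images_by_index coset_rows(1), simp only: coset_rows(2,4))
  next
    case (entry_2 \<delta>)
    show ?thesis
      unfolding a entry_2(1,2)
      by (intro exI conjI, rule weight_list.w2[OF entry_2(3-)])
        (simp only: entry_images_by_index coset_rows(1), simp only: coset_rows(2,3))
  next
    case (entry_3 \<delta> \<epsilon>)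
    show ?thesis
      unfolding a entry_3(1,2)
      by (intro exI conjI, rule weight_list.w3[OF entry_3(3-)])
        (simp only: entry_images_by_index coset_rows(1), simp only: coset_rows(6))
  next
    case (entry_4 \<delta>)
    show ?thesis
      unfolding a entry_4(1,2)
      by (intro exI conjI, rule weight_list.w4[OF entry_4(3-)])
        (simp only: entry_images_by_index coset_rows(1), simp only: coset_rows(3,5))
  next
    case (entry_5 \<delta>)
    show ?thesis
      unfolding a entry_5(1,2)
      by (intro exI conjI, rule weight_list.w5[OF entry_5(3-)])
        (simp only: entry_images_by_index coset_rows(1), simp only: coset_rows(4,5))
  next
    case (entry_6 \<delta> \<epsilon>)
    show ?thesis
      unfolding a entry_6(1,2)
      by (intro exI conjI, rule weight_list.w6[OF entry_6(3-)])
        (simp only: entry_images_by_index coset_rows(1), simp only: coset_rows(6))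
  next
    case (entry_7 \<delta>)
    show ?thesis
      unfolding a entry_7(1,2)
      by (intro exI conjI, rule weight_list.w7[OF entry_7(3-)])
        (simp only: entry_images_by_index coset_rows(1), simp only: coset_rows(5))
  next
    case (entry_8 \<delta>)
    show ?thesis
      unfolding a entry_8(1,2)
      by (intro exI conjI, rule weight_list.w8[OF entry_8(3-)])
        (simp only: entry_images_by_index coset_rows(1), simp only: coset_rows(2))
  next
    case (entry_i \<gamma> \<delta> \<epsilon>)
    show ?thesis
      unfolding a entry_i(1,2)
      by (intro exI conjI, rule weight_list.wi[OF entry_i(3-)])
        (simp only: entry_images_by_index coset_rows(1), simp only: coset_rows(2,6))
  next
    case (entry_ii \<gamma> \<delta> \<epsilon>)
    show ?thesis
      unfolding a entry_ii(1,2)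
      by (intro exI conjI, rule weight_list.wii[OF entry_ii(3-)])
        (simp only: entry_images_by_index coset_rows(1), simp only: coset_rows(5,6))
  qed
  then show "a \<in> {entry_images q w x |w x. weight_list q n lam w x}" by blast
next
  fix a assume "a \<in> {entry_images q w x |w x. weight_list q n lam w x}"
  then obtain w x where a: "a = entry_images q w x" and "weight_list q n lam w x" by blast
  from this(2) show "a \<in> action_list q n lam"
  proof cases
    case (w1 \<delta>)
    show ?thesis unfolding a w1(1,2) entry_images_by_index coset_rows(1) unfolding coset_rows(2,4)
      by (rule entry_1[OF w1(3-)])
  next
    case (w2 \<delta>)
    show ?thesis unfolding a w2(1,2) entry_images_by_index coset_rows(1) unfolding coset_rows(2,3)
      by (rule entry_2[OF w2(3-)])
  next
    case (w3 \<delta> \<epsilon>)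
    show ?thesis unfolding a w3(1,2) entry_images_by_index coset_rows(1) unfolding coset_rows(6)
      by (rule entry_3[OF w3(3-)])
  next
    case (w4 \<delta>)
    show ?thesis unfolding a w4(1,2) entry_images_by_index coset_rows(1) unfolding coset_rows(3,5)
      by (rule entry_4[OF w4(3-)])
  next
    case (w5 \<delta>)
    show ?thesis unfolding a w5(1,2) entry_images_by_index coset_rows(1) unfolding coset_rows(4,5)
      by (rule entry_5[OF w5(3-)])
  next
    case (w6 \<delta> \<epsilon>)
    show ?thesis unfolding a w6(1,2) entry_images_by_index coset_rows(1) unfolding coset_rows(6)
      by (rule entry_6[OF w6(3-)])
  next
    case (w7 \<delta>)
    show ?thesis unfolding a w7(1,2) entry_images_by_index coset_rows(1) unfolding coset_rows(5)
      by (rule entry_7[OF w7(3-)])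
  next
    case (w8 \<delta>)
    show ?thesis unfolding a w8(1,2) entry_images_by_index coset_rows(1) unfolding coset_rows(2)
      by (rule entry_8[OF w8(3-)])
  next
    case (wi \<gamma> \<delta> \<epsilon>)
    show ?thesis unfolding a wi(1,2) entry_images_by_index coset_rows(1) unfolding coset_rows(2,6)
      by (rule entry_i[OF wi(3-)])
  next
    case (wii \<gamma> \<delta> \<epsilon>)
    show ?thesis unfolding a wii(1,2) entry_images_by_index coset_rows(1) unfolding coset_rows(5,6)
      by (rule entry_ii[OF wii(3-)])
  qed
qed

lemma weight_list_nonempty_iff:
  "(\<exists>w x. weight_list q n lam w x) \<longleftrightarrow>
    (lam = q powi 2 \<or> lam = q powi -2) \<and> mult_ord q dvd n \<or>
    (lam = q powi 4 \<or> lam = q powi -4) \<and> mult_ord (q powi 2) dvd n" (is "?L \<longleftrightarrow> ?R")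
proof
  assume ?L
  then show ?R by (auto elim: weight_list.cases)
next
  assume ?R
  then consider "lam = q powi 2" "mult_ord q dvd n" | "lam = q powi -2" "mult_ord q dvd n"
    | "lam = q powi 4" "mult_ord (q powi 2) dvd n" | "lam = q powi -4" "mult_ord (q powi 2) dvd n" by blast
  then show ?L
  proof cases
    case 1 then show ?thesis by (intro exI) (rule weight_list.w1[where \<delta> = 1]; simp)
  next
    case 2 then show ?thesis by (intro exI) (rule weight_list.w4[where \<delta> = 1]; simp)
  next
    case 3 then show ?thesis by (intro exI) (rule weight_list.w7[where \<delta> = 1]; simp)
  next
    case 4 then show ?thesis by (intro exI) (rule weight_list.w8[where \<delta> = 1]; simp)
  qed
qed

lemma gen_span_eq: "gen_span q = range (\<lambda>c. coset (qmat_relations q) (lin_form c))"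
  by (simp add: gen_span_def Y_eq_coset scale_coset finsum_coset lin_form_def)

lemma free_hom_lin_form:
  fixes g :: "'g::finite \<Rightarrow> 'g \<Rightarrow> 'k::field"
  shows "free_hom scalar (\<lambda>y. lin_form (g y)) (lin_form c) = lin_form (\<lambda>z. \<Sum>y\<in>UNIV. c y * g y z)"
proof -
  have "free_hom scalar \<gamma> (lin_form c) = skew (\<lambda>_. 0) \<gamma> (lin_form c)" for \<gamma> :: "'g \<Rightarrow> 'g fword \<Rightarrow>\<^sub>0 'k"
    by (simp add: lin_form_def linear_op_sum[OF linear_op_skew] linear_op_scale[OF linear_op_skew]
        linear_op_sum[OF linear_op_free_hom] linear_op_scale[OF linear_op_free_hom])
  then show ?thesis by (simp add: skew_lin_form)
qed

lemma skew_trivial: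
  assumes "\<And>y. \<xi> y = 0"
  shows "skew \<gamma> \<xi> f = 0"
proof -
  have "skew_word \<gamma> \<xi> w = 0" for w
    by (induction w) (simp_all add: assms)
  then show ?thesis by (simp add: skew_def lin_ext_def)
qed

lemma coset_eq_zero: "f \<in> relation_ideal S \<Longrightarrow> coset S f = coset S 0"
  by (simp add: coset_eq_iff)

text \<open>Each relation of either algebra acts as zero.  Comparing representatives in degrees one and two turns this into
  equations between matrix entries.\<close>

lemma taft_action_constraints:
  fixes g x :: "2 \<times> 2 \<Rightarrow> 2 \<times> 2 \<Rightarrow> 'k::field"
  assumes \<rho>: "module_algebra (taft_relations n lam m) taft_comult taft_counit (qmat_relations q) \<rho>"
    and g: "\<And>y. \<rho> (taft_g n lam m) (coset (qmat_relations q) (letter y)) = coset (qmat_relations q) (lin_form (g y))"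
    and x: "\<And>y. \<rho> (taft_x n lam m) (coset (qmat_relations q) (letter y)) = coset (qmat_relations q) (lin_form (x y))"
  shows "\<forall>r\<in>qmat_relations q. skew (\<lambda>y. lin_form (g y)) (\<lambda>y. lin_form (x y)) r \<in> relation_ideal (qmat_relations q)"
    and "(\<Sum>u\<in>UNIV. x y u * g u z) = lam * (\<Sum>u\<in>UNIV. g y u * x u z)"
    and "Poly_Mapping.lookup ((free_hom scalar (\<lambda>y. lin_form (g y)) ^^ n) (letter y)) (FWord [z]) = (if z = y then 1 else 0)"
    and "(\<And>y z. x y z = 0) \<Longrightarrow> r \<in> carrier (Oq q) \<Longrightarrow> \<rho> (taft_x n lam m) r = \<zero>\<^bsub>Oq q\<^esub>"
proof -
  let ?S = "taft_relations n lam m" and ?Q = "qmat_relations q"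
  let ?\<gamma> = "\<lambda>y. lin_form (g y)" and ?\<xi> = "\<lambda>y. lin_form (x y)"
  note E = taft_action_eq_act[OF \<rho>, of ?\<gamma> ?\<xi>, OF g x]
  have kill: "act ?\<gamma> ?\<xi> h f \<in> relation_ideal ?Q" if "h \<in> ?S" for h f
  proof -
    have "coset ?Q (act ?\<gamma> ?\<xi> h f) = coset ?Q (act ?\<gamma> ?\<xi> 0 f)"
      unfolding E[symmetric] using that by (simp only: coset_eq_zero[OF relation_ideal_base])
    then show ?thesis
      by (simp add: coset_eq_iff linear_op_zero[OF linear_op_act_left])
  qed
  show "\<forall>r\<in>?Q. skew ?\<gamma> ?\<xi> r \<in> relation_ideal ?Q"
  proof
    fix r assume "r \<in> ?Q"
    then have "coset ?Q (act ?\<gamma> ?\<xi> (letter Sk) r) = coset ?Q (act ?\<gamma> ?\<xi> (letter Sk) 0)"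
      unfolding E[symmetric] by (simp only: coset_eq_zero[OF relation_ideal_base])
    then show "skew ?\<gamma> ?\<xi> r \<in> relation_ideal ?Q"
      by (simp add: coset_eq_iff linear_op_zero[OF linear_op_skew])
  qed
  have "act ?\<gamma> ?\<xi> (letter Gr * letter Sk - scalar lam * letter Sk * letter Gr) (letter y) \<in> relation_ideal ?Q"
    by (rule kill) (simp add: taft_relations_def Let_def)
  from relation_ideal_qmat_low(1)[OF this, of z]
  show "(\<Sum>u\<in>UNIV. x y u * g u z) = lam * (\<Sum>u\<in>UNIV. g y u * x u z)"
    by (simp add: linear_op_diff[OF linear_op_act_left] act_mult free_hom_lin_form skew_lin_form
        lookup_minus lookup_lin_form)
  have "act ?\<gamma> ?\<xi> (letter Gr ^ n - 1) (letter y) \<in> relation_ideal ?Q"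
    by (rule kill) (simp add: taft_relations_def Let_def)
  from relation_ideal_qmat_low(1)[OF this, of z]
  show "Poly_Mapping.lookup ((free_hom scalar ?\<gamma> ^^ n) (letter y)) (FWord [z]) = (if z = y then 1 else 0)"
    by (simp add: linear_op_diff[OF linear_op_act_left] act_power act_Gr[abs_def] lookup_minus lookup_letter)
  assume zero: "\<And>y z. x y z = 0" and "r \<in> carrier (Oq q)"
  then obtain f where "r = coset ?Q f" by (auto simp: carrier_presented)
  moreover have "lin_form (x y) = 0" for y
    by (simp add: lin_form_def zero)
  then have "skew ?\<gamma> ?\<xi> f = 0" by (rule skew_trivial)
  ultimately show "\<rho> (taft_x n lam m) r = \<zero>\<^bsub>Oq q\<^esub>"
    using E[of "letter Sk" f] by (simp add: taft_x_def coset_zero)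
qed

lemma taft_actions_classified:
  assumes q: "q \<noteq> 0" "q ^ 2 \<noteq> 1" and lam: "lam \<noteq> 1" "lam ^ 2 \<noteq> 1" and \<rho>: "\<rho> \<in> taft_actions q n lam m"
  obtains w x where "weight_list q n lam w x" "generator_images q n lam m \<rho> = entry_images q w x"
proof -
  let ?Q = "qmat_relations q"
  have mod: "module_algebra (taft_relations n lam m) taft_comult taft_counit ?Q \<rho>"
    and span: "\<And>v. v \<in> gen_span q \<Longrightarrow> \<rho> (taft_x n lam m) v \<in> gen_span q"
    and nz: "\<exists>r\<in>carrier (Oq q). \<rho> (taft_x n lam m) r \<noteq> \<zero>\<^bsub>Oq q\<^esub>"
    and tt: "\<rho> (taft_g n lam m) \<in> torus_transposition q"
    using \<rho> by (auto simp: taft_actions_def)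
  have "\<exists>c. \<rho> (taft_x n lam m) (coset ?Q (letter y)) = coset ?Q (lin_form c)" for y
    using span[of "coset ?Q (letter y)"] unfolding gen_span_eq letter_eq_lin_form by blast
  then obtain x where x: "\<And>y. \<rho> (taft_x n lam m) (coset ?Q (letter y)) = coset ?Q (lin_form (x y))"
    by metis
  from tt show thesis
  proof (cases rule: torus_transposition_cases)
    case (1 w)
    note C = taft_action_constraints[OF mod 1(3) x]
    have shift: "x y z * w z = lam * (w y * x y z)" for y z
      using C(2)[of y z] by (simp add: diagonal_def if_distrib[of "\<lambda>t. t * _"] if_distrib[of "\<lambda>t. _ * t"] cong: if_cong)
    have "w y ^ n = 1" for y
      using C(3)[of y y] by (simp add: free_hom_diagonal_pow lookup_letter)
    moreover have "w z = lam * w y" if "x y z \<noteq> 0" for y z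
      using shift[of y z] that by simp
    moreover have "x y y = 0" for y
      using shift[of y y] 1(1)[of y] lam by auto
    then have "diagonal_system q w x"
      using C(1) skew_diagonal_iff[of x q w] by blast
    moreover have "\<not> (\<forall>y z. x y z = 0)"
      using C(4) nz by blast
    ultimately have "weighted_solution q n lam w x"
      using 1 unfolding weighted_solution_def by blast
    then have "weight_list q n lam w x"
      by (rule weight_list_complete[OF q lam])
    moreover have "generator_images q n lam m \<rho> = entry_images q w x"
      by (simp add: generator_images_def entry_images_def Y_eq_coset 1 x)
    ultimately show thesis by (rule that)
  next
    case (2 w)
    note C = taft_action_constraints[OF mod 2(2) x]
    have shift: "x y (prod.swap z) * w z = lam * w (prod.swap y) * x (prod.swap y) z" for y z
    proof -
      have column: "antidiagonal w u z = (if u = prod.swap z then w z else 0)" for u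
        unfolding antidiagonal_def by (rule if_cong) (metis swap_swap, rule refl, rule refl)
      have "(\<Sum>u\<in>UNIV. x y u * antidiagonal w u z) = x y (prod.swap z) * w z"
        unfolding column by (simp add: if_distrib[of "\<lambda>t. _ * t"] cong: if_cong)
      moreover have "(\<Sum>u\<in>UNIV. antidiagonal w y u * x u z) = w (prod.swap y) * x (prod.swap y) z"
        unfolding antidiagonal_def by (simp add: if_distrib[of "\<lambda>t. t * _"] cong: if_cong)
      ultimately show ?thesis using C(2)[of y z] by (simp only: mult.assoc)
    qed
    have "x y z = 0" for y z
      by (rule antidiagonal_no_skew[OF q lam 2(1) shift C(1)])
    with C(4) nz have False by blast
    then show thesis ..
  qed
qed

text \<open>Equality of functions follows from equality on residue classes because actions are extensional.\<close>

lemma taft_actions_determined: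
  assumes "\<rho> \<in> taft_actions q n lam m" "\<rho>' \<in> taft_actions q n lam m"
    and im: "generator_images q n lam m \<rho> = entry_images q w x" "generator_images q n lam m \<rho>' = entry_images q w x"
  shows "\<rho> = \<rho>'"
proof -
  let ?Q = "qmat_relations q" and ?S = "taft_relations n lam m"
  have act: "\<sigma> (coset ?S h) (coset ?Q f) = coset ?Q (act (\<lambda>y. lin_form (diagonal w y)) (\<lambda>y. lin_form (x y)) h f)"
    if "\<sigma> \<in> taft_actions q n lam m" "generator_images q n lam m \<sigma> = entry_images q w x" for \<sigma> h f
  proof (rule taft_action_eq_act)
    show "module_algebra ?S taft_comult taft_counit ?Q \<sigma>"
      using that by (simp add: taft_actions_def)
    show "\<sigma> (taft_g n lam m) (coset ?Q (letter y)) = coset ?Q (lin_form (diagonal w y))"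
      "\<sigma> (taft_x n lam m) (coset ?Q (letter y)) = coset ?Q (lin_form (x y))" for y
      using that(2) by (cases y; simp add: generator_images_def entry_images_def Y_eq_coset fun_eq_iff)+
  qed
  have ext: "\<sigma> \<in> carrier (presented ?S) \<rightarrow>\<^sub>E (carrier (Oq q) \<rightarrow>\<^sub>E carrier (Oq q))"
    if "\<sigma> \<in> taft_actions q n lam m" for \<sigma>
    using that module_algebraD(1) unfolding taft_actions_def by blast
  show ?thesis
  proof (rule PiE_ext[OF ext ext])
    fix h assume h: "h \<in> carrier (presented ?S)"
    show "\<rho> h = \<rho>' h"
    proof (rule PiE_ext[OF PiE_mem[OF ext h] PiE_mem[OF ext h]])
      fix r assume "r \<in> carrier (Oq q)"
      with h obtain h0 f where "h = coset ?S h0" "r = coset ?Q f"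
        unfolding carrier_presented by blast
      then show "\<rho> h r = \<rho>' h r"
        by (simp only: act[OF assms(1) im(1)] act[OF assms(2) im(2)])
    qed (use assms in auto)
  qed (use assms in auto)
qed

lemma graded_skew_cubed:
  fixes x :: "'g::finite \<Rightarrow> 'g \<Rightarrow> 'k::field" and r :: "'g \<Rightarrow> nat"
  assumes r: "\<And>y. r y \<le> 2" and lower: "\<And>y z. x y z \<noteq> 0 \<Longrightarrow> r z < r y" and m: "m \<ge> 3"
  shows "(skew \<gamma> (\<lambda>y. lin_form (x y)) ^^ m) (letter y) = 0"
proof -
  let ?X = "skew \<gamma> (\<lambda>y. lin_form (x y))"
  have "(\<Sum>v\<in>UNIV. (\<Sum>u\<in>UNIV. x y u * x u v) * x v z) = 0" for z
  proof -
    have "x y u * x u v * x v z = 0" for u v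
      using lower[of y u] lower[of u v] lower[of v z] r[of y] by fastforce
    then show ?thesis by (simp only: sum_distrib_right sum.neutral_const)
  qed
  then have "?X (?X (?X (letter y))) = 0"
    by (simp add: skew_lin_form) (simp add: lin_form_def)
  moreover have "(?X ^^ k) 0 = 0" for k
    by (rule linear_op_zero[OF linear_op_funpow[OF linear_op_skew]])
  moreover have "(?X ^^ m) (letter y) = (?X ^^ (m - 3)) (?X (?X (?X (letter y))))"
  proof -
    have "m = (m - 3) + 3" using m by simp
    then have "?X ^^ m = ?X ^^ (m - 3) \<circ> ?X ^^ 3" by (metis funpow_add)
    then show ?thesis by (simp add: numeral_3_eq_3)
  qed
  ultimately show ?thesis by simp
qed

text \<open>For the listed weights and matrices all conditions for descent hold; \<open>x\<close> is nonzero in the quotient because the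
  ideal has no linear part.\<close>

lemma weight_list_realised:
  assumes q: "q \<noteq> 0" and n: "n > 0" and m: "m \<ge> 3"
    and lam: "lam ^ m = 1" "\<And>j. 0 < j \<Longrightarrow> j < m \<Longrightarrow> lam ^ j \<noteq> 1"
    and wl: "weight_list q n lam w x"
  shows "\<exists>\<rho>\<in>taft_actions q n lam m. generator_images q n lam m \<rho> = entry_images q w x"
proof -
  let ?Q = "qmat_relations q" and ?S = "taft_relations n lam m"
  from weight_list_sound[OF q wl] have w: "w y \<noteq> 0" and det: "w iA * w iD = w iB * w iC"
    and pow: "w y ^ n = 1" and shift: "x y z \<noteq> 0 \<Longrightarrow> w z = lam * w y"
    and nz: "\<not> (\<forall>y z. x y z = 0)" and sys: "diagonal_system q w x" for y z
    unfolding weighted_solution_def by blast+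
  from weight_list_graded[OF wl] obtain r :: "2 \<times> 2 \<Rightarrow> nat"
    where r: "\<And>y. r y \<le> 2" "\<And>y z. x y z \<noteq> 0 \<Longrightarrow> r z < r y" by blast
  have diag: "x y y = 0" for y using r(2)[of y y] by blast
  interpret D: taft_descent ?Q "\<lambda>y. lin_form (diagonal w y)" "\<lambda>y. lin_form (x y)" n m lam
  proof
    show "free_hom scalar (\<lambda>y. lin_form (diagonal w y)) r \<in> relation_ideal ?Q" if "r \<in> ?Q" for r
      using that by (rule diagonal_relations[OF det])
    show "skew (\<lambda>y. lin_form (diagonal w y)) (\<lambda>y. lin_form (x y)) r \<in> relation_ideal ?Q" if "r \<in> ?Q" for r
      using that sys skew_diagonal_iff[of x q w, OF diag] by blast
    show "(free_hom scalar (\<lambda>y. lin_form (diagonal w y)) ^^ n) (letter y) = letter y" for y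
      by (simp add: free_hom_diagonal_pow pow)
    show "(skew (\<lambda>y. lin_form (diagonal w y)) (\<lambda>y. lin_form (x y)) ^^ m) (letter y) = 0" for y
      by (rule graded_skew_cubed[OF r m])
    show "free_hom scalar (\<lambda>y. lin_form (diagonal w y)) (lin_form (x y))
        = scalar lam * skew (\<lambda>y. lin_form (diagonal w y)) (\<lambda>y. lin_form (x y)) (lin_form (diagonal w y))" for y
    proof -
      have "x y z * w z = lam * (w y * x y z)" for z
        using shift[of y z] by (cases "x y z = 0") simp_all
      then have "lin_form (\<lambda>z. x y z * w z) = lin_form (\<lambda>z. lam * (w y * x y z))"
        by presburger
      then show ?thesis
        by (simp add: free_hom_lin_form skew_lin_form lin_form_scale diagonal_def
            if_distrib[of "\<lambda>t. t * _"] if_distrib[of "\<lambda>t. _ * t"] cong: if_cong)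
    qed
  qed (use lam m in auto)
  have g: "D.descended (taft_g n lam m) (coset ?Q f) = coset ?Q (free_hom scalar (\<lambda>y. lin_form (diagonal w y)) f)"
    and x: "D.descended (taft_x n lam m) (coset ?Q f) = coset ?Q (skew (\<lambda>y. lin_form (diagonal w y)) (\<lambda>y. lin_form (x y)) f)" for f
    by (simp_all add: taft_g_def taft_x_def D.descended_coset)
  have "D.descended (taft_g n lam m) = hom_induced ?Q (\<lambda>y. lin_form (diagonal w y))"
  proof (rule extensionalityI)
    show "D.descended (taft_g n lam m) \<in> extensional (carrier (Oq q))"
      by (simp add: D.descended_def taft_g_def)
    show "hom_induced ?Q (\<lambda>y. lin_form (diagonal w y)) \<in> extensional (carrier (Oq q))"
      by (simp add: hom_induced_def)
    show "D.descended (taft_g n lam m) c = hom_induced ?Q (\<lambda>y. lin_form (diagonal w y)) c" if "c \<in> carrier (Oq q)" for c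
      using that by (auto simp: carrier_presented g hom_induced_coset[OF diagonal_relations[OF det]])
  qed
  then have tt: "D.descended (taft_g n lam m) \<in> torus_transposition q"
    using diagonal_in_torus_transposition[of w n q] w det pow n by simp
  have span: "D.descended (taft_x n lam m) v \<in> gen_span q" if "v \<in> gen_span q" for v
    using that by (auto simp: gen_span_eq x skew_lin_form)
  from nz obtain y z where yz: "x y z \<noteq> 0" by blast
  have "coset ?Q (lin_form (x y)) \<noteq> coset ?Q 0"
    using relation_ideal_qmat_low(1)[of "lin_form (x y)" q z] yz by (auto simp: coset_eq_iff lookup_lin_form)
  then have "\<exists>r\<in>carrier (Oq q). D.descended (taft_x n lam m) r \<noteq> \<zero>\<^bsub>Oq q\<^esub>"
    using x[of "letter y"] by (intro bexI[of _ "coset ?Q (letter y)"]) (simp_all add: coset_zero)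
  then have "D.descended \<in> taft_actions q n lam m"
    using D.module_algebra_descended span tt by (simp add: taft_actions_def)
  moreover have "generator_images q n lam m D.descended = entry_images q w x"
    by (simp add: generator_images_def entry_images_def Y_eq_coset g x)
  ultimately show ?thesis by blast
qed

theorem proposition4p4:
  fixes q lam :: "'k::{alg_closed_field, field_char_0}" and n m :: nat
  assumes "q \<noteq> 0" and "q \<noteq> 1" and "q \<noteq> -1"
    and "n > 0" and "m dvd n" and "mult_ord lam = m" and "m \<ge> 3"
  shows "(taft_actions q n lam m \<noteq> {} \<longleftrightarrow>
            (lam = q powi 2 \<or> lam = q powi -2) \<and> mult_ord q dvd n \<or>
            (lam = q powi 4 \<or> lam = q powi -4) \<and> mult_ord (q powi 2) dvd n) \<and>
         bij_betw (generator_images q n lam m) (taft_actions q n lam m) (action_list q n lam)"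
proof -
  have q2: "q ^ 2 \<noteq> 1" using assms(2,3) by (simp add: power2_eq_1_iff)
  have ord: "lam ^ k = 1 \<longleftrightarrow> m dvd k" for k
    using mult_ord_dvd_iff[of lam k] assms(6) by simp
  have "\<not> m dvd 1" "\<not> m dvd 2"
    using assms(7) by (auto dest: dvd_imp_le)
  then have lam: "lam \<noteq> 1" "lam ^ 2 \<noteq> 1"
    using ord[of 1] ord[of 2] by simp_all
  have prim: "lam ^ m = 1" "\<And>j. 0 < j \<Longrightarrow> j < m \<Longrightarrow> lam ^ j \<noteq> 1"
    by (auto simp: ord dest: dvd_imp_le)
  let ?im = "generator_images q n lam m" and ?A = "taft_actions q n lam m"
  have image: "?im ` ?A = action_list q n lam"
  proof (intro equalityI subsetI)
    fix a assume "a \<in> ?im ` ?A"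
    then show "a \<in> action_list q n lam"
      unfolding action_list_eq by (auto elim!: taft_actions_classified[OF assms(1) q2 lam])
  next
    fix a assume "a \<in> action_list q n lam"
    then obtain w x where "a = entry_images q w x" "weight_list q n lam w x"
      unfolding action_list_eq by blast
    with weight_list_realised[OF assms(1,4,7) prim, of w x] show "a \<in> ?im ` ?A"
      by force
  qed
  have "inj_on ?im ?A"
  proof (rule inj_onI)
    fix \<rho> \<rho>' assume \<rho>: "\<rho> \<in> ?A" "\<rho>' \<in> ?A" and eq: "?im \<rho> = ?im \<rho>'"
    obtain w x where "?im \<rho> = entry_images q w x"
      using taft_actions_classified[OF assms(1) q2 lam \<rho>(1)] by metis
    with \<rho> eq show "\<rho> = \<rho>'"
      by (intro taft_actions_determined[of _ q n lam m _ w x]) simp_all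
  qed
  moreover have "?A \<noteq> {} \<longleftrightarrow> (\<exists>w x. weight_list q n lam w x)"
    using image unfolding action_list_eq by blast
  ultimately show ?thesis
    using image by (simp only: bij_betw_def weight_list_nonempty_iff)
qed

end
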